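(* Let $\mathcal{A},\mathcal{B}$ be $2$-categories, $\Sigma$ a wide $1$-subcategory of $\mathcal{A}$, and $W:\mathcal{A}^{op}\to\mathcal{C}at$, $P:\mathcal{A}\to\mathcal{B}$ $2$-functors. Then $$W\otimes_\sigma P \;=\; k_1\otimes_\sigma P\Diamond_W^{op}\;=\;\underset{(x,A)\in\mathcal{E}l_W^{op}}{\sigma\mathrm{colim}^{\mathscr{C}_\Sigma}}\,PA,\qquad W\,{}_{bi}\!\otimes_\sigma P\;=\;k_1\,{}_{bi}\!\otimes_\sigma P\Diamond_W^{op}\;=\;\underset{(x,A)\in\mathcal{E}l_W^{op}}{\sigma\mathrm{bicolim}^{\mathscr{C}_\Sigma}}\,PA,$$ meaning that the universal properties defining each of the objects are equivalent. (Here $W\otimes_\sigma P$ is taken with respect to $\Sigma$, and the $\sigma$-(bi)colimits of $P\Diamond_W^{op}:\mathcal{E}l_W^{op}\to\mathcal{B}$ with respect to $\mathscr{C}_\Sigma$.) In particular, taking $\Sigma=\mathcal{A}_0$ (all arrows of $\mathcal{A}$), $$W\otimes_pP=\underset{(x,A)\in\mathcal{E}l_W^{op}}{\sigma\mathrm{colim}^{\mathscr{C}_W}}\,PA,\qquad W\,{}_{bi}\!\otimes_pP=\underset{(x,A)\in\mathcal{E}l_W^{op}}{\sigma\mathrm{bicolim}^{\mathscr{C}_W}}\,PA .$$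
   Context: $2$-categories and $2$-functors are strict; $\mathcal{A}^{op}$ reverses $1$-cells but not $2$-cells. A wide $1$-subcategory is a subcategory of the underlying category containing all objects; $\Sigma$ is also regarded as a wide $1$-subcategory of $\mathcal{A}^{op}$. For $2$-functors $F,G:\mathcal{A}\to\mathcal{B}$, a lax natural transformation $\theta:F\Rightarrow G$ consists of $\theta_A:FA\to GA$ and $\theta_f: Gf\,\theta_A\Rightarrow\theta_B\,Ff$ ($f:A\to B$) with $\theta_{id_A}=id_{\theta_A}$, $\theta_{gf}=\theta_gFf\circ Gg\,\theta_f$, and $\theta_BF\gamma\circ\theta_f=\theta_g\circ G\gamma\,\theta_A$ for $\gamma:f\Rightarrow g$. It is $\sigma$-natural (with respect to $\Sigma$) if $\theta_f$ is invertible for all $f\in\Sigma$, and pseudonatural if all $\theta_f$ are invertible. $\mathcal{H}om_\sigma^\Sigma(\mathcal{A},\mathcal{B})$ (resp. $\mathcal{H}om_p$) is the $2$-category of $2$-functors, $\sigma$-natural (resp. pseudonatural) transformations and modifications. Weighted $\sigma$-colimits: $W\otimes_\sigma P$ is an object $E$ of $\mathcal{B}$ with a $\sigma$-natural $\nu:W\Rightarrow\mathcal{B}(P-,E)$ such that for all $B$ precomposition with $\nu$, $\mathcal{B}(E,B)\to\mathcal{H}om_\sigma^\Sigma(\mathcal{A}^{op},\mathcal{C}at)(W,\mathcal{B}(P-,B))$, is an isomorphism of categories. The $\sigma$-bicolimit $W\,{}_{bi}\!\otimes_\sigma P$ is defined in the same way with "equivalence" in place of "isomorphism". $\otimes_p$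 and ${}_{bi}\!\otimes_p$ denote the same with $\mathcal{H}om_p$. $k_1$ is the constant $2$-functor at the terminal category. The conical $\sigma$-colimit of $F:\mathcal{I}\to\mathcal{B}$ with respect to $\Sigma'\subseteq\mathcal{I}$ is $\sigma\mathrm{colim}^{\Sigma'}F=k_1\otimes_\sigma F$, and the conical $\sigma$-bicolimit is $\sigma\mathrm{bicolim}^{\Sigma'}F=k_1\,{}_{bi}\!\otimes_\sigma F$. Equivalently, it is given by a universal family $\lambda_i:Fi\to E$, $\lambda_u:\lambda_jFu\Rightarrow\lambda_i$ ($u:i\to j$), op-lax natural, with $\lambda_u$ invertible for $u\in\Sigma'$. $\mathcal{E}l_W$, for $W:\mathcal{A}^{op}\to\mathcal{C}at$: in general, for a $2$-functor $Q:\mathcal{K}\to\mathcal{C}at$, $\mathcal{E}l_Q$ has objects $(x,A)$ with $A\in\mathcal{K}$, $x\in QA$; morphisms $(x,A)\to(y,B)$ are pairs $(f,\varphi)$ with $f:A\to B$ in $\mathcal{K}$, $\varphi:Qf(x)\to y$; $2$-cells $(f,\varphi)\Rightarrow(g,\psi)$ are $2$-cells $\theta:f\Rightarrow g$ with $\psi(Q\theta)_x=\varphi$; composition $(g,\psi)(f,\varphi)=(gf,\psi\,Qg(\varphi))$. $\Diamond_Q:\mathcal{E}l_Q\to\mathcal{K}$ is the projection. $\mathscr{C}_Q$ consists of the arrows $(f,\varphi)$ with $\varphi$ invertible, and $\mathscr{C}_\Sigma$ of those with moreover $f\in\Sigma$; they are also regarded as $1$-subcategories of $\mathcal{E}l_Q^{op}$.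 Here $\mathcal{K}=\mathcal{A}^{op}$, $Q=W$, so $\Diamond_W^{op}:\mathcal{E}l_W^{op}\to\mathcal{A}$. *)

theory Defs
  imports "HOL-Library.FuncSet"
begin

section \<open>Categories, functors, natural transformations\<close>

record ('o, 'm) cat =
  Obj :: "'o set"
  Arr :: "'m set"
  Dom :: "'m \<Rightarrow> 'o"
  Cod :: "'m \<Rightarrow> 'o"
  Idn :: "'o \<Rightarrow> 'm"
  Cmp :: "'m \<Rightarrow> 'm \<Rightarrow> 'm"

definition Hom :: "('o, 'm) cat \<Rightarrow> 'o \<Rightarrow> 'o \<Rightarrow> 'm set" where
  "Hom C x y = {f \<in> Arr C. Dom C f = x \<and> Cod C f = y}"

text \<open>Composition is written in applicative order: \<open>Cmp C g f\<close> is \<open>g\<close> after \<open>f\<close>.\<close>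

locale category =
  fixes C :: "('o, 'm) cat"
  assumes Dom_closed: "f \<in> Arr C \<Longrightarrow> Dom C f \<in> Obj C"
    and Cod_closed: "f \<in> Arr C \<Longrightarrow> Cod C f \<in> Obj C"
    and Idn_closed: "x \<in> Obj C \<Longrightarrow> Idn C x \<in> Hom C x x"
    and Cmp_closed: "f \<in> Hom C x y \<Longrightarrow> g \<in> Hom C y z \<Longrightarrow> Cmp C g f \<in> Hom C x z"
    and Cmp_Idn_right: "f \<in> Hom C x y \<Longrightarrow> Cmp C f (Idn C x) = f"
    and Cmp_Idn_left: "f \<in> Hom C x y \<Longrightarrow> Cmp C (Idn C y) f = f"
    and Cmp_assoc: "f \<in> Hom C w x \<Longrightarrow> g \<in> Hom C x y \<Longrightarrow> h \<in> Hom C y z \<Longrightarrow>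
      Cmp C h (Cmp C g f) = Cmp C (Cmp C h g) f"

definition invertible :: "('o, 'm) cat \<Rightarrow> 'm \<Rightarrow> bool" where
  "invertible C f \<longleftrightarrow> (\<exists>x y g. f \<in> Hom C x y \<and> g \<in> Hom C y x \<and>
     Cmp C g f = Idn C x \<and> Cmp C f g = Idn C y)"

definition isomorphic :: "('o, 'm) cat \<Rightarrow> 'o \<Rightarrow> 'o \<Rightarrow> bool" where
  "isomorphic C x y \<longleftrightarrow> (\<exists>f \<in> Hom C x y. invertible C f)"

text \<open>
  Functors, natural transformations, lax transformations and modifications are required to be
  \<open>undefined\<close> outside the carrier they live on, so that HOL equality is equality of
  these data.
\<close>

record ('o, 'm, 'p, 'n) fct =
  fob :: "'o \<Rightarrow> 'p"
  far :: "'m \<Rightarrow> 'n"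

locale cat_functor = C: category C + D: category D
  for C :: "('o, 'm) cat" and D :: "('p, 'n) cat" +
  fixes F :: "('o, 'm, 'p, 'n) fct"
  assumes fob_ext: "fob F \<in> extensional (Obj C)"
    and far_ext: "far F \<in> extensional (Arr C)"
    and fob_closed: "x \<in> Obj C \<Longrightarrow> fob F x \<in> Obj D"
    and far_closed: "f \<in> Hom C x y \<Longrightarrow> far F f \<in> Hom D (fob F x) (fob F y)"
    and far_Idn: "x \<in> Obj C \<Longrightarrow> far F (Idn C x) = Idn D (fob F x)"
    and far_Cmp: "f \<in> Hom C x y \<Longrightarrow> g \<in> Hom C y z \<Longrightarrow>
      far F (Cmp C g f) = Cmp D (far F g) (far F f)"

definition id_fct :: "('o, 'm) cat \<Rightarrow> ('o, 'm, 'o, 'm) fct" where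
  "id_fct C = \<lparr>fob = (\<lambda>x\<in>Obj C. x), far = (\<lambda>f\<in>Arr C. f)\<rparr>"

text \<open>\<open>comp_fct C G F\<close> is \<open>G\<close> after \<open>F\<close>, where \<open>C\<close> is the domain of \<open>F\<close>.\<close>

definition comp_fct ::
  "('o, 'm) cat \<Rightarrow> ('p, 'n, 'q, 'r) fct \<Rightarrow> ('o, 'm, 'p, 'n) fct \<Rightarrow> ('o, 'm, 'q, 'r) fct" where
  "comp_fct C G F = \<lparr>fob = (\<lambda>x\<in>Obj C. fob G (fob F x)), far = (\<lambda>f\<in>Arr C. far G (far F f))\<rparr>"

definition nat_trans :: "('o, 'm) cat \<Rightarrow> ('p, 'n) cat \<Rightarrow> ('o, 'm, 'p, 'n) fct \<Rightarrow>
    ('o, 'm, 'p, 'n) fct \<Rightarrow> ('o \<Rightarrow> 'n) \<Rightarrow> bool" where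
  "nat_trans C D F G \<alpha> \<longleftrightarrow>
     cat_functor C D F \<and> cat_functor C D G \<and> \<alpha> \<in> extensional (Obj C) \<and>
     (\<forall>x\<in>Obj C. \<alpha> x \<in> Hom D (fob F x) (fob G x)) \<and>
     (\<forall>f\<in>Arr C. Cmp D (far G f) (\<alpha> (Dom C f)) = Cmp D (\<alpha> (Cod C f)) (far F f))"

text \<open>
  As arrows of a functor category, natural transformations are triples (source, components,
  target). Modifications, and the 2-cells of the 2-category of elements, are encoded likewise.
\<close>

type_synonym ('o, 'm, 'p, 'n) ntr =
  "('o, 'm, 'p, 'n) fct \<times> ('o \<Rightarrow> 'n) \<times> ('o, 'm, 'p, 'n) fct"

definition comps :: "'x \<times> 'y \<times> 'z \<Rightarrow> 'y" where
  "comps t = fst (snd t)"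

definition tgt :: "'x \<times> 'y \<times> 'z \<Rightarrow> 'z" where
  "tgt t = snd (snd t)"

definition fun_cat :: "('o, 'm) cat \<Rightarrow> ('p, 'n) cat \<Rightarrow>
    (('o, 'm, 'p, 'n) fct, ('o, 'm, 'p, 'n) ntr) cat" where
  "fun_cat C D = \<lparr>
     Obj = {F. cat_functor C D F},
     Arr = {t. nat_trans C D (fst t) (tgt t) (comps t)},
     Dom = fst,
     Cod = tgt,
     Idn = (\<lambda>F. (F, \<lambda>x\<in>Obj C. Idn D (fob F x), F)),
     Cmp = (\<lambda>t s. (fst s, \<lambda>x\<in>Obj C. Cmp D (comps t x) (comps s x), tgt t))\<rparr>"

definition cat_iso :: "('o, 'm) cat \<Rightarrow> ('p, 'n) cat \<Rightarrow> ('o, 'm, 'p, 'n) fct \<Rightarrow> bool" where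
  "cat_iso C D F \<longleftrightarrow> cat_functor C D F \<and>
     (\<exists>G. cat_functor D C G \<and> comp_fct C G F = id_fct C \<and> comp_fct D F G = id_fct D)"

definition cat_equiv :: "('o, 'm) cat \<Rightarrow> ('p, 'n) cat \<Rightarrow> ('o, 'm, 'p, 'n) fct \<Rightarrow> bool" where
  "cat_equiv C D F \<longleftrightarrow> cat_functor C D F \<and>
     (\<exists>G. cat_functor D C G \<and>
        isomorphic (fun_cat C C) (comp_fct C G F) (id_fct C) \<and>
        isomorphic (fun_cat D D) (comp_fct D F G) (id_fct D))"


section \<open>Strict 2-categories and 2-functors\<close>

text \<open>
  A 2-category is given by its hom-categories \<open>Hm A X Y\<close>, whose objects are the 1-cells and whose
  arrows are the 2-cells, vertically composed. The functors
  \<open>Hm A Y Z \<times> Hm A X Y \<longrightarrow> Hm A X Z\<close> are \<open>Cm1 A X Y Z\<close> on 1-cells and \<open>Cm2 A X Y Z\<close>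
  (horizontal composition) on 2-cells. Hom-categories need not be disjoint, so these operations
  take the objects as arguments.
\<close>

record ('a, 'f, 't) twocat =
  Ob :: "'a set"
  Hm :: "'a \<Rightarrow> 'a \<Rightarrow> ('f, 't) cat"
  Id1 :: "'a \<Rightarrow> 'f"
  Cm1 :: "'a \<Rightarrow> 'a \<Rightarrow> 'a \<Rightarrow> 'f \<Rightarrow> 'f \<Rightarrow> 'f"
  Cm2 :: "'a \<Rightarrow> 'a \<Rightarrow> 'a \<Rightarrow> 't \<Rightarrow> 't \<Rightarrow> 't"

abbreviation Id2 :: "('a, 'f, 't) twocat \<Rightarrow> 'a \<Rightarrow> 'a \<Rightarrow> 'f \<Rightarrow> 't" where
  "Id2 A X Y f \<equiv> Idn (Hm A X Y) f"

locale two_category =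
  fixes A :: "('a, 'f, 't) twocat"
  assumes Hm_category: "X \<in> Ob A \<Longrightarrow> Y \<in> Ob A \<Longrightarrow> category (Hm A X Y)"
    and Id1_closed: "X \<in> Ob A \<Longrightarrow> Id1 A X \<in> Obj (Hm A X X)"
    and Cm1_closed: "X \<in> Ob A \<Longrightarrow> Y \<in> Ob A \<Longrightarrow> Z \<in> Ob A \<Longrightarrow>
      f \<in> Obj (Hm A X Y) \<Longrightarrow> g \<in> Obj (Hm A Y Z) \<Longrightarrow> Cm1 A X Y Z g f \<in> Obj (Hm A X Z)"
    and Cm2_closed: "X \<in> Ob A \<Longrightarrow> Y \<in> Ob A \<Longrightarrow> Z \<in> Ob A \<Longrightarrow>
      \<alpha> \<in> Hom (Hm A X Y) f f' \<Longrightarrow> \<beta> \<in> Hom (Hm A Y Z) g g' \<Longrightarrow>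
      Cm2 A X Y Z \<beta> \<alpha> \<in> Hom (Hm A X Z) (Cm1 A X Y Z g f) (Cm1 A X Y Z g' f')"
    and Cm2_Id2: "X \<in> Ob A \<Longrightarrow> Y \<in> Ob A \<Longrightarrow> Z \<in> Ob A \<Longrightarrow>
      f \<in> Obj (Hm A X Y) \<Longrightarrow> g \<in> Obj (Hm A Y Z) \<Longrightarrow>
      Cm2 A X Y Z (Id2 A Y Z g) (Id2 A X Y f) = Id2 A X Z (Cm1 A X Y Z g f)"
    and interchange: "X \<in> Ob A \<Longrightarrow> Y \<in> Ob A \<Longrightarrow> Z \<in> Ob A \<Longrightarrow>
      \<alpha> \<in> Hom (Hm A X Y) f f' \<Longrightarrow> \<alpha>' \<in> Hom (Hm A X Y) f' f'' \<Longrightarrow>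
      \<beta> \<in> Hom (Hm A Y Z) g g' \<Longrightarrow> \<beta>' \<in> Hom (Hm A Y Z) g' g'' \<Longrightarrow>
      Cm2 A X Y Z (Cmp (Hm A Y Z) \<beta>' \<beta>) (Cmp (Hm A X Y) \<alpha>' \<alpha>) =
      Cmp (Hm A X Z) (Cm2 A X Y Z \<beta>' \<alpha>') (Cm2 A X Y Z \<beta> \<alpha>)"
    and Cm1_Id1_right: "X \<in> Ob A \<Longrightarrow> Y \<in> Ob A \<Longrightarrow> f \<in> Obj (Hm A X Y) \<Longrightarrow>
      Cm1 A X X Y f (Id1 A X) = f"
    and Cm1_Id1_left: "X \<in> Ob A \<Longrightarrow> Y \<in> Ob A \<Longrightarrow> f \<in> Obj (Hm A X Y) \<Longrightarrow>
      Cm1 A X Y Y (Id1 A Y) f = f"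
    and Cm2_Id1_right: "X \<in> Ob A \<Longrightarrow> Y \<in> Ob A \<Longrightarrow> \<alpha> \<in> Arr (Hm A X Y) \<Longrightarrow>
      Cm2 A X X Y \<alpha> (Id2 A X X (Id1 A X)) = \<alpha>"
    and Cm2_Id1_left: "X \<in> Ob A \<Longrightarrow> Y \<in> Ob A \<Longrightarrow> \<alpha> \<in> Arr (Hm A X Y) \<Longrightarrow>
      Cm2 A X Y Y (Id2 A Y Y (Id1 A Y)) \<alpha> = \<alpha>"
    and Cm1_assoc: "X \<in> Ob A \<Longrightarrow> Y \<in> Ob A \<Longrightarrow> Z \<in> Ob A \<Longrightarrow> V \<in> Ob A \<Longrightarrow>
      f \<in> Obj (Hm A X Y) \<Longrightarrow> g \<in> Obj (Hm A Y Z) \<Longrightarrow> h \<in> Obj (Hm A Z V) \<Longrightarrow>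
      Cm1 A X Z V h (Cm1 A X Y Z g f) = Cm1 A X Y V (Cm1 A Y Z V h g) f"
    and Cm2_assoc: "X \<in> Ob A \<Longrightarrow> Y \<in> Ob A \<Longrightarrow> Z \<in> Ob A \<Longrightarrow> V \<in> Ob A \<Longrightarrow>
      \<alpha> \<in> Arr (Hm A X Y) \<Longrightarrow> \<beta> \<in> Arr (Hm A Y Z) \<Longrightarrow> \<gamma> \<in> Arr (Hm A Z V) \<Longrightarrow>
      Cm2 A X Z V \<gamma> (Cm2 A X Y Z \<beta> \<alpha>) = Cm2 A X Y V (Cm2 A Y Z V \<gamma> \<beta>) \<alpha>"

text \<open>Whiskering: \<open>lwh A X Y Z g \<alpha>\<close> is \<open>g \<alpha>\<close>, and \<open>rwh A X Y Z \<beta> f\<close> is \<open>\<beta> f\<close>.\<close>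

definition lwh :: "('a, 'f, 't) twocat \<Rightarrow> 'a \<Rightarrow> 'a \<Rightarrow> 'a \<Rightarrow> 'f \<Rightarrow> 't \<Rightarrow> 't" where
  "lwh A X Y Z g \<alpha> = Cm2 A X Y Z (Id2 A Y Z g) \<alpha>"

definition rwh :: "('a, 'f, 't) twocat \<Rightarrow> 'a \<Rightarrow> 'a \<Rightarrow> 'a \<Rightarrow> 't \<Rightarrow> 'f \<Rightarrow> 't" where
  "rwh A X Y Z \<beta> f = Cm2 A X Y Z \<beta> (Id2 A X Y f)"

definition op2 :: "('a, 'f, 't) twocat \<Rightarrow> ('a, 'f, 't) twocat" where
  "op2 A = \<lparr>
     Ob = Ob A,
     Hm = (\<lambda>X Y. Hm A Y X),
     Id1 = Id1 A,
     Cm1 = (\<lambda>X Y Z g f. Cm1 A Z Y X f g),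
     Cm2 = (\<lambda>X Y Z \<beta> \<alpha>. Cm2 A Z Y X \<alpha> \<beta>)\<rparr>"

text \<open>
  \<open>Cat\<close> consists of the categories with objects in \<open>'u\<close> and arrows in \<open>'v\<close>; these two types
  play the role of the universe of small categories.
\<close>

type_synonym ('u, 'v) cat_2cat =
  "(('u, 'v) cat, ('u, 'v, 'u, 'v) fct, ('u, 'v, 'u, 'v) ntr) twocat"

definition Cat :: "('u, 'v) cat_2cat" where
  "Cat = \<lparr>
     Ob = {C. category C},
     Hm = fun_cat,
     Id1 = id_fct,
     Cm1 = (\<lambda>C D E G F. comp_fct C G F),
     Cm2 = (\<lambda>C D E t s.
       (comp_fct C (fst t) (fst s),
        \<lambda>x\<in>Obj C. Cmp E (comps t (fob (tgt s) x)) (far (fst t) (comps s x)),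
        comp_fct C (tgt t) (tgt s)))\<rparr>"

record ('a, 'f, 't, 'b, 'u, 'v) twofct =
  F0 :: "'a \<Rightarrow> 'b"
  Fh :: "'a \<Rightarrow> 'a \<Rightarrow> ('f, 't, 'u, 'v) fct"

abbreviation F1 :: "('a, 'f, 't, 'b, 'u, 'v) twofct \<Rightarrow> 'a \<Rightarrow> 'a \<Rightarrow> 'f \<Rightarrow> 'u" where
  "F1 F X Y f \<equiv> fob (Fh F X Y) f"

abbreviation F2 :: "('a, 'f, 't, 'b, 'u, 'v) twofct \<Rightarrow> 'a \<Rightarrow> 'a \<Rightarrow> 't \<Rightarrow> 'v" where
  "F2 F X Y \<alpha> \<equiv> far (Fh F X Y) \<alpha>"

locale two_functor = A: two_category A + B: two_category B
  for A :: "('a, 'f, 't) twocat" and B :: "('b, 'u, 'v) twocat" +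
  fixes F :: "('a, 'f, 't, 'b, 'u, 'v) twofct"
  assumes F0_closed: "X \<in> Ob A \<Longrightarrow> F0 F X \<in> Ob B"
    and Fh_functor: "X \<in> Ob A \<Longrightarrow> Y \<in> Ob A \<Longrightarrow>
      cat_functor (Hm A X Y) (Hm B (F0 F X) (F0 F Y)) (Fh F X Y)"
    and F1_Id1: "X \<in> Ob A \<Longrightarrow> F1 F X X (Id1 A X) = Id1 B (F0 F X)"
    and F1_Cm1: "X \<in> Ob A \<Longrightarrow> Y \<in> Ob A \<Longrightarrow> Z \<in> Ob A \<Longrightarrow>
      f \<in> Obj (Hm A X Y) \<Longrightarrow> g \<in> Obj (Hm A Y Z) \<Longrightarrow>
      F1 F X Z (Cm1 A X Y Z g f) = Cm1 B (F0 F X) (F0 F Y) (F0 F Z) (F1 F Y Z g) (F1 F X Y f)"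
    and F2_Cm2: "X \<in> Ob A \<Longrightarrow> Y \<in> Ob A \<Longrightarrow> Z \<in> Ob A \<Longrightarrow>
      \<alpha> \<in> Arr (Hm A X Y) \<Longrightarrow> \<beta> \<in> Arr (Hm A Y Z) \<Longrightarrow>
      F2 F X Z (Cm2 A X Y Z \<beta> \<alpha>) = Cm2 B (F0 F X) (F0 F Y) (F0 F Z) (F2 F Y Z \<beta>) (F2 F X Y \<alpha>)"

definition op_twofct ::
  "('a, 'f, 't, 'b, 'u, 'v) twofct \<Rightarrow> ('a, 'f, 't, 'b, 'u, 'v) twofct" where
  "op_twofct F = \<lparr>F0 = F0 F, Fh = (\<lambda>X Y. Fh F Y X)\<rparr>"

text \<open>\<open>comp_twofct A G F\<close> is \<open>G\<close> after \<open>F\<close>, where \<open>A\<close> is the domain of \<open>F\<close>.\<close>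

definition comp_twofct :: "('a, 'f, 't) twocat \<Rightarrow> ('b, 'u, 'v, 'c, 'w, 'x) twofct \<Rightarrow>
    ('a, 'f, 't, 'b, 'u, 'v) twofct \<Rightarrow> ('a, 'f, 't, 'c, 'w, 'x) twofct" where
  "comp_twofct A G F = \<lparr>
     F0 = (\<lambda>X. F0 G (F0 F X)),
     Fh = (\<lambda>X Y. comp_fct (Hm A X Y) (Fh G (F0 F X) (F0 F Y)) (Fh F X Y))\<rparr>"

text \<open>
  A class of 1-cells is a family \<open>S\<close> of sets \<open>S X Y\<close> of 1-cells \<open>X \<rightarrow> Y\<close>.
\<close>

definition wide_subcat :: "('a, 'f, 't) twocat \<Rightarrow> ('a \<Rightarrow> 'a \<Rightarrow> 'f set) \<Rightarrow> bool" where
  "wide_subcat A S \<longleftrightarrow>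
     (\<forall>X\<in>Ob A. \<forall>Y\<in>Ob A. S X Y \<subseteq> Obj (Hm A X Y)) \<and>
     (\<forall>X\<in>Ob A. Id1 A X \<in> S X X) \<and>
     (\<forall>X\<in>Ob A. \<forall>Y\<in>Ob A. \<forall>Z\<in>Ob A. \<forall>f\<in>S X Y. \<forall>g\<in>S Y Z. Cm1 A X Y Z g f \<in> S X Z)"

definition op_class :: "('a \<Rightarrow> 'a \<Rightarrow> 'f set) \<Rightarrow> 'a \<Rightarrow> 'a \<Rightarrow> 'f set" where
  "op_class S X Y = S Y X"


section \<open>Lax, sigma-natural and pseudonatural transformations\<close>

record ('a, 'f, 'u, 'v) trans =
  T0 :: "'a \<Rightarrow> 'u"
  T1 :: "'a \<Rightarrow> 'a \<Rightarrow> 'f \<Rightarrow> 'v"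

definition restrict1 ::
  "('a, 'f, 't) twocat \<Rightarrow> ('a \<Rightarrow> 'a \<Rightarrow> 'f \<Rightarrow> 'v) \<Rightarrow> 'a \<Rightarrow> 'a \<Rightarrow> 'f \<Rightarrow> 'v" where
  "restrict1 A t = (\<lambda>X Y f.
     if X \<in> Ob A \<and> Y \<in> Ob A \<and> f \<in> Obj (Hm A X Y) then t X Y f else undefined)"

locale lax_trans = F: two_functor A B F + G: two_functor A B G
  for A :: "('a, 'f, 't) twocat" and B :: "('b, 'u, 'v) twocat"
    and F :: "('a, 'f, 't, 'b, 'u, 'v) twofct" and G :: "('a, 'f, 't, 'b, 'u, 'v) twofct" +
  fixes \<theta> :: "('a, 'f, 'u, 'v) trans"
  assumes T0_ext: "T0 \<theta> \<in> extensional (Ob A)"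
    and T1_ext: "restrict1 A (T1 \<theta>) = T1 \<theta>"
    and T0_closed: "X \<in> Ob A \<Longrightarrow> T0 \<theta> X \<in> Obj (Hm B (F0 F X) (F0 G X))"
    and T1_closed: "X \<in> Ob A \<Longrightarrow> Y \<in> Ob A \<Longrightarrow> f \<in> Obj (Hm A X Y) \<Longrightarrow>
      T1 \<theta> X Y f \<in> Hom (Hm B (F0 F X) (F0 G Y))
        (Cm1 B (F0 F X) (F0 G X) (F0 G Y) (F1 G X Y f) (T0 \<theta> X))
        (Cm1 B (F0 F X) (F0 F Y) (F0 G Y) (T0 \<theta> Y) (F1 F X Y f))"
    and T1_Id1: "X \<in> Ob A \<Longrightarrow>
      T1 \<theta> X X (Id1 A X) = Id2 B (F0 F X) (F0 G X) (T0 \<theta> X)"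
    and T1_Cm1: "X \<in> Ob A \<Longrightarrow> Y \<in> Ob A \<Longrightarrow> Z \<in> Ob A \<Longrightarrow>
      f \<in> Obj (Hm A X Y) \<Longrightarrow> g \<in> Obj (Hm A Y Z) \<Longrightarrow>
      T1 \<theta> X Z (Cm1 A X Y Z g f) =
      Cmp (Hm B (F0 F X) (F0 G Z))
        (rwh B (F0 F X) (F0 F Y) (F0 G Z) (T1 \<theta> Y Z g) (F1 F X Y f))
        (lwh B (F0 F X) (F0 G Y) (F0 G Z) (F1 G Y Z g) (T1 \<theta> X Y f))"
    and T1_natural: "X \<in> Ob A \<Longrightarrow> Y \<in> Ob A \<Longrightarrow> \<gamma> \<in> Hom (Hm A X Y) f g \<Longrightarrow>
      Cmp (Hm B (F0 F X) (F0 G Y))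
        (lwh B (F0 F X) (F0 F Y) (F0 G Y) (T0 \<theta> Y) (F2 F X Y \<gamma>))
        (T1 \<theta> X Y f) =
      Cmp (Hm B (F0 F X) (F0 G Y))
        (T1 \<theta> X Y g)
        (rwh B (F0 F X) (F0 G X) (F0 G Y) (F2 G X Y \<gamma>) (T0 \<theta> X))"

definition sigma_natural :: "('a, 'f, 't) twocat \<Rightarrow> ('a \<Rightarrow> 'a \<Rightarrow> 'f set) \<Rightarrow>
    ('b, 'u, 'v) twocat \<Rightarrow> ('a, 'f, 't, 'b, 'u, 'v) twofct \<Rightarrow>
    ('a, 'f, 't, 'b, 'u, 'v) twofct \<Rightarrow> ('a, 'f, 'u, 'v) trans \<Rightarrow> bool" where
  "sigma_natural A S B F G \<theta> \<longleftrightarrow> lax_trans A B F G \<theta> \<and>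
     (\<forall>X\<in>Ob A. \<forall>Y\<in>Ob A. \<forall>f\<in>S X Y. invertible (Hm B (F0 F X) (F0 G Y)) (T1 \<theta> X Y f))"

definition pseudonatural :: "('a, 'f, 't) twocat \<Rightarrow>
    ('b, 'u, 'v) twocat \<Rightarrow> ('a, 'f, 't, 'b, 'u, 'v) twofct \<Rightarrow>
    ('a, 'f, 't, 'b, 'u, 'v) twofct \<Rightarrow> ('a, 'f, 'u, 'v) trans \<Rightarrow> bool" where
  "pseudonatural A B F G \<theta> \<longleftrightarrow> lax_trans A B F G \<theta> \<and>
     (\<forall>X\<in>Ob A. \<forall>Y\<in>Ob A. \<forall>f\<in>Obj (Hm A X Y).
        invertible (Hm B (F0 F X) (F0 G Y)) (T1 \<theta> X Y f))"

text \<open>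
  For a modification \<open>\<rho> : \<theta> \<rightarrow> \<theta>'\<close> the equation reads
  \<open>\<theta>'\<^sub>f \<circ> Gf \<rho>\<^sub>X = \<rho>\<^sub>Y Ff \<circ> \<theta>\<^sub>f\<close>.
\<close>

definition modification :: "('a, 'f, 't) twocat \<Rightarrow> ('b, 'u, 'v) twocat \<Rightarrow>
    ('a, 'f, 't, 'b, 'u, 'v) twofct \<Rightarrow> ('a, 'f, 't, 'b, 'u, 'v) twofct \<Rightarrow>
    ('a, 'f, 'u, 'v) trans \<Rightarrow> ('a, 'f, 'u, 'v) trans \<Rightarrow> ('a \<Rightarrow> 'v) \<Rightarrow> bool" where
  "modification A B F G \<theta> \<theta>' \<rho> \<longleftrightarrow>
     \<rho> \<in> extensional (Ob A) \<and>
     (\<forall>X\<in>Ob A. \<rho> X \<in> Hom (Hm B (F0 F X) (F0 G X)) (T0 \<theta> X) (T0 \<theta>' X)) \<and>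
     (\<forall>X\<in>Ob A. \<forall>Y\<in>Ob A. \<forall>f\<in>Obj (Hm A X Y).
        Cmp (Hm B (F0 F X) (F0 G Y))
          (T1 \<theta>' X Y f)
          (lwh B (F0 F X) (F0 G X) (F0 G Y) (F1 G X Y f) (\<rho> X)) =
        Cmp (Hm B (F0 F X) (F0 G Y))
          (rwh B (F0 F X) (F0 F Y) (F0 G Y) (\<rho> Y) (F1 F X Y f))
          (T1 \<theta> X Y f))"

type_synonym ('a, 'f, 'u, 'v) modif =
  "('a, 'f, 'u, 'v) trans \<times> ('a \<Rightarrow> 'v) \<times> ('a, 'f, 'u, 'v) trans"

type_synonym ('a, 'f, 't, 'b, 'u, 'v) trans_2cat =
  "(('a, 'f, 't, 'b, 'u, 'v) twofct, ('a, 'f, 'u, 'v) trans, ('a, 'f, 'u, 'v) modif) twocat"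

definition id_trans :: "('a, 'f, 't) twocat \<Rightarrow> ('b, 'u, 'v) twocat \<Rightarrow>
    ('a, 'f, 't, 'b, 'u, 'v) twofct \<Rightarrow> ('a, 'f, 'u, 'v) trans" where
  "id_trans A B F = \<lparr>
     T0 = (\<lambda>X\<in>Ob A. Id1 B (F0 F X)),
     T1 = restrict1 A (\<lambda>X Y f. Id2 B (F0 F X) (F0 F Y) (F1 F X Y f))\<rparr>"

text \<open>
  The structure 2-cell of the composite of \<open>\<theta> : F \<Rightarrow> G\<close> and \<open>\<eta> : G \<Rightarrow> H\<close> is
  \<open>\<eta>\<^sub>Y \<theta>\<^sub>f \<circ> \<eta>\<^sub>f \<theta>\<^sub>X\<close>.
\<close>

definition comp_trans :: "('a, 'f, 't) twocat \<Rightarrow> ('b, 'u, 'v) twocat \<Rightarrow>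
    ('a, 'f, 't, 'b, 'u, 'v) twofct \<Rightarrow> ('a, 'f, 't, 'b, 'u, 'v) twofct \<Rightarrow>
    ('a, 'f, 't, 'b, 'u, 'v) twofct \<Rightarrow>
    ('a, 'f, 'u, 'v) trans \<Rightarrow> ('a, 'f, 'u, 'v) trans \<Rightarrow> ('a, 'f, 'u, 'v) trans" where
  "comp_trans A B F G H \<eta> \<theta> = \<lparr>
     T0 = (\<lambda>X\<in>Ob A. Cm1 B (F0 F X) (F0 G X) (F0 H X) (T0 \<eta> X) (T0 \<theta> X)),
     T1 = restrict1 A (\<lambda>X Y f.
       Cmp (Hm B (F0 F X) (F0 H Y))
         (lwh B (F0 F X) (F0 G Y) (F0 H Y) (T0 \<eta> Y) (T1 \<theta> X Y f))
         (rwh B (F0 F X) (F0 G X) (F0 H Y) (T1 \<eta> X Y f) (T0 \<theta> X)))\<rparr>"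

text \<open>
  The 2-category of 2-functors \<open>A \<rightarrow> B\<close>, those lax transformations which satisfy \<open>N\<close>,
  and all modifications between them.
\<close>

definition trans_2cat :: "('a, 'f, 't) twocat \<Rightarrow> ('b, 'u, 'v) twocat \<Rightarrow>
    (('a, 'f, 't, 'b, 'u, 'v) twofct \<Rightarrow> ('a, 'f, 't, 'b, 'u, 'v) twofct \<Rightarrow>
       ('a, 'f, 'u, 'v) trans \<Rightarrow> bool) \<Rightarrow> ('a, 'f, 't, 'b, 'u, 'v) trans_2cat" where
  "trans_2cat A B N = \<lparr>
     Ob = {F. two_functor A B F},
     Hm = (\<lambda>F G. \<lparr>
       Obj = {\<theta>. N F G \<theta>},
       Arr = {m. N F G (fst m) \<and> N F G (tgt m) \<and>
                 modification A B F G (fst m) (tgt m) (comps m)},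
       Dom = fst,
       Cod = tgt,
       Idn = (\<lambda>\<theta>. (\<theta>, \<lambda>X\<in>Ob A. Id2 B (F0 F X) (F0 G X) (T0 \<theta> X), \<theta>)),
       Cmp = (\<lambda>n m.
         (fst m, \<lambda>X\<in>Ob A. Cmp (Hm B (F0 F X) (F0 G X)) (comps n X) (comps m X), tgt n))\<rparr>),
     Id1 = id_trans A B,
     Cm1 = comp_trans A B,
     Cm2 = (\<lambda>F G H n m.
       (comp_trans A B F G H (fst n) (fst m),
        \<lambda>X\<in>Ob A. Cm2 B (F0 F X) (F0 G X) (F0 H X) (comps n X) (comps m X),
        comp_trans A B F G H (tgt n) (tgt m)))\<rparr>"

definition Hom_sigma :: "('a, 'f, 't) twocat \<Rightarrow> ('a \<Rightarrow> 'a \<Rightarrow> 'f set) \<Rightarrow>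
    ('b, 'u, 'v) twocat \<Rightarrow> ('a, 'f, 't, 'b, 'u, 'v) trans_2cat" where
  "Hom_sigma A S B = trans_2cat A B (sigma_natural A S B)"

definition Hom_p :: "('a, 'f, 't) twocat \<Rightarrow>
    ('b, 'u, 'v) twocat \<Rightarrow> ('a, 'f, 't, 'b, 'u, 'v) trans_2cat" where
  "Hom_p A B = trans_2cat A B (pseudonatural A B)"


section \<open>The 2-functors \<open>B(P-,E)\<close> and the cocone categories\<close>

text \<open>
  The 2-functor \<open>B(P-,E) : op2 A \<rightarrow> Cat\<close>: a 1-cell \<open>f : X \<rightarrow> Y\<close> of \<open>op2 A\<close>, that is
  \<open>f : Y \<rightarrow> X\<close> in \<open>A\<close>, acts by precomposition with \<open>Pf : PY \<rightarrow> PX\<close>.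
\<close>

definition precomp :: "('b, 'u, 'v) twocat \<Rightarrow> 'b \<Rightarrow> 'b \<Rightarrow> 'b \<Rightarrow> 'u \<Rightarrow> ('u, 'v, 'u, 'v) fct" where
  "precomp B Y X E p = \<lparr>
     fob = (\<lambda>k\<in>Obj (Hm B X E). Cm1 B Y X E k p),
     far = (\<lambda>\<alpha>\<in>Arr (Hm B X E). rwh B Y X E \<alpha> p)\<rparr>"

definition postcomp :: "('b, 'u, 'v) twocat \<Rightarrow> 'b \<Rightarrow> 'b \<Rightarrow> 'b \<Rightarrow> 'u \<Rightarrow> ('u, 'v, 'u, 'v) fct" where
  "postcomp B X E E' h = \<lparr>
     fob = (\<lambda>k\<in>Obj (Hm B X E). Cm1 B X E E' h k),
     far = (\<lambda>\<alpha>\<in>Arr (Hm B X E). lwh B X E E' h \<alpha>)\<rparr>"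

definition hom_into :: "('a, 'f, 't) twocat \<Rightarrow> ('b, 'u, 'v) twocat \<Rightarrow>
    ('a, 'f, 't, 'b, 'u, 'v) twofct \<Rightarrow> 'b \<Rightarrow>
    ('a, 'f, 't, ('u, 'v) cat, ('u, 'v, 'u, 'v) fct, ('u, 'v, 'u, 'v) ntr) twofct" where
  "hom_into A B P E = \<lparr>
     F0 = (\<lambda>X. Hm B (F0 P X) E),
     Fh = (\<lambda>X Y. \<lparr>
       fob = (\<lambda>f\<in>Obj (Hm A Y X). precomp B (F0 P Y) (F0 P X) E (F1 P Y X f)),
       far = (\<lambda>\<gamma>\<in>Arr (Hm A Y X).
         (precomp B (F0 P Y) (F0 P X) E (F1 P Y X (Dom (Hm A Y X) \<gamma>)),
          \<lambda>k\<in>Obj (Hm B (F0 P X) E). lwh B (F0 P Y) (F0 P X) E k (F2 P Y X \<gamma>),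
          precomp B (F0 P Y) (F0 P X) E (F1 P Y X (Cod (Hm A Y X) \<gamma>))))\<rparr>)\<rparr>"

text \<open>
  \<open>B(P-,h) : B(P-,E) \<Rightarrow> B(P-,E')\<close> for a 1-cell \<open>h : E \<rightarrow> E'\<close>. It is 2-natural, so its
  structure 2-cells are identities. A 2-cell \<open>\<tau>\<close> between such 1-cells induces the modification
  \<open>B(P-,\<tau>)\<close>.
\<close>

definition hom_into_trans :: "('a, 'f, 't) twocat \<Rightarrow> ('b, 'u, 'v) twocat \<Rightarrow>
    ('a, 'f, 't, 'b, 'u, 'v) twofct \<Rightarrow> 'b \<Rightarrow> 'b \<Rightarrow> 'u \<Rightarrow>
    ('a, 'f, ('u, 'v, 'u, 'v) fct, ('u, 'v, 'u, 'v) ntr) trans" where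
  "hom_into_trans A B P E E' h = \<lparr>
     T0 = (\<lambda>X\<in>Ob A. postcomp B (F0 P X) E E' h),
     T1 = restrict1 (op2 A) (\<lambda>X Y f.
       Id2 Cat (Hm B (F0 P X) E) (Hm B (F0 P Y) E')
         (comp_fct (Hm B (F0 P X) E)
            (F1 (hom_into A B P E') X Y f) (postcomp B (F0 P X) E E' h)))\<rparr>"

definition hom_into_modif :: "('a, 'f, 't) twocat \<Rightarrow> ('b, 'u, 'v) twocat \<Rightarrow>
    ('a, 'f, 't, 'b, 'u, 'v) twofct \<Rightarrow> 'b \<Rightarrow> 'b \<Rightarrow> 'v \<Rightarrow>
    ('a, 'f, ('u, 'v, 'u, 'v) fct, ('u, 'v, 'u, 'v) ntr) modif" where
  "hom_into_modif A B P E E' \<tau> =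
     (hom_into_trans A B P E E' (Dom (Hm B E E') \<tau>),
      \<lambda>X\<in>Ob A.
        (postcomp B (F0 P X) E E' (Dom (Hm B E E') \<tau>),
         \<lambda>k\<in>Obj (Hm B (F0 P X) E). rwh B (F0 P X) E E' \<tau> k,
         postcomp B (F0 P X) E E' (Cod (Hm B E E') \<tau>)),
      hom_into_trans A B P E E' (Cod (Hm B E E') \<tau>))"

text \<open>
  Below, \<open>H\<close> is one of the 2-categories of 2-functors \<open>op2 A \<rightarrow> Cat\<close>; \<open>cocones H A B W P X\<close>
  is the category \<open>H(W, B(P-,X))\<close>, which is 2-functorial in \<open>X\<close> by composition with
  \<open>B(P-,h)\<close> and \<open>B(P-,\<tau>)\<close>.
\<close>

type_synonym ('a, 'f, 't, 'u, 'v) weight =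
  "('a, 'f, 't, ('u, 'v) cat, ('u, 'v, 'u, 'v) fct, ('u, 'v, 'u, 'v) ntr) twofct"

type_synonym ('a, 'f, 't, 'u, 'v) weight_2cat =
  "('a, 'f, 't, ('u, 'v) cat, ('u, 'v, 'u, 'v) fct, ('u, 'v, 'u, 'v) ntr) trans_2cat"

type_synonym ('a, 'f, 'u, 'v) cocone =
  "('a, 'f, ('u, 'v, 'u, 'v) fct, ('u, 'v, 'u, 'v) ntr) trans"

type_synonym ('a, 'f, 'u, 'v) cocone_map =
  "('a, 'f, ('u, 'v, 'u, 'v) fct, ('u, 'v, 'u, 'v) ntr) modif"

definition cocones :: "('a, 'f, 't, 'u, 'v) weight_2cat \<Rightarrow> ('a, 'f, 't) twocat \<Rightarrow>
    ('b, 'u, 'v) twocat \<Rightarrow> ('a, 'f, 't, 'u, 'v) weight \<Rightarrow> ('a, 'f, 't, 'b, 'u, 'v) twofct \<Rightarrow>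
    'b \<Rightarrow> (('a, 'f, 'u, 'v) cocone, ('a, 'f, 'u, 'v) cocone_map) cat" where
  "cocones H A B W P X = Hm H W (hom_into A B P X)"

definition cocone_act1 :: "('a, 'f, 't, 'u, 'v) weight_2cat \<Rightarrow> ('a, 'f, 't) twocat \<Rightarrow>
    ('b, 'u, 'v) twocat \<Rightarrow> ('a, 'f, 't, 'u, 'v) weight \<Rightarrow> ('a, 'f, 't, 'b, 'u, 'v) twofct \<Rightarrow>
    'b \<Rightarrow> 'b \<Rightarrow> 'u \<Rightarrow> ('a, 'f, 'u, 'v) cocone \<Rightarrow> ('a, 'f, 'u, 'v) cocone" where
  "cocone_act1 H A B W P X Y h \<nu> =
     Cm1 H W (hom_into A B P X) (hom_into A B P Y) (hom_into_trans A B P X Y h) \<nu>"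

definition cocone_act2 :: "('a, 'f, 't, 'u, 'v) weight_2cat \<Rightarrow> ('a, 'f, 't) twocat \<Rightarrow>
    ('b, 'u, 'v) twocat \<Rightarrow> ('a, 'f, 't, 'u, 'v) weight \<Rightarrow> ('a, 'f, 't, 'b, 'u, 'v) twofct \<Rightarrow>
    'b \<Rightarrow> 'b \<Rightarrow> 'v \<Rightarrow> ('a, 'f, 'u, 'v) cocone_map \<Rightarrow> ('a, 'f, 'u, 'v) cocone_map" where
  "cocone_act2 H A B W P X Y \<tau> \<rho> =
     Cm2 H W (hom_into A B P X) (hom_into A B P Y) (hom_into_modif A B P X Y \<tau>) \<rho>"

definition induced :: "('a, 'f, 't, 'u, 'v) weight_2cat \<Rightarrow> ('a, 'f, 't) twocat \<Rightarrow>
    ('b, 'u, 'v) twocat \<Rightarrow> ('a, 'f, 't, 'u, 'v) weight \<Rightarrow> ('a, 'f, 't, 'b, 'u, 'v) twofct \<Rightarrow>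
    'b \<Rightarrow> ('a, 'f, 'u, 'v) cocone \<Rightarrow> 'b \<Rightarrow>
    ('u, 'v, ('a, 'f, 'u, 'v) cocone, ('a, 'f, 'u, 'v) cocone_map) fct" where
  "induced H A B W P E \<nu> X = \<lparr>
     fob = (\<lambda>h\<in>Obj (Hm B E X). cocone_act1 H A B W P E X h \<nu>),
     far = (\<lambda>\<tau>\<in>Arr (Hm B E X).
       cocone_act2 H A B W P E X \<tau> (Idn (cocones H A B W P E) \<nu>))\<rparr>"

definition is_colim :: "('a, 'f, 't, 'u, 'v) weight_2cat \<Rightarrow> ('a, 'f, 't) twocat \<Rightarrow>
    ('b, 'u, 'v) twocat \<Rightarrow> ('a, 'f, 't, 'u, 'v) weight \<Rightarrow> ('a, 'f, 't, 'b, 'u, 'v) twofct \<Rightarrow>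
    'b \<Rightarrow> ('a, 'f, 'u, 'v) cocone \<Rightarrow> bool" where
  "is_colim H A B W P E \<nu> \<longleftrightarrow> E \<in> Ob B \<and> \<nu> \<in> Obj (cocones H A B W P E) \<and>
     (\<forall>X\<in>Ob B. cat_iso (Hm B E X) (cocones H A B W P X) (induced H A B W P E \<nu> X))"

definition is_bicolim :: "('a, 'f, 't, 'u, 'v) weight_2cat \<Rightarrow> ('a, 'f, 't) twocat \<Rightarrow>
    ('b, 'u, 'v) twocat \<Rightarrow> ('a, 'f, 't, 'u, 'v) weight \<Rightarrow> ('a, 'f, 't, 'b, 'u, 'v) twofct \<Rightarrow>
    'b \<Rightarrow> ('a, 'f, 'u, 'v) cocone \<Rightarrow> bool" where
  "is_bicolim H A B W P E \<nu> \<longleftrightarrow> E \<in> Ob B \<and> \<nu> \<in> Obj (cocones H A B W P E) \<and>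
     (\<forall>X\<in>Ob B. cat_equiv (Hm B E X) (cocones H A B W P X) (induced H A B W P E \<nu> X))"


section \<open>Weighted and conical sigma-colimits\<close>

abbreviation Hom_sigma_op ::
  "('a, 'f, 't) twocat \<Rightarrow> ('a \<Rightarrow> 'a \<Rightarrow> 'f set) \<Rightarrow> ('a, 'f, 't, 'u, 'v) weight_2cat" where
  "Hom_sigma_op A S \<equiv> Hom_sigma (op2 A) (op_class S) Cat"

abbreviation Hom_p_op :: "('a, 'f, 't) twocat \<Rightarrow> ('a, 'f, 't, 'u, 'v) weight_2cat" where
  "Hom_p_op A \<equiv> Hom_p (op2 A) Cat"

definition sigma_colim :: "('a, 'f, 't) twocat \<Rightarrow> ('a \<Rightarrow> 'a \<Rightarrow> 'f set) \<Rightarrow>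
    ('b, 'u, 'v) twocat \<Rightarrow> ('a, 'f, 't, 'u, 'v) weight \<Rightarrow> ('a, 'f, 't, 'b, 'u, 'v) twofct \<Rightarrow>
    'b \<Rightarrow> ('a, 'f, 'u, 'v) cocone \<Rightarrow> bool" where
  "sigma_colim A S B W P E \<nu> \<longleftrightarrow> is_colim (Hom_sigma_op A S) A B W P E \<nu>"

definition sigma_bicolim :: "('a, 'f, 't) twocat \<Rightarrow> ('a \<Rightarrow> 'a \<Rightarrow> 'f set) \<Rightarrow>
    ('b, 'u, 'v) twocat \<Rightarrow> ('a, 'f, 't, 'u, 'v) weight \<Rightarrow> ('a, 'f, 't, 'b, 'u, 'v) twofct \<Rightarrow>
    'b \<Rightarrow> ('a, 'f, 'u, 'v) cocone \<Rightarrow> bool" where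
  "sigma_bicolim A S B W P E \<nu> \<longleftrightarrow> is_bicolim (Hom_sigma_op A S) A B W P E \<nu>"

definition pseudo_colim :: "('a, 'f, 't) twocat \<Rightarrow>
    ('b, 'u, 'v) twocat \<Rightarrow> ('a, 'f, 't, 'u, 'v) weight \<Rightarrow> ('a, 'f, 't, 'b, 'u, 'v) twofct \<Rightarrow>
    'b \<Rightarrow> ('a, 'f, 'u, 'v) cocone \<Rightarrow> bool" where
  "pseudo_colim A B W P E \<nu> \<longleftrightarrow> is_colim (Hom_p_op A) A B W P E \<nu>"

definition pseudo_bicolim :: "('a, 'f, 't) twocat \<Rightarrow>
    ('b, 'u, 'v) twocat \<Rightarrow> ('a, 'f, 't, 'u, 'v) weight \<Rightarrow> ('a, 'f, 't, 'b, 'u, 'v) twofct \<Rightarrow>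
    'b \<Rightarrow> ('a, 'f, 'u, 'v) cocone \<Rightarrow> bool" where
  "pseudo_bicolim A B W P E \<nu> \<longleftrightarrow> is_bicolim (Hom_p_op A) A B W P E \<nu>"

definition terminal_cat :: "('u, 'v) cat" where
  "terminal_cat = \<lparr>Obj = {undefined}, Arr = {undefined}, Dom = (\<lambda>_. undefined),
     Cod = (\<lambda>_. undefined), Idn = (\<lambda>_. undefined), Cmp = (\<lambda>_ _. undefined)\<rparr>"

text \<open>The constant 2-functor \<open>k\<^sub>1 : K \<rightarrow> Cat\<close> at the terminal category.\<close>

definition const1 :: "('a, 'f, 't) twocat \<Rightarrow> ('a, 'f, 't, 'u, 'v) weight" where
  "const1 K = \<lparr>
     F0 = (\<lambda>_. terminal_cat),
     Fh = (\<lambda>X Y. \<lparr>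
       fob = (\<lambda>f\<in>Obj (Hm K X Y). id_fct terminal_cat),
       far = (\<lambda>\<alpha>\<in>Arr (Hm K X Y).
         Id2 Cat terminal_cat terminal_cat (id_fct terminal_cat))\<rparr>)\<rparr>"

definition conical_sigma_colim :: "('i, 'f, 't) twocat \<Rightarrow> ('i \<Rightarrow> 'i \<Rightarrow> 'f set) \<Rightarrow>
    ('b, 'u, 'v) twocat \<Rightarrow> ('i, 'f, 't, 'b, 'u, 'v) twofct \<Rightarrow>
    'b \<Rightarrow> ('i, 'f, 'u, 'v) cocone \<Rightarrow> bool" where
  "conical_sigma_colim I S B F E \<nu> \<longleftrightarrow> sigma_colim I S B (const1 (op2 I)) F E \<nu>"

definition conical_sigma_bicolim :: "('i, 'f, 't) twocat \<Rightarrow> ('i \<Rightarrow> 'i \<Rightarrow> 'f set) \<Rightarrow>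
    ('b, 'u, 'v) twocat \<Rightarrow> ('i, 'f, 't, 'b, 'u, 'v) twofct \<Rightarrow>
    'b \<Rightarrow> ('i, 'f, 'u, 'v) cocone \<Rightarrow> bool" where
  "conical_sigma_bicolim I S B F E \<nu> \<longleftrightarrow> sigma_bicolim I S B (const1 (op2 I)) F E \<nu>"

text \<open>
  An isomorphism of categories \<open>cocones H A B W P X \<cong> cocones H' A' B W' P' X\<close> for every object
  \<open>X\<close> of \<open>B\<close>, 2-natural in \<open>X\<close>.
\<close>

definition cocones_natural_iso :: "('b, 'u, 'v) twocat \<Rightarrow>
    ('a, 'f, 't, 'u, 'v) weight_2cat \<Rightarrow> ('a, 'f, 't) twocat \<Rightarrow>
    ('a, 'f, 't, 'u, 'v) weight \<Rightarrow> ('a, 'f, 't, 'b, 'u, 'v) twofct \<Rightarrow>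
    ('i, 'g, 's, 'u, 'v) weight_2cat \<Rightarrow> ('i, 'g, 's) twocat \<Rightarrow>
    ('i, 'g, 's, 'u, 'v) weight \<Rightarrow> ('i, 'g, 's, 'b, 'u, 'v) twofct \<Rightarrow>
    ('b \<Rightarrow> (('a, 'f, 'u, 'v) cocone, ('a, 'f, 'u, 'v) cocone_map,
            ('i, 'g, 'u, 'v) cocone, ('i, 'g, 'u, 'v) cocone_map) fct) \<Rightarrow> bool" where
  "cocones_natural_iso B H A W P H' A' W' P' \<Phi> \<longleftrightarrow>
     (\<forall>X\<in>Ob B. cat_iso (cocones H A B W P X) (cocones H' A' B W' P' X) (\<Phi> X)) \<and>
     (\<forall>X\<in>Ob B. \<forall>Y\<in>Ob B. \<forall>h\<in>Obj (Hm B X Y). \<forall>\<nu>\<in>Obj (cocones H A B W P X).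
        fob (\<Phi> Y) (cocone_act1 H A B W P X Y h \<nu>) =
        cocone_act1 H' A' B W' P' X Y h (fob (\<Phi> X) \<nu>)) \<and>
     (\<forall>X\<in>Ob B. \<forall>Y\<in>Ob B. \<forall>\<tau>\<in>Arr (Hm B X Y). \<forall>\<rho>\<in>Arr (cocones H A B W P X).
        far (\<Phi> Y) (cocone_act2 H A B W P X Y \<tau> \<rho>) =
        cocone_act2 H' A' B W' P' X Y \<tau> (far (\<Phi> X) \<rho>))"


section \<open>The 2-category of elements\<close>

definition El :: "('k, 'f, 't) twocat \<Rightarrow> ('k, 'f, 't, 'u, 'v) weight \<Rightarrow>
    ('u \<times> 'k, 'f \<times> 'v, ('f \<times> 'v) \<times> 't \<times> ('f \<times> 'v)) twocat" where
  "El K Q = \<lparr>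
     Ob = {p. snd p \<in> Ob K \<and> fst p \<in> Obj (F0 Q (snd p))},
     Hm = (\<lambda>(x, X) (y, Y).
       let ob = {p. fst p \<in> Obj (Hm K X Y) \<and> snd p \<in> Hom (F0 Q Y) (fob (F1 Q X Y (fst p)) x) y}
       in \<lparr>
         Obj = ob,
         Arr = {c. fst c \<in> ob \<and> tgt c \<in> ob \<and>
                   comps c \<in> Hom (Hm K X Y) (fst (fst c)) (fst (tgt c)) \<and>
                   Cmp (F0 Q Y) (snd (tgt c)) (comps (F2 Q X Y (comps c)) x) = snd (fst c)},
         Dom = fst,
         Cod = tgt,
         Idn = (\<lambda>p. (p, Id2 K X Y (fst p), p)),
         Cmp = (\<lambda>d c. (fst c, Cmp (Hm K X Y) (comps d) (comps c), tgt d))\<rparr>),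
     Id1 = (\<lambda>(x, X). (Id1 K X, Idn (F0 Q X) x)),
     Cm1 = (\<lambda>(x, X) (y, Y) (z, Z) (g, \<psi>) (f, \<phi>).
       (Cm1 K X Y Z g f, Cmp (F0 Q Z) \<psi> (far (F1 Q Y Z g) \<phi>))),
     Cm2 = (\<lambda>(x, X) (y, Y) (z, Z) ((g, \<psi>), \<theta>', (g', \<psi>')) ((f, \<phi>), \<theta>, (f', \<phi>')).
       ((Cm1 K X Y Z g f, Cmp (F0 Q Z) \<psi> (far (F1 Q Y Z g) \<phi>)),
        Cm2 K X Y Z \<theta>' \<theta>,
        (Cm1 K X Y Z g' f', Cmp (F0 Q Z) \<psi>' (far (F1 Q Y Z g') \<phi>'))))\<rparr>"

definition El_proj :: "('k, 'f, 't) twocat \<Rightarrow> ('k, 'f, 't, 'u, 'v) weight \<Rightarrow>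
    ('u \<times> 'k, 'f \<times> 'v, ('f \<times> 'v) \<times> 't \<times> ('f \<times> 'v), 'k, 'f, 't) twofct" where
  "El_proj K Q = \<lparr>
     F0 = snd,
     Fh = (\<lambda>p q. \<lparr>
       fob = (\<lambda>u\<in>Obj (Hm (El K Q) p q). fst u),
       far = (\<lambda>c\<in>Arr (Hm (El K Q) p q). comps c)\<rparr>)\<rparr>"

definition C_all :: "('k, 'f, 't) twocat \<Rightarrow> ('k, 'f, 't, 'u, 'v) weight \<Rightarrow>
    'u \<times> 'k \<Rightarrow> 'u \<times> 'k \<Rightarrow> ('f \<times> 'v) set" where
  "C_all K Q p q = {u \<in> Obj (Hm (El K Q) p q). invertible (F0 Q (snd q)) (snd u)}"

definition C_class :: "('k, 'f, 't) twocat \<Rightarrow> ('k \<Rightarrow> 'k \<Rightarrow> 'f set) \<Rightarrow>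
    ('k, 'f, 't, 'u, 'v) weight \<Rightarrow> 'u \<times> 'k \<Rightarrow> 'u \<times> 'k \<Rightarrow> ('f \<times> 'v) set" where
  "C_class K S Q p q = {u \<in> C_all K Q p q. fst u \<in> S (snd p) (snd q)}"

text \<open>
  For a weight \<open>W : op2 A \<rightarrow> Cat\<close>: the opposite of its 2-category of elements, which is the
  index 2-category of the conical colimits, the classes of 1-cells regarded in this opposite,
  and the diagram obtained from \<open>P\<close>.
\<close>

definition El_op :: "('a, 'f, 't) twocat \<Rightarrow> ('a, 'f, 't, 'u, 'v) weight \<Rightarrow>
    ('u \<times> 'a, 'f \<times> 'v, ('f \<times> 'v) \<times> 't \<times> ('f \<times> 'v)) twocat" where
  "El_op A W = op2 (El (op2 A) W)"

definition C_Sigma :: "('a, 'f, 't) twocat \<Rightarrow> ('a \<Rightarrow> 'a \<Rightarrow> 'f set) \<Rightarrow>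
    ('a, 'f, 't, 'u, 'v) weight \<Rightarrow> 'u \<times> 'a \<Rightarrow> 'u \<times> 'a \<Rightarrow> ('f \<times> 'v) set" where
  "C_Sigma A S W = op_class (C_class (op2 A) (op_class S) W)"

definition C_W :: "('a, 'f, 't) twocat \<Rightarrow>
    ('a, 'f, 't, 'u, 'v) weight \<Rightarrow> 'u \<times> 'a \<Rightarrow> 'u \<times> 'a \<Rightarrow> ('f \<times> 'v) set" where
  "C_W A W = op_class (C_all (op2 A) W)"

definition El_diagram :: "('a, 'f, 't) twocat \<Rightarrow> ('a, 'f, 't, 'u, 'v) weight \<Rightarrow>
    ('a, 'f, 't, 'b, 'u, 'v) twofct \<Rightarrow>
    ('u \<times> 'a, 'f \<times> 'v, ('f \<times> 'v) \<times> 't \<times> ('f \<times> 'v), 'b, 'u, 'v) twofct" where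
  "El_diagram A W P = comp_twofct (El_op A W) P (op_twofct (El_proj (op2 A) W))"

end

theory Submission
  imports Defs
begin

text \<open>
  A lax transformation \<open>\<nu> : W \<Rightarrow> G\<close> into a 2-functor \<open>G : K \<rightarrow> Cat\<close> unwinds to a lax cone \<open>\<mu>\<close> over the
  2-category of elements of \<open>W\<close> with \<open>\<mu>\<^bsub>(x,A)\<^esub> = \<nu>\<^sub>A(x)\<close> and \<open>\<mu>\<^bsub>(f,\<phi>)\<^esub> = \<nu>\<^sub>B(\<phi>) \<circ> (\<nu>\<^sub>f)\<^sub>x\<close>. Since every
  1-cell \<open>(f,\<phi>)\<close> of elements factors as \<open>(id,\<phi>)\<close> after \<open>(f,id)\<close>, one recovers \<open>\<nu>\<^sub>A(\<phi>) = \<mu>\<^bsub>(id,\<phi>)\<^esub>\<close>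
  and \<open>(\<nu>\<^sub>f)\<^sub>x = \<mu>\<^bsub>(f,id)\<^esub>\<close>, so this is a bijection; it matches invertibility of \<open>\<nu>\<^sub>f\<close> for \<open>f \<in> \<Sigma>\<close> with
  invertibility of \<open>\<mu>\<^bsub>(f,\<phi>)\<^esub>\<close> for \<open>f \<in> \<Sigma>\<close>, \<open>\<phi>\<close> invertible, and extends to modifications. For
  \<open>G = B(P-,X)\<close> it is 2-natural in \<open>X\<close>, hence carries the comparison functor of one universal
  property to that of the other. Pseudonaturality is the case where \<open>\<Sigma>\<close> consists of all 1-cells.
\<close>

section \<open>Categories and functors\<close>

text \<open>Each law of a lax transformation is a law of the cone, read at a suitable composite or
  2-cell of elements. Functoriality of \<open>\<nu>\<^sub>A\<close> is the composition law for
  (id,\<psi>) after (id,\<phi>). Naturality of \<open>\<nu>\<^sub>f\<close> at \<phi> compares two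
  factorizations of (f, Wf \<phi>): (f,id) after (id,\<phi>), and (id, Wf \<phi>) after (f,id). The
  law for a composite gf is the composition law for (g,id) after (f,id). The law for \<gamma> from f
  to g uses \<gamma> as a 2-cell of elements from (f, (W\<gamma>)_x) to (g,id). The transfer of
  universal properties needs more than a bijection of cocones: the comparison functor on the conical
  side has to be the original one followed by an isomorphism of categories, and conversely.
  Composition with an isomorphism preserves isomorphisms strictly and equivalences up to whiskering,
  so both kinds of colimit are handled at once. All these identities are HOL equalities, so source,
  target and extensional range of each stored functor, 2-cell and modification have to agree as
  well; this explains the many extensionality conditions.\<close>

lemma comps_simps [simp]: "comps (a, b, c) = b" and tgt_simps [simp]: "tgt (a, b, c) = c"
  by (simp_all add: comps_def tgt_def)

lemma triple_eqI: "\<lbrakk>fst s = fst t; comps s = comps t; tgt s = tgt t\<rbrakk> \<Longrightarrow> s = t"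
  by (simp add: comps_def tgt_def prod_eq_iff)

lemma HomI: "\<lbrakk>f \<in> Arr C; Dom C f = x; Cod C f = y\<rbrakk> \<Longrightarrow> f \<in> Hom C x y"
  by (simp add: Hom_def)

lemma HomD:
  assumes "f \<in> Hom C x y"
  shows "f \<in> Arr C" "Dom C f = x" "Cod C f = y"
  using assms by (simp_all add: Hom_def)

lemma Arr_Hom: "f \<in> Arr C \<Longrightarrow> f \<in> Hom C (Dom C f) (Cod C f)"
  by (simp add: Hom_def)

lemma (in category) Hom_Obj:
  assumes "f \<in> Hom C x y"
  shows "x \<in> Obj C" "y \<in> Obj C"
  using assms Dom_closed Cod_closed by (auto simp: Hom_def)

lemma (in category) Idn_Arr: "x \<in> Obj C \<Longrightarrow> Idn C x \<in> Arr C"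
  using Idn_closed HomD(1) by fast

lemma invertibleI:
  "\<lbrakk>f \<in> Hom C x y; g \<in> Hom C y x; Cmp C g f = Idn C x; Cmp C f g = Idn C y\<rbrakk> \<Longrightarrow>
      invertible C f"
  unfolding invertible_def by blast

lemma invertibleE:
  assumes "invertible C f" "f \<in> Hom C x y"
  obtains g where "g \<in> Hom C y x" "Cmp C g f = Idn C x" "Cmp C f g = Idn C y"
  using assms unfolding invertible_def Hom_def by auto

lemma (in category) invertible_Idn: "x \<in> Obj C \<Longrightarrow> invertible C (Idn C x)"
  using Idn_closed[of x] Cmp_Idn_left[of "Idn C x" x x] by (blast intro: invertibleI)

text \<open>The inner pair cancels by associativity. Used once in each order, this gives both
  inverse laws for a composite.\<close>

lemma (in category) Cmp_cancel_middle:
  assumes "f \<in> Hom C x y" "g \<in> Hom C y z" "g' \<in> Hom C z y" "f' \<in> Hom C y w"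
    and "Cmp C g' g = Idn C y"
  shows "Cmp C (Cmp C f' g') (Cmp C g f) = Cmp C f' f"
proof -
  have "Cmp C (Cmp C f' g') (Cmp C g f) = Cmp C f' (Cmp C g' (Cmp C g f))"
    using Cmp_assoc[OF Cmp_closed[OF assms(1,2)] assms(3,4)] by simp
  also have "\<dots> = Cmp C f' f"
    using Cmp_assoc[OF assms(1-3)] assms(5) Cmp_Idn_left[OF assms(1)] by simp
  finally show ?thesis .
qed

lemma (in category) invertible_Cmp:
  assumes "f \<in> Hom C x y" "g \<in> Hom C y z" "invertible C f" "invertible C g"
  shows "invertible C (Cmp C g f)"
proof -
  obtain f' where f': "f' \<in> Hom C y x" "Cmp C f' f = Idn C x" "Cmp C f f' = Idn C y"
    using invertibleE[OF assms(3,1)] .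
  obtain g' where g': "g' \<in> Hom C z y" "Cmp C g' g = Idn C y" "Cmp C g g' = Idn C z"
    using invertibleE[OF assms(4,2)] .
  have "Cmp C (Cmp C f' g') (Cmp C g f) = Idn C x"
    using Cmp_cancel_middle[OF assms(1,2) g'(1) f'(1) g'(2)] f'(2) by simp
  moreover have "Cmp C (Cmp C g f) (Cmp C f' g') = Idn C z"
    using Cmp_cancel_middle[OF g'(1) f'(1) assms(1,2) f'(3)] g'(3) by simp
  ultimately show ?thesis
    by (rule invertibleI[OF Cmp_closed[OF assms(1,2)] Cmp_closed[OF g'(1) f'(1)]])
qed

lemma (in cat_functor) invertible_far:
  assumes "invertible C f" "f \<in> Hom C x y"
  shows "invertible D (far F f)"
proof -
  obtain g where g: "g \<in> Hom C y x" "Cmp C g f = Idn C x" "Cmp C f g = Idn C y"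
    using invertibleE[OF assms] .
  show ?thesis
    using far_closed[OF assms(2)] far_closed[OF g(1)]
  proof (rule invertibleI)
    show "Cmp D (far F g) (far F f) = Idn D (fob F x)"
      using far_Cmp[OF assms(2) g(1)] g(2) far_Idn C.Hom_Obj[OF assms(2)] by simp
    show "Cmp D (far F f) (far F g) = Idn D (fob F y)"
      using far_Cmp[OF g(1) assms(2)] g(3) far_Idn C.Hom_Obj[OF assms(2)] by simp
  qed
qed

section \<open>Equality, composition and isomorphism of functors\<close>

lemma (in cat_functor) far_Arr: "f \<in> Arr C \<Longrightarrow> far F f \<in> Arr D"
  using far_closed[OF Arr_Hom] HomD(1) by fast

text \<open>Stated for extensional data instead of functors, so that it applies to composites and
  inverses before these are known to be functors.\<close>

lemma fct_eqI:
  fixes F G :: "('o, 'm, 'p, 'n) fct"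
  assumes "fob F \<in> extensional (Obj C)" "far F \<in> extensional (Arr C)"
    and "fob G \<in> extensional (Obj C)" "far G \<in> extensional (Arr C)"
    and "\<And>x. x \<in> Obj C \<Longrightarrow> fob F x = fob G x" "\<And>f. f \<in> Arr C \<Longrightarrow> far F f = far G f"
  shows "F = G"
proof (rule fct.equality)
  show "fob F = fob G" using assms by (metis extensionalityI)
  show "far F = far G" using assms by (metis extensionalityI)
qed simp

lemma cat_functor_eqI:
  assumes "cat_functor C D F" "cat_functor C D G"
    and "\<And>x. x \<in> Obj C \<Longrightarrow> fob F x = fob G x" "\<And>f. f \<in> Arr C \<Longrightarrow> far F f = far G f"
  shows "F = G"
proof -
  interpret F: cat_functor C D F by fact
  interpret G: cat_functor C D G by fact
  show ?thesis using F.fob_ext F.far_ext G.fob_ext G.far_ext assms(3,4) by (rule fct_eqI)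
qed

lemma fob_comp_fct [simp]: "x \<in> Obj C \<Longrightarrow> fob (comp_fct C G F) x = fob G (fob F x)"
  and far_comp_fct [simp]: "f \<in> Arr C \<Longrightarrow> far (comp_fct C G F) f = far G (far F f)"
  and fob_comp_fct_ext: "fob (comp_fct C G F) \<in> extensional (Obj C)"
  and far_comp_fct_ext: "far (comp_fct C G F) \<in> extensional (Arr C)"
  by (simp_all add: comp_fct_def)

lemma fob_id_fct [simp]: "x \<in> Obj C \<Longrightarrow> fob (id_fct C) x = x"
  and far_id_fct [simp]: "f \<in> Arr C \<Longrightarrow> far (id_fct C) f = f"
  and fob_id_fct_ext: "fob (id_fct C) \<in> extensional (Obj C)"
  and far_id_fct_ext: "far (id_fct C) \<in> extensional (Arr C)"
  by (simp_all add: id_fct_def)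

lemma cat_functor_comp_fct:
  assumes "cat_functor C D F" "cat_functor D E G"
  shows "cat_functor C E (comp_fct C G F)"
proof -
  interpret F: cat_functor C D F by fact
  interpret G: cat_functor D E G by fact
  show ?thesis
  proof
    fix f x y assume f: "f \<in> Hom C x y"
    show "far (comp_fct C G F) f \<in> Hom E (fob (comp_fct C G F) x) (fob (comp_fct C G F) y)"
      using f F.C.Hom_Obj[OF f] HomD[OF f] G.far_closed F.far_closed by simp
    fix g z assume g: "g \<in> Hom C y z"
    have "Cmp C g f \<in> Arr C" using F.C.Cmp_closed[OF f g] HomD by fast
    then show "far (comp_fct C G F) (Cmp C g f) =
        Cmp E (far (comp_fct C G F) g) (far (comp_fct C G F) f)"
      using f g HomD(1)[OF f] HomD(1)[OF g] F.far_closed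
      by (simp add: F.far_Cmp[OF f g] G.far_Cmp[OF F.far_closed[OF f] F.far_closed[OF g]])
  qed (simp_all add: fob_comp_fct_ext far_comp_fct_ext F.fob_closed G.fob_closed F.far_Idn
      G.far_Idn F.C.Idn_Arr)
qed

text \<open>Composites are restricted to the carrier of their domain. The functor F has to land in
  the carrier of D, where the restriction built into \<open>comp_fct D H G\<close> has no
  effect.\<close>

lemma comp_fct_assoc:
  assumes "cat_functor C D F"
  shows "comp_fct C H (comp_fct C G F) = comp_fct C (comp_fct D H G) F"
proof -
  interpret cat_functor C D F by fact
  show ?thesis
    by (rule fct_eqI[OF fob_comp_fct_ext far_comp_fct_ext fob_comp_fct_ext far_comp_fct_ext])
      (simp_all add: fob_closed far_Arr)
qed

lemma comp_fct_id_left: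
  assumes "cat_functor C D F"
  shows "comp_fct C (id_fct D) F = F"
proof -
  interpret cat_functor C D F by fact
  show ?thesis
    by (rule fct_eqI[OF fob_comp_fct_ext far_comp_fct_ext fob_ext far_ext])
      (simp_all add: fob_closed far_Arr)
qed

lemma comp_fct_id_right:
  assumes "cat_functor C D F"
  shows "comp_fct C F (id_fct C) = F"
proof -
  interpret cat_functor C D F by fact
  show ?thesis
    by (rule fct_eqI[OF fob_comp_fct_ext far_comp_fct_ext fob_ext far_ext]) simp_all
qed

lemma cat_iso_functor: "cat_iso C D F \<Longrightarrow> cat_functor C D F"
  by (simp add: cat_iso_def)

lemma cat_iso_comp:
  assumes "cat_iso C D F" "cat_iso D E G"
  shows "cat_iso C E (comp_fct C G F)"
proof -
  obtain F' where F: "cat_functor C D F" "cat_functor D C F'" "comp_fct C F' F = id_fct C"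
    "comp_fct D F F' = id_fct D" using assms(1) unfolding cat_iso_def by blast
  obtain G' where G: "cat_functor D E G" "cat_functor E D G'" "comp_fct D G' G = id_fct D"
    "comp_fct E G G' = id_fct E" using assms(2) unfolding cat_iso_def by blast
  have "comp_fct C (comp_fct E F' G') (comp_fct C G F) = id_fct C"
    using comp_fct_assoc[OF cat_functor_comp_fct[OF F(1) G(1)], of F' G'] G(3) F(3)
      comp_fct_assoc[OF F(1), of G' G] comp_fct_id_left[OF F(1)] by simp
  moreover have "comp_fct E (comp_fct C G F) (comp_fct E F' G') = id_fct E"
    using comp_fct_assoc[OF cat_functor_comp_fct[OF G(2) F(2)], of G F] F(4) G(4)
      comp_fct_assoc[OF G(2), of F F'] comp_fct_id_left[OF G(2)] by simp
  ultimately show ?thesis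
    using cat_functor_comp_fct[OF F(1) G(1)] cat_functor_comp_fct[OF G(2) F(2)]
    unfolding cat_iso_def by blast
qed

lemma cat_iso_inverse:
  assumes "cat_iso C D F"
  obtains G where "cat_iso D C G" "comp_fct C G F = id_fct C" "comp_fct D F G = id_fct D"
  using assms unfolding cat_iso_def by blast

text \<open>The inverse is chosen separately on objects and on arrows. The two choices are
  compatible because F is injective on objects.\<close>

lemma cat_isoI:
  assumes "cat_functor C D F"
    and ob: "bij_betw (fob F) (Obj C) (Obj D)" and ar: "bij_betw (far F) (Arr C) (Arr D)"
  shows "cat_iso C D F"
proof -
  interpret cat_functor C D F by fact
  define G where "G = \<lparr>fob = (\<lambda>y\<in>Obj D. inv_into (Obj C) (fob F) y),
    far = (\<lambda>g\<in>Arr D. inv_into (Arr C) (far F) g)\<rparr>"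
  have Gob: "fob G y \<in> Obj C" "fob F (fob G y) = y" if "y \<in> Obj D" for y
    using that ob by (auto simp: G_def bij_betw_def inv_into_into f_inv_into_f)
  have Gar: "far G g \<in> Arr C" "far F (far G g) = g" if "g \<in> Arr D" for g
    using that ar by (auto simp: G_def bij_betw_def inv_into_into f_inv_into_f)
  have GFob: "fob G (fob F x) = x" if "x \<in> Obj C" for x
    using that ob fob_closed by (simp add: G_def bij_betw_def)
  have GFar: "far G (far F f) = f" if "f \<in> Arr C" for f
    using that ar far_Arr by (simp add: G_def bij_betw_def)
  \<comment> \<open>The preimage of g has some domain and codomain; F sends them to x and y, and
    applying G to these equations identifies them with the chosen preimages of x and y.\<close>
  have Ghom: "far G g \<in> Hom C (fob G x) (fob G y)" if g: "g \<in> Hom D x y" for g x y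
  proof -
    have a: "far G g \<in> Arr C" "far F (far G g) = g" using Gar g HomD by fast+
    have "g \<in> Hom D (fob F (Dom C (far G g))) (fob F (Cod C (far G g)))"
      using far_closed[OF Arr_Hom[OF a(1)]] a(2) by simp
    then have "x = fob F (Dom C (far G g))" "y = fob F (Cod C (far G g))"
      using g by (auto simp: Hom_def)
    then show ?thesis using a(1) GFob C.Dom_closed C.Cod_closed by (simp add: Hom_def)
  qed
  have "cat_functor D C G"
  proof
    fix f x y assume f: "f \<in> Hom D x y"
    show "far G f \<in> Hom C (fob G x) (fob G y)" using Ghom[OF f] .
    fix g z assume g: "g \<in> Hom D y z"
    have "far F (Cmp C (far G g) (far G f)) = Cmp D g f"
      using far_Cmp[OF Ghom[OF f] Ghom[OF g]] Gar HomD(1)[OF f] HomD(1)[OF g] by simp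
    then show "far G (Cmp D g f) = Cmp C (far G g) (far G f)"
      using GFar C.Cmp_closed[OF Ghom[OF f] Ghom[OF g]] HomD(1) by metis
  next
    fix x assume x: "x \<in> Obj D"
    show "far G (Idn D x) = Idn C (fob G x)"
      using GFar[OF C.Idn_Arr[OF Gob(1)[OF x]]] far_Idn[OF Gob(1)[OF x]] Gob(2)[OF x] by simp
  qed (use Gob in \<open>simp_all add: G_def\<close>)
  moreover have "comp_fct C G F = id_fct C" "comp_fct D F G = id_fct D"
    by (rule fct_eqI[OF fob_comp_fct_ext far_comp_fct_ext fob_id_fct_ext far_id_fct_ext];
        simp add: GFob GFar Gob Gar)+
  ultimately show ?thesis using assms(1) unfolding cat_iso_def by blast
qed


section \<open>Functor categories\<close>

lemma fun_cat_simps [simp]: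
  "Obj (fun_cat C D) = {F. cat_functor C D F}"
  "Arr (fun_cat C D) = {t. nat_trans C D (fst t) (tgt t) (comps t)}"
  "Dom (fun_cat C D) = fst"
  "Cod (fun_cat C D) = tgt"
  "Idn (fun_cat C D) F = (F, \<lambda>x\<in>Obj C. Idn D (fob F x), F)"
  "Cmp (fun_cat C D) t s = (fst s, \<lambda>x\<in>Obj C. Cmp D (comps t x) (comps s x), tgt t)"
  by (simp_all add: fun_cat_def)

lemma Hom_fun_cat:
  "t \<in> Hom (fun_cat C D) F G \<longleftrightarrow> fst t = F \<and> tgt t = G \<and> nat_trans C D F G (comps t)"
  by (auto simp: Hom_def)

lemma nat_transD:
  assumes "nat_trans C D F G \<alpha>"
  shows "cat_functor C D F" "cat_functor C D G" "\<alpha> \<in> extensional (Obj C)"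
    "x \<in> Obj C \<Longrightarrow> \<alpha> x \<in> Hom D (fob F x) (fob G x)"
    "f \<in> Hom C x y \<Longrightarrow> Cmp D (far G f) (\<alpha> x) = Cmp D (\<alpha> y) (far F f)"
  using assms by (auto simp: nat_trans_def Hom_def)

lemma nat_transI:
  assumes "cat_functor C D F" "cat_functor C D G" "\<alpha> \<in> extensional (Obj C)"
    "\<And>x. x \<in> Obj C \<Longrightarrow> \<alpha> x \<in> Hom D (fob F x) (fob G x)"
    "\<And>f x y. f \<in> Hom C x y \<Longrightarrow> Cmp D (far G f) (\<alpha> x) = Cmp D (\<alpha> y) (far F f)"
  shows "nat_trans C D F G \<alpha>"
  unfolding nat_trans_def using assms Arr_Hom by metis

text \<open>Naturality of \<beta> is the naturality square of \<alpha> composed with \<beta> on both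
  sides.\<close>

lemma nat_trans_inverse:
  assumes \<alpha>: "nat_trans C D F G \<alpha>" and \<beta>: "\<beta> \<in> extensional (Obj C)"
    and h: "\<And>x. x \<in> Obj C \<Longrightarrow> \<beta> x \<in> Hom D (fob G x) (fob F x)"
    and l: "\<And>x. x \<in> Obj C \<Longrightarrow> Cmp D (\<beta> x) (\<alpha> x) = Idn D (fob F x)"
    and r: "\<And>x. x \<in> Obj C \<Longrightarrow> Cmp D (\<alpha> x) (\<beta> x) = Idn D (fob G x)"
  shows "nat_trans C D G F \<beta>"
proof (rule nat_transI)
  interpret F: cat_functor C D F using nat_transD(1)[OF \<alpha>] .
  interpret G: cat_functor C D G using nat_transD(2)[OF \<alpha>] .
  show "cat_functor C D G" "cat_functor C D F" "\<beta> \<in> extensional (Obj C)"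
    "\<And>x. x \<in> Obj C \<Longrightarrow> \<beta> x \<in> Hom D (fob G x) (fob F x)"
    using h \<beta> by (unfold_locales, auto)
  fix f x y assume f: "f \<in> Hom C x y"
  have x: "x \<in> Obj C" and y: "y \<in> Obj C" using F.C.Hom_Obj[OF f] by auto
  note ax = nat_transD(4)[OF \<alpha> x] and ay = nat_transD(4)[OF \<alpha> y]
  note Ff = F.far_closed[OF f] and Gf = G.far_closed[OF f]
  have "Cmp D (far F f) (\<beta> x) = Cmp D (Cmp D (\<beta> y) (\<alpha> y)) (Cmp D (far F f) (\<beta> x))"
    using l[OF y] F.D.Cmp_Idn_left[OF F.D.Cmp_closed[OF h[OF x] Ff]] by simp
  also have "\<dots> = Cmp D (\<beta> y) (Cmp D (Cmp D (\<alpha> y) (far F f)) (\<beta> x))"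
    using F.D.Cmp_assoc[OF F.D.Cmp_closed[OF h[OF x] Ff] ay h[OF y]]
      F.D.Cmp_assoc[OF h[OF x] Ff ay] by simp
  also have "\<dots> = Cmp D (\<beta> y) (Cmp D (Cmp D (far G f) (\<alpha> x)) (\<beta> x))"
    using nat_transD(5)[OF \<alpha> f] by simp
  also have "\<dots> = Cmp D (\<beta> y) (far G f)"
    using F.D.Cmp_assoc[OF h[OF x] ax Gf] r[OF x] F.D.Cmp_Idn_right[OF Gf] by simp
  finally show "Cmp D (far F f) (\<beta> x) = Cmp D (\<beta> y) (far G f)" .
qed

text \<open>Reduces invertibility of a 2-cell of \<open>Cat\<close> to its components, the form in
  which sigma-naturality of a transformation and of its cone can be compared.\<close>

lemma invertible_fun_cat_iff:
  assumes t: "t \<in> Hom (fun_cat C D) F G"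
  shows "invertible (fun_cat C D) t \<longleftrightarrow> (\<forall>x\<in>Obj C. invertible D (comps t x))"
proof
  have n: "nat_trans C D F G (comps t)" and ft: "fst t = F" "tgt t = G"
    using t by (auto simp: Hom_fun_cat)
  {
    assume "invertible (fun_cat C D) t"
    then obtain s where s: "s \<in> Hom (fun_cat C D) G F"
      "Cmp (fun_cat C D) s t = Idn (fun_cat C D) F" "Cmp (fun_cat C D) t s = Idn (fun_cat C D) G"
      using invertibleE[OF _ t] by blast
    show "\<forall>x\<in>Obj C. invertible D (comps t x)"
    proof
      fix x assume x: "x \<in> Obj C"
      have "comps s x \<in> Hom D (fob G x) (fob F x)"
        using s(1) x nat_transD(4) by (fastforce simp: Hom_fun_cat)
      moreover have "Cmp D (comps s x) (comps t x) = Idn D (fob F x)"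
        using fun_cong[OF arg_cong[OF s(2), of comps], of x] x by simp
      moreover have "Cmp D (comps t x) (comps s x) = Idn D (fob G x)"
        using fun_cong[OF arg_cong[OF s(3), of comps], of x] x by simp
      ultimately show "invertible D (comps t x)"
        using nat_transD(4)[OF n x] by (metis invertibleI)
    qed
  }
  assume inv: "\<forall>x\<in>Obj C. invertible D (comps t x)"
  \<comment> \<open>The inverses of the components are collected by choice; the family is natural by
    \<open>nat_trans_inverse\<close>.\<close>
  have "\<exists>g. g \<in> Hom D (fob G x) (fob F x) \<and> Cmp D g (comps t x) = Idn D (fob F x) \<and>
      Cmp D (comps t x) g = Idn D (fob G x)" if x: "x \<in> Obj C" for x
    using inv nat_transD(4)[OF n x] x by (meson invertibleE)
  then obtain b where b: "\<And>x. x \<in> Obj C \<Longrightarrow> b x \<in> Hom D (fob G x) (fob F x)"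
    "\<And>x. x \<in> Obj C \<Longrightarrow> Cmp D (b x) (comps t x) = Idn D (fob F x)"
    "\<And>x. x \<in> Obj C \<Longrightarrow> Cmp D (comps t x) (b x) = Idn D (fob G x)" by metis
  have "nat_trans C D G F (\<lambda>x\<in>Obj C. b x)"
    by (rule nat_trans_inverse[OF n]) (simp_all add: b)
  then have "(G, \<lambda>x\<in>Obj C. b x, F) \<in> Hom (fun_cat C D) G F" by (simp add: Hom_fun_cat)
  with t show "invertible (fun_cat C D) t"
    by (rule invertibleI) (simp_all add: b ft cong: restrict_cong)
qed

lemma Cat_simps [simp]:
  "Ob Cat = {C. category C}"
  "Hm Cat = fun_cat"
  "Id1 Cat = id_fct"
  "Cm1 Cat C D E G F = comp_fct C G F"
  "Cm2 Cat C D E t s =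
    (comp_fct C (fst t) (fst s),
     \<lambda>x\<in>Obj C. Cmp E (comps t (fob (tgt s) x)) (far (fst t) (comps s x)),
     comp_fct C (tgt t) (tgt s))"
  by (simp_all add: Cat_def)

text \<open>Needed to conjugate the isomorphism between F F' and the identity, given by an
  equivalence, with an isomorphism of categories. The whiskered components are invertible because
  functors preserve invertible arrows.\<close>

lemma isomorphic_fun_cat_whisker:
  assumes iso: "isomorphic (fun_cat D D) F G" and L: "cat_functor D E L" and R: "cat_functor E D R"
  shows "isomorphic (fun_cat E E) (comp_fct E L (comp_fct E F R)) (comp_fct E L (comp_fct E G R))"
proof -
  obtain t where t: "t \<in> Hom (fun_cat D D) F G" and it: "invertible (fun_cat D D) t"
    using iso unfolding isomorphic_def by blast
  have n: "nat_trans D D F G (comps t)" using t by (simp add: Hom_fun_cat)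
  interpret L: cat_functor D E L by fact
  interpret R: cat_functor E D R by fact
  interpret F: cat_functor D D F using nat_transD(1)[OF n] .
  interpret G: cat_functor D D G using nat_transD(2)[OF n] .
  let ?F = "comp_fct E L (comp_fct E F R)" and ?G = "comp_fct E L (comp_fct E G R)"
  let ?s = "(?F, \<lambda>x\<in>Obj E. far L (comps t (fob R x)), ?G)"
  have "nat_trans E E ?F ?G (\<lambda>x\<in>Obj E. far L (comps t (fob R x)))"
  proof (rule nat_transI)
    show "cat_functor E E ?F" "cat_functor E E ?G"
      using L R F.cat_functor_axioms G.cat_functor_axioms cat_functor_comp_fct by metis+
    fix x assume "x \<in> Obj E"
    then show "(\<lambda>x\<in>Obj E. far L (comps t (fob R x))) x \<in> Hom E (fob ?F x) (fob ?G x)"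
      using L.far_closed[OF nat_transD(4)[OF n R.fob_closed]] by simp
  next
    fix f x y assume f: "f \<in> Hom E x y"
    have o: "x \<in> Obj E" "y \<in> Obj E" "f \<in> Arr E" using L.D.Hom_Obj[OF f] HomD[OF f] by auto
    note Rf = R.far_closed[OF f]
    note tx = nat_transD(4)[OF n R.fob_closed[OF o(1)]]
    note ty = nat_transD(4)[OF n R.fob_closed[OF o(2)]]
    show "Cmp E (far ?G f) ((\<lambda>x\<in>Obj E. far L (comps t (fob R x))) x) =
        Cmp E ((\<lambda>x\<in>Obj E. far L (comps t (fob R x))) y) (far ?F f)"
      using o nat_transD(5)[OF n Rf] L.far_Cmp[OF tx G.far_closed[OF Rf]]
        L.far_Cmp[OF F.far_closed[OF Rf] ty] by simp
  qed simp
  then have s: "?s \<in> Hom (fun_cat E E) ?F ?G" by (simp add: Hom_fun_cat)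
  have "invertible E (far L (comps t (fob R x)))" if x: "x \<in> Obj E" for x
    using L.invertible_far[OF _ nat_transD(4)[OF n R.fob_closed[OF x]]]
      it invertible_fun_cat_iff[OF t] R.fob_closed[OF x] by blast
  then show ?thesis
    using s invertible_fun_cat_iff[OF s] unfolding isomorphic_def by auto
qed

text \<open>The quasi-inverse is F' after the strict inverse G' of G. One of the two composites
  equals F' F exactly; the other is F F' conjugated by G and G'.\<close>

lemma cat_equiv_comp_iso:
  assumes F: "cat_equiv C D F" and G: "cat_iso D E G"
  shows "cat_equiv C E (comp_fct C G F)"
proof -
  obtain F' where F': "cat_functor C D F" "cat_functor D C F'"
    "isomorphic (fun_cat C C) (comp_fct C F' F) (id_fct C)"
    "isomorphic (fun_cat D D) (comp_fct D F F') (id_fct D)"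
    using F unfolding cat_equiv_def by blast
  obtain G' where G': "cat_iso E D G'" "comp_fct D G' G = id_fct D" "comp_fct E G G' = id_fct E"
    using cat_iso_inverse[OF G] by blast
  note fs = F'(1,2) cat_iso_functor[OF G] cat_iso_functor[OF G'(1)]
  have "comp_fct C (comp_fct E F' G') (comp_fct C G F) = comp_fct C F' F"
    using comp_fct_assoc[OF cat_functor_comp_fct[OF fs(1,3)], of F' G'] G'(2)
      comp_fct_assoc[OF fs(1), of G' G] comp_fct_id_left[OF fs(1)] by simp
  moreover have "comp_fct E (comp_fct C G F) (comp_fct E F' G') =
      comp_fct E G (comp_fct E (comp_fct D F F') G')"
    using comp_fct_assoc[OF cat_functor_comp_fct[OF fs(4,2)], of G F] comp_fct_assoc[OF fs(4), of F F']
    by simp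
  moreover have "comp_fct E G (comp_fct E (id_fct D) G') = id_fct E"
    using G'(3) comp_fct_id_left[OF fs(4)] by simp
  ultimately have "isomorphic (fun_cat C C) (comp_fct C (comp_fct E F' G') (comp_fct C G F)) (id_fct C)"
    "isomorphic (fun_cat E E) (comp_fct E (comp_fct C G F) (comp_fct E F' G')) (id_fct E)"
    using isomorphic_fun_cat_whisker[OF F'(4) fs(3,4)] F'(3) by simp_all
  with cat_functor_comp_fct[OF fs(1,3)] cat_functor_comp_fct[OF fs(4,2)] show ?thesis
    unfolding cat_equiv_def by blast
qed

section \<open>Transformations between Cat-valued 2-functors\<close>

text \<open>\<open>Cm2\<close> of \<open>Cat\<close> leaves an identity arrow in each component of a
  whiskering. This lemma and the next one remove it.\<close>

lemma lwh_Cat: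
  assumes t: "t \<in> Hom (fun_cat C D) F F'" and H: "cat_functor D E H"
  shows "lwh Cat C D E H t = (comp_fct C H F, \<lambda>x\<in>Obj C. far H (comps t x), comp_fct C H F')"
proof -
  interpret cat_functor D E H by fact
  have n: "nat_trans C D F F' (comps t)" "fst t = F" "tgt t = F'" using t by (auto simp: Hom_fun_cat)
  have "Cmp E (Idn E (fob H (fob F' x))) (far H (comps t x)) = far H (comps t x)"
    and "fob F' x \<in> Obj D" if x: "x \<in> Obj C" for x
    using D.Cmp_Idn_left[OF far_closed[OF nat_transD(4)[OF n(1) x]]]
      C.Hom_Obj[OF nat_transD(4)[OF n(1) x]] by auto
  then show ?thesis by (simp add: lwh_def n cong: restrict_cong)
qed

lemma rwh_Cat:
  assumes t: "t \<in> Hom (fun_cat D E) F F'" and H: "cat_functor C D H"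
  shows "rwh Cat C D E t H = (comp_fct C F H, \<lambda>x\<in>Obj C. comps t (fob H x), comp_fct C F' H)"
proof -
  interpret H: cat_functor C D H by fact
  have n: "nat_trans D E F F' (comps t)" "fst t = F" "tgt t = F'" using t by (auto simp: Hom_fun_cat)
  interpret F: cat_functor D E F using nat_transD(1)[OF n(1)] .
  have "Cmp E (comps t (fob H x)) (far F (Idn D (fob H x))) = comps t (fob H x)" if x: "x \<in> Obj C" for x
    using F.D.Cmp_Idn_right[OF nat_transD(4)[OF n(1) H.fob_closed[OF x]]]
      F.far_Idn[OF H.fob_closed[OF x]] by simp
  then show ?thesis by (simp add: rwh_def n cong: restrict_cong)
qed

section \<open>2-functors into \<open>Cat\<close> and lax transformations between them, in
  components\<close>

locale cat_valued = two_functor K Cat F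
  for K :: "('k, 'f, 't) twocat" and F :: "('k, 'f, 't, 'u, 'v) weight"
begin

lemma F0_category: "X \<in> Ob K \<Longrightarrow> category (F0 F X)"
  using F0_closed by simp

lemma Fh_functor_fun_cat:
  "X \<in> Ob K \<Longrightarrow> Y \<in> Ob K \<Longrightarrow> cat_functor (Hm K X Y) (fun_cat (F0 F X) (F0 F Y)) (Fh F X Y)"
  using Fh_functor by simp

lemma F1_functor:
  "\<lbrakk>X \<in> Ob K; Y \<in> Ob K; f \<in> Obj (Hm K X Y)\<rbrakk> \<Longrightarrow> cat_functor (F0 F X) (F0 F Y) (F1 F X Y f)"
  using cat_functor.fob_closed[OF Fh_functor_fun_cat] by simp

lemma F1_fob:
  assumes "X \<in> Ob K" "Y \<in> Ob K" "f \<in> Obj (Hm K X Y)" "x \<in> Obj (F0 F X)"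
  shows "fob (F1 F X Y f) x \<in> Obj (F0 F Y)"
  using cat_functor.fob_closed[OF F1_functor] assms by blast

lemma F1_far:
  assumes "X \<in> Ob K" "Y \<in> Ob K" "f \<in> Obj (Hm K X Y)" "\<phi> \<in> Hom (F0 F X) x y"
  shows "far (F1 F X Y f) \<phi> \<in> Hom (F0 F Y) (fob (F1 F X Y f) x) (fob (F1 F X Y f) y)"
  using cat_functor.far_closed[OF F1_functor] assms by blast

lemma F1_Id1_fob: "X \<in> Ob K \<Longrightarrow> x \<in> Obj (F0 F X) \<Longrightarrow> fob (F1 F X X (Id1 K X)) x = x"
  and F1_Id1_far: "X \<in> Ob K \<Longrightarrow> \<phi> \<in> Arr (F0 F X) \<Longrightarrow> far (F1 F X X (Id1 K X)) \<phi> = \<phi>"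
  by (simp_all add: F1_Id1)

lemma F1_Cm1_fob:
  "\<lbrakk>X \<in> Ob K; Y \<in> Ob K; Z \<in> Ob K; f \<in> Obj (Hm K X Y); g \<in> Obj (Hm K Y Z);
      x \<in> Obj (F0 F X)\<rbrakk> \<Longrightarrow>
      fob (F1 F X Z (Cm1 K X Y Z g f)) x = fob (F1 F Y Z g) (fob (F1 F X Y f) x)"
  and F1_Cm1_far:
  "\<lbrakk>X \<in> Ob K; Y \<in> Ob K; Z \<in> Ob K; f \<in> Obj (Hm K X Y); g \<in> Obj (Hm K Y Z);
      \<phi> \<in> Arr (F0 F X)\<rbrakk> \<Longrightarrow>
      far (F1 F X Z (Cm1 K X Y Z g f)) \<phi> = far (F1 F Y Z g) (far (F1 F X Y f) \<phi>)"
  by (simp_all add: F1_Cm1)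

lemma F2_Hom:
  "\<lbrakk>X \<in> Ob K; Y \<in> Ob K; \<gamma> \<in> Hom (Hm K X Y) f g\<rbrakk> \<Longrightarrow>
      F2 F X Y \<gamma> \<in> Hom (fun_cat (F0 F X) (F0 F Y)) (F1 F X Y f) (F1 F X Y g)"
  using cat_functor.far_closed[OF Fh_functor_fun_cat] by blast

lemma F2_fst_tgt:
  assumes "X \<in> Ob K" "Y \<in> Ob K" "\<gamma> \<in> Hom (Hm K X Y) f g"
  shows "fst (F2 F X Y \<gamma>) = F1 F X Y f" "tgt (F2 F X Y \<gamma>) = F1 F X Y g"
    "nat_trans (F0 F X) (F0 F Y) (F1 F X Y f) (F1 F X Y g) (comps (F2 F X Y \<gamma>))"
  using F2_Hom[OF assms] by (simp_all add: Hom_fun_cat)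

lemma F2_comps:
  assumes "X \<in> Ob K" "Y \<in> Ob K" "\<gamma> \<in> Hom (Hm K X Y) f g" "x \<in> Obj (F0 F X)"
  shows "comps (F2 F X Y \<gamma>) x \<in> Hom (F0 F Y) (fob (F1 F X Y f) x) (fob (F1 F X Y g) x)"
  using nat_transD(4)[OF F2_fst_tgt(3)] assms by blast

lemma F2_natural:
  assumes "X \<in> Ob K" "Y \<in> Ob K" "\<gamma> \<in> Hom (Hm K X Y) f g" "\<phi> \<in> Hom (F0 F X) x y"
  shows "Cmp (F0 F Y) (far (F1 F X Y g) \<phi>) (comps (F2 F X Y \<gamma>) x) =
    Cmp (F0 F Y) (comps (F2 F X Y \<gamma>) y) (far (F1 F X Y f) \<phi>)"
  using nat_transD(5)[OF F2_fst_tgt(3)] assms by blast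

lemma F2_Idn:
  assumes "X \<in> Ob K" "Y \<in> Ob K" "f \<in> Obj (Hm K X Y)" "x \<in> Obj (F0 F X)"
  shows "comps (F2 F X Y (Idn (Hm K X Y) f)) x = Idn (F0 F Y) (fob (F1 F X Y f) x)"
  using assms(4) by (simp add: cat_functor.far_Idn[OF Fh_functor_fun_cat[OF assms(1,2)] assms(3)])

lemma F2_Cmp:
  assumes "X \<in> Ob K" "Y \<in> Ob K" "\<gamma> \<in> Hom (Hm K X Y) f g" "\<delta> \<in> Hom (Hm K X Y) g h"
    "x \<in> Obj (F0 F X)"
  shows "comps (F2 F X Y (Cmp (Hm K X Y) \<delta> \<gamma>)) x =
    Cmp (F0 F Y) (comps (F2 F X Y \<delta>) x) (comps (F2 F X Y \<gamma>) x)"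
  using assms(5) by (simp add: cat_functor.far_Cmp[OF Fh_functor_fun_cat[OF assms(1,2)] assms(3,4)])

text \<open>Of the two equal formulas for a horizontal composite of natural transformations,
  \<open>Cm2\<close> of \<open>Cat\<close> fixes the one which applies the functor to \<alpha> first
  and then takes \<beta> at the target of \<alpha>.\<close>

lemma F2_Cm2_comps:
  assumes "X \<in> Ob K" "Y \<in> Ob K" "Z \<in> Ob K" "\<alpha> \<in> Hom (Hm K X Y) f f'"
    "\<beta> \<in> Hom (Hm K Y Z) g g'" "x \<in> Obj (F0 F X)"
  shows "comps (F2 F X Z (Cm2 K X Y Z \<beta> \<alpha>)) x =
    Cmp (F0 F Z) (comps (F2 F Y Z \<beta>) (fob (F1 F X Y f') x))
      (far (F1 F Y Z g) (comps (F2 F X Y \<alpha>) x))"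
  using assms(6) F2_fst_tgt[OF assms(1,2,4)] F2_fst_tgt[OF assms(2,3,5)]
  by (simp add: F2_Cm2[OF assms(1-3) HomD(1)[OF assms(4)] HomD(1)[OF assms(5)]])

end

locale cat_valued_pair = F: cat_valued K F + G: cat_valued K G
  for K :: "('k, 'f, 't) twocat" and F G :: "('k, 'f, 't, 'u, 'v) weight"
begin

context
  fixes \<nu> :: "('k, 'f, 'u, 'v) cocone"
  assumes lax: "lax_trans K Cat F G \<nu>"
begin

lemma lax_functor: "X \<in> Ob K \<Longrightarrow> cat_functor (F0 F X) (F0 G X) (T0 \<nu> X)"
  using lax_trans.T0_closed[OF lax] by simp

context
  fixes X Y f
  assumes a: "X \<in> Ob K" "Y \<in> Ob K" "f \<in> Obj (Hm K X Y)"
begin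

lemma lax_Hom: "T1 \<nu> X Y f \<in> Hom (fun_cat (F0 F X) (F0 G Y))
    (comp_fct (F0 F X) (F1 G X Y f) (T0 \<nu> X)) (comp_fct (F0 F X) (T0 \<nu> Y) (F1 F X Y f))"
  using lax_trans.T1_closed[OF lax a] by simp

lemma lax_comps: "x \<in> Obj (F0 F X) \<Longrightarrow> comps (T1 \<nu> X Y f) x \<in> Hom (F0 G Y)
    (fob (F1 G X Y f) (fob (T0 \<nu> X) x)) (fob (T0 \<nu> Y) (fob (F1 F X Y f) x))"
  using lax_Hom nat_transD(4) by (fastforce simp: Hom_fun_cat)

lemma lax_natural:
  assumes \<phi>: "\<phi> \<in> Hom (F0 F X) x y"
  shows "Cmp (F0 G Y) (far (T0 \<nu> Y) (far (F1 F X Y f) \<phi>)) (comps (T1 \<nu> X Y f) x) =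
    Cmp (F0 G Y) (comps (T1 \<nu> X Y f) y) (far (F1 G X Y f) (far (T0 \<nu> X) \<phi>))"
  using lax_Hom nat_transD(5)[OF _ \<phi>] HomD(1)[OF \<phi>] by (fastforce simp: Hom_fun_cat)

end

lemma lax_Id1: "X \<in> Ob K \<Longrightarrow> x \<in> Obj (F0 F X) \<Longrightarrow>
    comps (T1 \<nu> X X (Id1 K X)) x = Idn (F0 G X) (fob (T0 \<nu> X) x)"
  using lax_trans.T1_Id1[OF lax] by simp

lemma lax_Cm1:
  assumes a: "X \<in> Ob K" "Y \<in> Ob K" "Z \<in> Ob K" "f \<in> Obj (Hm K X Y)" "g \<in> Obj (Hm K Y Z)"
    "x \<in> Obj (F0 F X)"
  shows "comps (T1 \<nu> X Z (Cm1 K X Y Z g f)) x = Cmp (F0 G Z)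
    (comps (T1 \<nu> Y Z g) (fob (F1 F X Y f) x)) (far (F1 G Y Z g) (comps (T1 \<nu> X Y f) x))"
  using lax_trans.T1_Cm1[OF lax a(1-5)] a(6) lwh_Cat[OF lax_Hom[OF a(1,2,4)] G.F1_functor[OF a(2,3,5)]]
    rwh_Cat[OF lax_Hom[OF a(2,3,5)] F.F1_functor[OF a(1,2,4)]] by simp

lemma lax_2cell:
  assumes a: "X \<in> Ob K" "Y \<in> Ob K" "\<gamma> \<in> Hom (Hm K X Y) f g" and x: "x \<in> Obj (F0 F X)"
  shows "Cmp (F0 G Y) (far (T0 \<nu> Y) (comps (F2 F X Y \<gamma>) x)) (comps (T1 \<nu> X Y f) x) =
    Cmp (F0 G Y) (comps (T1 \<nu> X Y g) x) (comps (F2 G X Y \<gamma>) (fob (T0 \<nu> X) x))"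
  using fun_cong[OF arg_cong[OF lax_trans.T1_natural[OF lax a], of comps], of x] x
    lwh_Cat[OF F.F2_Hom[OF a] lax_functor[OF a(2)]]
    rwh_Cat[OF G.F2_Hom[OF a] lax_functor[OF a(1)]] by simp

end

text \<open>Converse of the component lemmas above. An equation of 2-cells of \<open>Cat\<close> is
  one of triples: the sources and targets agree by associativity and unit laws of composition of
  functors, and the middle entries are extensional, so only equations at each object x
  remain.\<close>

lemma lax_transI:
  assumes e0: "T0 \<nu> \<in> extensional (Ob K)" and e1: "restrict1 K (T1 \<nu>) = T1 \<nu>"
    and T0: "\<And>X. X \<in> Ob K \<Longrightarrow> cat_functor (F0 F X) (F0 G X) (T0 \<nu> X)"
    and T1: "\<And>X Y f. \<lbrakk>X \<in> Ob K; Y \<in> Ob K; f \<in> Obj (Hm K X Y)\<rbrakk> \<Longrightarrow>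
      fst (T1 \<nu> X Y f) = comp_fct (F0 F X) (F1 G X Y f) (T0 \<nu> X) \<and>
      tgt (T1 \<nu> X Y f) = comp_fct (F0 F X) (T0 \<nu> Y) (F1 F X Y f) \<and>
      comps (T1 \<nu> X Y f) \<in> extensional (Obj (F0 F X))"
    and hom: "\<And>X Y f x. \<lbrakk>X \<in> Ob K; Y \<in> Ob K; f \<in> Obj (Hm K X Y); x \<in> Obj (F0 F X)\<rbrakk> \<Longrightarrow>
      comps (T1 \<nu> X Y f) x \<in> Hom (F0 G Y)
        (fob (F1 G X Y f) (fob (T0 \<nu> X) x)) (fob (T0 \<nu> Y) (fob (F1 F X Y f) x))"
    and nat: "\<And>X Y f \<phi> x y. \<lbrakk>X \<in> Ob K; Y \<in> Ob K; f \<in> Obj (Hm K X Y); \<phi> \<in> Hom (F0 F X) x y\<rbrakk> \<Longrightarrow>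
      Cmp (F0 G Y) (far (T0 \<nu> Y) (far (F1 F X Y f) \<phi>)) (comps (T1 \<nu> X Y f) x) =
      Cmp (F0 G Y) (comps (T1 \<nu> X Y f) y) (far (F1 G X Y f) (far (T0 \<nu> X) \<phi>))"
    and Id1: "\<And>X x. X \<in> Ob K \<Longrightarrow> x \<in> Obj (F0 F X) \<Longrightarrow>
      comps (T1 \<nu> X X (Id1 K X)) x = Idn (F0 G X) (fob (T0 \<nu> X) x)"
    and Cm1: "\<And>X Y Z f g x. \<lbrakk>X \<in> Ob K; Y \<in> Ob K; Z \<in> Ob K; f \<in> Obj (Hm K X Y); g \<in> Obj (Hm K Y Z);
      x \<in> Obj (F0 F X)\<rbrakk> \<Longrightarrow> comps (T1 \<nu> X Z (Cm1 K X Y Z g f)) x =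
      Cmp (F0 G Z) (comps (T1 \<nu> Y Z g) (fob (F1 F X Y f) x))
        (far (F1 G Y Z g) (comps (T1 \<nu> X Y f) x))"
    and cell: "\<And>X Y \<gamma> f g x. \<lbrakk>X \<in> Ob K; Y \<in> Ob K; \<gamma> \<in> Hom (Hm K X Y) f g; x \<in> Obj (F0 F X)\<rbrakk> \<Longrightarrow>
      Cmp (F0 G Y) (far (T0 \<nu> Y) (comps (F2 F X Y \<gamma>) x)) (comps (T1 \<nu> X Y f) x) =
      Cmp (F0 G Y) (comps (T1 \<nu> X Y g) x) (comps (F2 G X Y \<gamma>) (fob (T0 \<nu> X) x))"
  shows "lax_trans K Cat F G \<nu>"
proof -
  have T1H: "T1 \<nu> X Y f \<in> Hom (fun_cat (F0 F X) (F0 G Y))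
      (comp_fct (F0 F X) (F1 G X Y f) (T0 \<nu> X)) (comp_fct (F0 F X) (T0 \<nu> Y) (F1 F X Y f))"
    if a: "X \<in> Ob K" "Y \<in> Ob K" "f \<in> Obj (Hm K X Y)" for X Y f
  proof -
    have "nat_trans (F0 F X) (F0 G Y) (comp_fct (F0 F X) (F1 G X Y f) (T0 \<nu> X))
      (comp_fct (F0 F X) (T0 \<nu> Y) (F1 F X Y f)) (comps (T1 \<nu> X Y f))"
    proof (rule nat_transI)
      show "cat_functor (F0 F X) (F0 G Y) (comp_fct (F0 F X) (F1 G X Y f) (T0 \<nu> X))"
        using cat_functor_comp_fct[OF T0[OF a(1)] G.F1_functor[OF a]] .
      show "cat_functor (F0 F X) (F0 G Y) (comp_fct (F0 F X) (T0 \<nu> Y) (F1 F X Y f))"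
        using cat_functor_comp_fct[OF F.F1_functor[OF a] T0[OF a(2)]] .
      show "comps (T1 \<nu> X Y f) \<in> extensional (Obj (F0 F X))" using T1[OF a] by blast
      show "Cmp (F0 G Y) (far (comp_fct (F0 F X) (T0 \<nu> Y) (F1 F X Y f)) \<phi>) (comps (T1 \<nu> X Y f) x) =
          Cmp (F0 G Y) (comps (T1 \<nu> X Y f) y) (far (comp_fct (F0 F X) (F1 G X Y f) (T0 \<nu> X)) \<phi>)"
        if "\<phi> \<in> Hom (F0 F X) x y" for \<phi> x y
        using nat[OF a that] HomD(1)[OF that] by simp
    qed (use hom[OF a] in simp_all)
    then show ?thesis using T1[OF a] by (simp add: Hom_fun_cat)
  qed
  show ?thesis
  proof
    fix X assume X: "X \<in> Ob K"
    show "T0 \<nu> X \<in> Obj (Hm Cat (F0 F X) (F0 G X))" using T0[OF X] by simp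
    note I = F.A.Id1_closed[OF X]
    show "T1 \<nu> X X (Id1 K X) = Id2 Cat (F0 F X) (F0 G X) (T0 \<nu> X)"
    proof (rule triple_eqI)
      show "comps (T1 \<nu> X X (Id1 K X)) = comps (Id2 Cat (F0 F X) (F0 G X) (T0 \<nu> X))"
        using T1[OF X X I] Id1[OF X] by (auto intro!: extensionalityI[where A = "Obj (F0 F X)"])
    qed (use T1[OF X X I] F.F1_Id1[OF X] G.F1_Id1[OF X] comp_fct_id_left[OF T0[OF X]]
        comp_fct_id_right[OF T0[OF X]] in simp_all)
  next
    fix X Y f assume a: "X \<in> Ob K" "Y \<in> Ob K" "f \<in> Obj (Hm K X Y)"
    show "T1 \<nu> X Y f \<in> Hom (Hm Cat (F0 F X) (F0 G Y))
        (Cm1 Cat (F0 F X) (F0 G X) (F0 G Y) (F1 G X Y f) (T0 \<nu> X))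
        (Cm1 Cat (F0 F X) (F0 F Y) (F0 G Y) (T0 \<nu> Y) (F1 F X Y f))"
      using T1H[OF a] by simp
  next
    fix X Y Z f g
    assume a: "X \<in> Ob K" "Y \<in> Ob K" "Z \<in> Ob K" "f \<in> Obj (Hm K X Y)" "g \<in> Obj (Hm K Y Z)"
    note gf = F.A.Cm1_closed[OF a]
    note l = lwh_Cat[OF T1H[OF a(1,2,4)] G.F1_functor[OF a(2,3,5)]]
    note r = rwh_Cat[OF T1H[OF a(2,3,5)] F.F1_functor[OF a(1,2,4)]]
    show "T1 \<nu> X Z (Cm1 K X Y Z g f) =
      Cmp (Hm Cat (F0 F X) (F0 G Z))
        (rwh Cat (F0 F X) (F0 F Y) (F0 G Z) (T1 \<nu> Y Z g) (F1 F X Y f))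
        (lwh Cat (F0 F X) (F0 G Y) (F0 G Z) (F1 G Y Z g) (T1 \<nu> X Y f))" (is "_ = ?r")
    proof (rule triple_eqI)
      show "comps (T1 \<nu> X Z (Cm1 K X Y Z g f)) = comps ?r"
        using T1[OF a(1,3) gf] Cm1[OF a] by (auto simp: l r intro!: extensionalityI[where A = "Obj (F0 F X)"])
    qed (use T1[OF a(1,3) gf] F.F1_Cm1[OF a] G.F1_Cm1[OF a]
        in \<open>simp_all add: l r comp_fct_assoc[OF T0[OF a(1)]]
          comp_fct_assoc[OF F.F1_functor[OF a(1,2,4)]]\<close>)
  next
    fix X Y \<gamma> f g assume a: "X \<in> Ob K" "Y \<in> Ob K" "\<gamma> \<in> Hom (Hm K X Y) f g"
    interpret H: category "Hm K X Y" using F.A.Hm_category[OF a(1,2)] .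
    note fg = H.Hom_Obj[OF a(3)]
    show "Cmp (Hm Cat (F0 F X) (F0 G Y))
        (lwh Cat (F0 F X) (F0 F Y) (F0 G Y) (T0 \<nu> Y) (F2 F X Y \<gamma>)) (T1 \<nu> X Y f) =
      Cmp (Hm Cat (F0 F X) (F0 G Y))
        (T1 \<nu> X Y g) (rwh Cat (F0 F X) (F0 G X) (F0 G Y) (F2 G X Y \<gamma>) (T0 \<nu> X))"
      using T1[OF a(1,2) fg(1)] T1[OF a(1,2) fg(2)] cell[OF a]
        lwh_Cat[OF F.F2_Hom[OF a] T0[OF a(2)]] rwh_Cat[OF G.F2_Hom[OF a] T0[OF a(1)]]
      by (simp cong: restrict_cong)
  qed (fact e0 e1)+
qed

text \<open>The structure 2-cells have composites with the functors \<open>T0\<close> as source and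
  target, so these ends agree as soon as the functors do.\<close>

lemma lax_trans_eqI:
  fixes \<nu> \<nu>' :: "('k, 'f, ('u, 'v, 'u, 'v) fct, ('u, 'v, 'u, 'v) ntr) trans"
  assumes \<nu>: "lax_trans K Cat F G \<nu>" and \<nu>': "lax_trans K Cat F G \<nu>'"
    and T0: "\<And>X. X \<in> Ob K \<Longrightarrow> T0 \<nu> X = T0 \<nu>' X"
    and T1: "\<And>X Y f x. \<lbrakk>X \<in> Ob K; Y \<in> Ob K; f \<in> Obj (Hm K X Y); x \<in> Obj (F0 F X)\<rbrakk> \<Longrightarrow>
      comps (T1 \<nu> X Y f) x = comps (T1 \<nu>' X Y f) x"
  shows "\<nu> = \<nu>'"
proof (rule trans.equality)
  show "T0 \<nu> = T0 \<nu>'"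
    using lax_trans.T0_ext[OF \<nu>] lax_trans.T0_ext[OF \<nu>'] T0 by (rule extensionalityI)
  have "T1 \<nu> X Y f = T1 \<nu>' X Y f" if a: "X \<in> Ob K" "Y \<in> Ob K" "f \<in> Obj (Hm K X Y)" for X Y f
  proof (rule triple_eqI)
    show "comps (T1 \<nu> X Y f) = comps (T1 \<nu>' X Y f)"
      using T1[OF a] lax_Hom[OF \<nu> a] lax_Hom[OF \<nu>' a] nat_transD(3)
      by (auto simp: Hom_fun_cat intro!: extensionalityI[where A = "Obj (F0 F X)"])
  qed (use lax_Hom[OF \<nu> a] lax_Hom[OF \<nu>' a] T0 a in \<open>simp_all add: Hom_fun_cat\<close>)
  then have "restrict1 K (T1 \<nu>) = restrict1 K (T1 \<nu>')"
    by (auto simp: restrict1_def fun_eq_iff)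
  then show "T1 \<nu> = T1 \<nu>'" using lax_trans.T1_ext[OF \<nu>] lax_trans.T1_ext[OF \<nu>'] by simp
qed simp

text \<open>Once the 2-cells of \<rho> have the right ends, both sides of the modification equation
  have the same source and target, and it becomes an equation of components.\<close>

lemma modification_iff:
  assumes \<nu>: "lax_trans K Cat F G \<nu>" and \<nu>': "lax_trans K Cat F G \<nu>'"
  shows "modification K Cat F G \<nu> \<nu>' \<rho> \<longleftrightarrow> \<rho> \<in> extensional (Ob K) \<and>
    (\<forall>X\<in>Ob K. \<rho> X \<in> Hom (fun_cat (F0 F X) (F0 G X)) (T0 \<nu> X) (T0 \<nu>' X)) \<and>
    (\<forall>X\<in>Ob K. \<forall>Y\<in>Ob K. \<forall>f\<in>Obj (Hm K X Y). \<forall>x\<in>Obj (F0 F X).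
      Cmp (F0 G Y) (comps (T1 \<nu>' X Y f) x) (far (F1 G X Y f) (comps (\<rho> X) x)) =
      Cmp (F0 G Y) (comps (\<rho> Y) (fob (F1 F X Y f) x)) (comps (T1 \<nu> X Y f) x))"
    (is "_ \<longleftrightarrow> ?e \<and> ?h \<and> ?c")
proof -
  have "Cmp (Hm Cat (F0 F X) (F0 G Y)) (T1 \<nu>' X Y f)
        (lwh Cat (F0 F X) (F0 G X) (F0 G Y) (F1 G X Y f) (\<rho> X)) =
      Cmp (Hm Cat (F0 F X) (F0 G Y))
        (rwh Cat (F0 F X) (F0 F Y) (F0 G Y) (\<rho> Y) (F1 F X Y f)) (T1 \<nu> X Y f) \<longleftrightarrow>
      (\<forall>x\<in>Obj (F0 F X).
        Cmp (F0 G Y) (comps (T1 \<nu>' X Y f) x) (far (F1 G X Y f) (comps (\<rho> X) x)) =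
        Cmp (F0 G Y) (comps (\<rho> Y) (fob (F1 F X Y f) x)) (comps (T1 \<nu> X Y f) x))"
    if h: "?h" and a: "X \<in> Ob K" "Y \<in> Ob K" "f \<in> Obj (Hm K X Y)" for X Y f
    using lax_Hom[OF \<nu> a] lax_Hom[OF \<nu>' a] lwh_Cat[OF bspec[OF h a(1)] G.F1_functor[OF a]]
      rwh_Cat[OF bspec[OF h a(2)] F.F1_functor[OF a]]
    by (auto simp: Hom_fun_cat fun_eq_iff restrict_def)
  then show ?thesis unfolding modification_def by (auto simp del: fun_cat_simps)
qed

context
  fixes \<nu> \<nu>' \<rho>
  assumes mod: "modification K Cat F G \<nu> \<nu>' \<rho>"
    and lax: "lax_trans K Cat F G \<nu>" "lax_trans K Cat F G \<nu>'"
begin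

lemma mod_ext: "\<rho> \<in> extensional (Ob K)"
  and mod_Hom: "X \<in> Ob K \<Longrightarrow> \<rho> X \<in> Hom (fun_cat (F0 F X) (F0 G X)) (T0 \<nu> X) (T0 \<nu>' X)"
  and mod_1cell: "\<lbrakk>X \<in> Ob K; Y \<in> Ob K; f \<in> Obj (Hm K X Y); x \<in> Obj (F0 F X)\<rbrakk> \<Longrightarrow>
      Cmp (F0 G Y) (comps (T1 \<nu>' X Y f) x) (far (F1 G X Y f) (comps (\<rho> X) x)) =
    Cmp (F0 G Y) (comps (\<rho> Y) (fob (F1 F X Y f) x)) (comps (T1 \<nu> X Y f) x)"
  using mod modification_iff[OF lax] by blast+

lemma mod_comps: "X \<in> Ob K \<Longrightarrow> x \<in> Obj (F0 F X) \<Longrightarrow>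
    comps (\<rho> X) x \<in> Hom (F0 G X) (fob (T0 \<nu> X) x) (fob (T0 \<nu>' X) x)"
  using mod_Hom nat_transD(4) by (fastforce simp: Hom_fun_cat)

lemma mod_natural: "X \<in> Ob K \<Longrightarrow> \<phi> \<in> Hom (F0 F X) x y \<Longrightarrow>
    Cmp (F0 G X) (far (T0 \<nu>' X) \<phi>) (comps (\<rho> X) x) =
    Cmp (F0 G X) (comps (\<rho> X) y) (far (T0 \<nu> X) \<phi>)"
  using mod_Hom nat_transD(5) by (fastforce simp: Hom_fun_cat)

end

text \<open>The predicate N selects the objects; the arrows are all modifications between them.
  Hence identities and composites stay inside for any N that implies laxness.\<close>

lemma category_trans:
  assumes N: "\<And>\<nu>. N F G \<nu> \<Longrightarrow> lax_trans K Cat F G \<nu>"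
  shows "category (Hm (trans_2cat K Cat N) F G)" (is "category ?C")
proof -
  have simps: "Obj ?C = {\<nu>. N F G \<nu>}"
    "Dom ?C = fst" "Cod ?C = tgt"
    "Idn ?C = (\<lambda>\<nu>. (\<nu>, \<lambda>X\<in>Ob K. Id2 Cat (F0 F X) (F0 G X) (T0 \<nu> X), \<nu>))"
    "Cmp ?C = (\<lambda>n m. (fst m,
      \<lambda>X\<in>Ob K. Cmp (Hm Cat (F0 F X) (F0 G X)) (comps n X) (comps m X), tgt n))"
    by (simp_all add: trans_2cat_def)
  have Hom: "m \<in> Hom ?C \<nu> \<nu>' \<longleftrightarrow> fst m = \<nu> \<and> tgt m = \<nu>' \<and> N F G \<nu> \<and> N F G \<nu>' \<and>
      modification K Cat F G \<nu> \<nu>' (comps m)" for m \<nu> \<nu>'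
    by (auto simp: trans_2cat_def Hom_def)
  have FC: "category (fun_cat (F0 F X) (F0 G X))" if "X \<in> Ob K" for X
    using F.B.Hm_category[of "F0 F X" "F0 G X"] F.F0_closed[OF that] G.F0_closed[OF that] by simp
  have mH: "comps m X \<in> Hom (fun_cat (F0 F X) (F0 G X)) (T0 \<nu> X) (T0 \<nu>' X)"
    if "m \<in> Hom ?C \<nu> \<nu>'" "X \<in> Ob K" for m \<nu> \<nu>' X
    using that mod_Hom N by (auto simp: Hom)
  have mE: "comps m \<in> extensional (Ob K)" if "m \<in> Hom ?C \<nu> \<nu>'" for m \<nu> \<nu>'
    using that mod_ext N by (auto simp: Hom)
  show ?thesis
  proof
    fix m assume "m \<in> Arr ?C"
    then show "Dom ?C m \<in> Obj ?C" "Cod ?C m \<in> Obj ?C" by (simp_all add: trans_2cat_def)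
  next
    fix \<nu> assume "\<nu> \<in> Obj ?C"
    then have \<nu>: "N F G \<nu>" by (simp add: simps)
    have "modification K Cat F G \<nu> \<nu> (\<lambda>X\<in>Ob K. Id2 Cat (F0 F X) (F0 G X) (T0 \<nu> X))"
    proof (subst modification_iff[OF N[OF \<nu>] N[OF \<nu>]], intro conjI ballI)
      fix X assume X: "X \<in> Ob K"
      show "(\<lambda>X\<in>Ob K. Id2 Cat (F0 F X) (F0 G X) (T0 \<nu> X)) X \<in>
          Hom (fun_cat (F0 F X) (F0 G X)) (T0 \<nu> X) (T0 \<nu> X)"
        using X category.Idn_closed[OF FC[OF X], of "T0 \<nu> X"] lax_functor[OF N[OF \<nu>] X] by simp
    next
      fix X Y f x assume a: "X \<in> Ob K" "Y \<in> Ob K" "f \<in> Obj (Hm K X Y)" and x: "x \<in> Obj (F0 F X)"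
      interpret TX: cat_functor "F0 F X" "F0 G X" "T0 \<nu> X" using lax_functor[OF N[OF \<nu>] a(1)] .
      interpret TY: cat_functor "F0 F Y" "F0 G Y" "T0 \<nu> Y" using lax_functor[OF N[OF \<nu>] a(2)] .
      interpret GF: cat_functor "F0 G X" "F0 G Y" "F1 G X Y f" using G.F1_functor[OF a] .
      show "Cmp (F0 G Y) (comps (T1 \<nu> X Y f) x)
          (far (F1 G X Y f) (comps ((\<lambda>X\<in>Ob K. Id2 Cat (F0 F X) (F0 G X) (T0 \<nu> X)) X) x)) =
        Cmp (F0 G Y) (comps ((\<lambda>X\<in>Ob K. Id2 Cat (F0 F X) (F0 G X) (T0 \<nu> X)) Y)
          (fob (F1 F X Y f) x)) (comps (T1 \<nu> X Y f) x)"
        using a x TX.fob_closed[OF x] F.F1_fob[OF a x] lax_comps[OF N[OF \<nu>] a x]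
        by (simp add: GF.far_Idn TY.D.Cmp_Idn_left TY.D.Cmp_Idn_right)
    qed simp
    then show "Idn ?C \<nu> \<in> Hom ?C \<nu> \<nu>" by (simp add: Hom simps \<nu>)
  next
    fix m n \<nu> \<nu>' \<nu>'' assume m: "m \<in> Hom ?C \<nu> \<nu>'" and n: "n \<in> Hom ?C \<nu>' \<nu>''"
    have \<nu>: "lax_trans K Cat F G \<nu>" "lax_trans K Cat F G \<nu>'" "lax_trans K Cat F G \<nu>''"
      "modification K Cat F G \<nu> \<nu>' (comps m)" "modification K Cat F G \<nu>' \<nu>'' (comps n)"
      using m n N by (auto simp: Hom)
    have "modification K Cat F G \<nu> \<nu>'' (comps (Cmp ?C n m))"
    proof (subst modification_iff[OF \<nu>(1,3)], intro conjI ballI)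
      fix X assume X: "X \<in> Ob K"
      show "comps (Cmp ?C n m) X \<in> Hom (fun_cat (F0 F X) (F0 G X)) (T0 \<nu> X) (T0 \<nu>'' X)"
        using X category.Cmp_closed[OF FC[OF X] mH[OF m X] mH[OF n X]] by (simp add: simps)
    next
      fix X Y f x assume a: "X \<in> Ob K" "Y \<in> Ob K" "f \<in> Obj (Hm K X Y)" and x: "x \<in> Obj (F0 F X)"
      interpret GF: cat_functor "F0 G X" "F0 G Y" "F1 G X Y f" using G.F1_functor[OF a] .
      note Fx = F.F1_fob[OF a x]
      note mX = mod_comps[OF \<nu>(4,1,2) a(1) x] and nX = mod_comps[OF \<nu>(5,2,3) a(1) x]
      note mY = mod_comps[OF \<nu>(4,1,2) a(2) Fx] and nY = mod_comps[OF \<nu>(5,2,3) a(2) Fx]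
      note t = lax_comps[OF \<nu>(1) a x] lax_comps[OF \<nu>(2) a x] lax_comps[OF \<nu>(3) a x]
      note GmX = GF.far_closed[OF mX] and GnX = GF.far_closed[OF nX]
      let ?c = "Cmp (F0 G Y)"
      \<comment> \<open>Pasting of two squares: the equation for n moves the structure 2-cell past
        n, and then the equation for m moves it past m.\<close>
      have "?c (comps (T1 \<nu>'' X Y f) x) (?c (far (F1 G X Y f) (comps (comps n X) x))
            (far (F1 G X Y f) (comps (comps m X) x))) =
          ?c (?c (comps (comps n Y) (fob (F1 F X Y f) x)) (comps (T1 \<nu>' X Y f) x))
            (far (F1 G X Y f) (comps (comps m X) x))"
        using GF.D.Cmp_assoc[OF GmX GnX t(3)] mod_1cell[OF \<nu>(5,2,3) a x] by simp
      also have "\<dots> = ?c (comps (comps n Y) (fob (F1 F X Y f) x))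
          (?c (comps (comps m Y) (fob (F1 F X Y f) x)) (comps (T1 \<nu> X Y f) x))"
        using GF.D.Cmp_assoc[OF GmX t(2) nY] mod_1cell[OF \<nu>(4,1,2) a x] by simp
      finally show "?c (comps (T1 \<nu>'' X Y f) x)
          (far (F1 G X Y f) (comps (comps (Cmp ?C n m) X) x)) =
        ?c (comps (comps (Cmp ?C n m) Y) (fob (F1 F X Y f) x)) (comps (T1 \<nu> X Y f) x)"
        using a x Fx GF.far_Cmp[OF mX nX] GF.D.Cmp_assoc[OF t(1) mY nY] by (simp add: simps)
    qed (simp add: simps)
    then show "Cmp ?C n m \<in> Hom ?C \<nu> \<nu>''" using m n by (simp add: Hom simps)
  next
    fix m \<nu> \<nu>' assume m: "m \<in> Hom ?C \<nu> \<nu>'"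
    have ft: "fst m = \<nu>" "tgt m = \<nu>'" using m by (auto simp: Hom)
    show "Cmp ?C m (Idn ?C \<nu>) = m" "Cmp ?C (Idn ?C \<nu>') m = m"
      by (auto intro!: triple_eqI extensionalityI[OF _ mE[OF m]]
          simp: simps ft category.Cmp_Idn_left[OF FC mH[OF m]] category.Cmp_Idn_right[OF FC mH[OF m]]
          simp del: fun_cat_simps)
  next
    fix m n l \<nu> \<nu>' \<nu>'' \<nu>'''
    assume m: "m \<in> Hom ?C \<nu> \<nu>'" and n: "n \<in> Hom ?C \<nu>' \<nu>''" and l: "l \<in> Hom ?C \<nu>'' \<nu>'''"
    show "Cmp ?C l (Cmp ?C n m) = Cmp ?C (Cmp ?C l n) m"
      by (auto simp: simps category.Cmp_assoc[OF FC mH[OF m] mH[OF n] mH[OF l]]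
          simp del: fun_cat_simps cong: restrict_cong)
  qed
qed

end

section \<open>Composition of lax transformations and of modifications\<close>

locale cat_valued_triple = FG: cat_valued_pair K F G + GH: cat_valued_pair K G H
  for K :: "('k, 'f, 't) twocat" and F G H :: "('k, 'f, 't, 'u, 'v) weight"
begin

sublocale FH: cat_valued_pair K F H ..

lemma comp_trans_T0: "X \<in> Ob K \<Longrightarrow>
    T0 (comp_trans K Cat F G H \<mu> \<nu>) X = comp_fct (F0 F X) (T0 \<mu> X) (T0 \<nu> X)"
  by (simp add: comp_trans_def)

text \<open>Reassociates the composites of functors at both ends into the shape which
  \<open>lax_transI\<close> expects for the composed \<open>T0\<close>.\<close>

lemma comp_trans_T1:
  assumes \<nu>: "lax_trans K Cat F G \<nu>" and \<mu>: "lax_trans K Cat G H \<mu>"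
    and a: "X \<in> Ob K" "Y \<in> Ob K" "f \<in> Obj (Hm K X Y)"
  shows "T1 (comp_trans K Cat F G H \<mu> \<nu>) X Y f =
    (comp_fct (F0 F X) (F1 H X Y f) (comp_fct (F0 F X) (T0 \<mu> X) (T0 \<nu> X)),
     \<lambda>x\<in>Obj (F0 F X). Cmp (F0 H Y) (far (T0 \<mu> Y) (comps (T1 \<nu> X Y f) x))
       (comps (T1 \<mu> X Y f) (fob (T0 \<nu> X) x)),
     comp_fct (F0 F X) (comp_fct (F0 F Y) (T0 \<mu> Y) (T0 \<nu> Y)) (F1 F X Y f))"
  using a lwh_Cat[OF FG.lax_Hom[OF \<nu> a] GH.lax_functor[OF \<mu> a(2)]]
    rwh_Cat[OF GH.lax_Hom[OF \<mu> a] FG.lax_functor[OF \<nu> a(1)]]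
  by (simp add: comp_trans_def restrict1_def comp_fct_assoc[OF FG.lax_functor[OF \<nu> a(1)]]
      comp_fct_assoc[OF FG.F.F1_functor[OF a]] cong: restrict_cong)

text \<open>Each law pastes the law for \<nu>, carried along a functor \<open>T0 \<mu>\<close>, with
  the law for \<mu> at an image under \<nu>.\<close>

lemma lax_trans_comp:
  assumes \<nu>: "lax_trans K Cat F G \<nu>" and \<mu>: "lax_trans K Cat G H \<mu>"
  shows "lax_trans K Cat F H (comp_trans K Cat F G H \<mu> \<nu>)"
proof -
  note T1 = comp_trans_T1[OF \<nu> \<mu>]
  let ?c = "comp_trans K Cat F G H \<mu> \<nu>"
  show ?thesis
  proof (rule FH.lax_transI, goal_cases)
    case 1 show ?case by (simp add: comp_trans_def)
  next
    case 2 show ?case by (auto simp: comp_trans_def restrict1_def fun_eq_iff)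
  next
    case (3 X)
    then show ?case
      using cat_functor_comp_fct[OF FG.lax_functor[OF \<nu>] GH.lax_functor[OF \<mu>]]
      by (simp add: comp_trans_T0)
  next
    case (4 X Y f)
    then show ?case by (simp add: T1 comp_trans_T0)
  next
    case (5 X Y f x)
    note a = 5(1-3) and x = 5(4)
    interpret \<mu>Y: cat_functor "F0 G Y" "F0 H Y" "T0 \<mu> Y" using GH.lax_functor[OF \<mu> a(2)] .
    interpret \<nu>X: cat_functor "F0 F X" "F0 G X" "T0 \<nu> X" using FG.lax_functor[OF \<nu> a(1)] .
    show ?case
      using a x \<nu>X.fob_closed[OF x] FG.F.F1_fob[OF a x]
        \<mu>Y.D.Cmp_closed[OF GH.lax_comps[OF \<mu> a \<nu>X.fob_closed[OF x]]
          \<mu>Y.far_closed[OF FG.lax_comps[OF \<nu> a x]]]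
      by (simp add: T1[OF a] comp_trans_T0)
  next
    case (6 X Y f \<phi> x y)
    note a = 6(1-3) and \<phi> = 6(4)
    interpret \<mu>Y: cat_functor "F0 G Y" "F0 H Y" "T0 \<mu> Y" using GH.lax_functor[OF \<mu> a(2)] .
    interpret \<nu>X: cat_functor "F0 F X" "F0 G X" "T0 \<nu> X" using FG.lax_functor[OF \<nu> a(1)] .
    interpret \<nu>Y: cat_functor "F0 F Y" "F0 G Y" "T0 \<nu> Y" using FG.lax_functor[OF \<nu> a(2)] .
    interpret \<mu>X: cat_functor "F0 G X" "F0 H X" "T0 \<mu> X" using GH.lax_functor[OF \<mu> a(1)] .
    have x: "x \<in> Obj (F0 F X)" and y: "y \<in> Obj (F0 F X)" using \<nu>X.C.Hom_Obj[OF \<phi>] by auto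
    note F\<phi> = FG.F.F1_far[OF a \<phi>] and \<nu>\<phi> = \<nu>X.far_closed[OF \<phi>]
    note \<nu>F\<phi> = \<nu>Y.far_closed[OF F\<phi>] and G\<nu>\<phi> = FG.G.F1_far[OF a \<nu>\<phi>]
    note H\<phi> = GH.G.F1_far[OF a \<mu>X.far_closed[OF \<nu>\<phi>]]
    note t\<nu>x = FG.lax_comps[OF \<nu> a x] and t\<nu>y = FG.lax_comps[OF \<nu> a y]
    note t\<mu>x = GH.lax_comps[OF \<mu> a \<nu>X.fob_closed[OF x]]
    note t\<mu>y = GH.lax_comps[OF \<mu> a \<nu>X.fob_closed[OF y]]
    let ?H = "Cmp (F0 H Y)" and ?\<mu> = "far (T0 \<mu> Y)"
    have "?H (?\<mu> (far (T0 \<nu> Y) (far (F1 F X Y f) \<phi>)))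
        (?H (?\<mu> (comps (T1 \<nu> X Y f) x)) (comps (T1 \<mu> X Y f) (fob (T0 \<nu> X) x))) =
      ?H (?\<mu> (Cmp (F0 G Y) (comps (T1 \<nu> X Y f) y) (far (F1 G X Y f) (far (T0 \<nu> X) \<phi>))))
        (comps (T1 \<mu> X Y f) (fob (T0 \<nu> X) x))"
      using \<mu>Y.D.Cmp_assoc[OF t\<mu>x \<mu>Y.far_closed[OF t\<nu>x] \<mu>Y.far_closed[OF \<nu>F\<phi>]]
        \<mu>Y.far_Cmp[OF t\<nu>x \<nu>F\<phi>] FG.lax_natural[OF \<nu> a \<phi>] by simp
    also have "\<dots> = ?H (?\<mu> (comps (T1 \<nu> X Y f) y)) (?H (?\<mu> (far (F1 G X Y f) (far (T0 \<nu> X) \<phi>)))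
        (comps (T1 \<mu> X Y f) (fob (T0 \<nu> X) x)))"
      using \<mu>Y.far_Cmp[OF G\<nu>\<phi> t\<nu>y]
        \<mu>Y.D.Cmp_assoc[OF t\<mu>x \<mu>Y.far_closed[OF G\<nu>\<phi>] \<mu>Y.far_closed[OF t\<nu>y]] by simp
    also have "\<dots> = ?H (?H (?\<mu> (comps (T1 \<nu> X Y f) y)) (comps (T1 \<mu> X Y f) (fob (T0 \<nu> X) y)))
        (far (F1 H X Y f) (far (T0 \<mu> X) (far (T0 \<nu> X) \<phi>)))"
      using GH.lax_natural[OF \<mu> a \<nu>\<phi>] \<mu>Y.D.Cmp_assoc[OF H\<phi> t\<mu>y \<mu>Y.far_closed[OF t\<nu>y]] by simp
    finally show ?case
      using a x y HomD(1)[OF \<phi>] HomD(1)[OF F\<phi>] by (simp add: T1[OF a] comp_trans_T0)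
  next
    case (7 X x)
    note X = 7(1) and x = 7(2)
    interpret \<nu>X: cat_functor "F0 F X" "F0 G X" "T0 \<nu> X" using FG.lax_functor[OF \<nu> X] .
    interpret \<mu>X: cat_functor "F0 G X" "F0 H X" "T0 \<mu> X" using GH.lax_functor[OF \<mu> X] .
    note \<nu>x = \<nu>X.fob_closed[OF x]
    show ?case
      using X x FG.lax_Id1[OF \<nu> X x] GH.lax_Id1[OF \<mu> X \<nu>x] \<mu>X.far_Idn[OF \<nu>x]
        \<mu>X.D.Cmp_Idn_left[OF \<mu>X.D.Idn_closed[OF \<mu>X.fob_closed[OF \<nu>x]]]
      by (simp add: T1[OF X X FG.F.A.Id1_closed[OF X]] comp_trans_T0)
  next
    case (8 X Y Z f g x)
    note a = 8(1-5) and x = 8(6)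
    interpret \<nu>X: cat_functor "F0 F X" "F0 G X" "T0 \<nu> X" using FG.lax_functor[OF \<nu> a(1)] .
    interpret \<mu>Y: cat_functor "F0 G Y" "F0 H Y" "T0 \<mu> Y" using GH.lax_functor[OF \<mu> a(2)] .
    interpret \<nu>Y: cat_functor "F0 F Y" "F0 G Y" "T0 \<nu> Y" using FG.lax_functor[OF \<nu> a(2)] .
    interpret \<mu>Z: cat_functor "F0 G Z" "F0 H Z" "T0 \<mu> Z" using GH.lax_functor[OF \<mu> a(3)] .
    interpret Hg: cat_functor "F0 H Y" "F0 H Z" "F1 H Y Z g" using GH.G.F1_functor[OF a(2,3,5)] .
    interpret Gg: cat_functor "F0 G Y" "F0 G Z" "F1 G Y Z g" using FG.G.F1_functor[OF a(2,3,5)] .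
    note f = a(1,2,4) and g = a(2,3,5)
    note \<nu>x = \<nu>X.fob_closed[OF x] and Fx = FG.F.F1_fob[OF f x]
    note \<nu>Fx = \<nu>Y.fob_closed[OF Fx] and G\<nu>x = FG.G.F1_fob[OF f \<nu>x]
    note t\<nu>f = FG.lax_comps[OF \<nu> f x] and t\<mu>f = GH.lax_comps[OF \<mu> f \<nu>x]
    note t\<nu>g = FG.lax_comps[OF \<nu> g Fx] and t\<mu>g = GH.lax_comps[OF \<mu> g G\<nu>x]
      and t\<mu>g' = GH.lax_comps[OF \<mu> g \<nu>Fx]
    note G\<nu>f = Gg.far_closed[OF t\<nu>f] and H\<mu>f = Hg.far_closed[OF t\<mu>f]
    note H\<mu>\<nu>f = Hg.far_closed[OF \<mu>Y.far_closed[OF t\<nu>f]]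
    let ?H = "Cmp (F0 H Z)" and ?\<mu> = "far (T0 \<mu> Z)"
    let ?\<nu>f = "comps (T1 \<nu> X Y f) x" and ?\<nu>g = "comps (T1 \<nu> Y Z g) (fob (F1 F X Y f) x)"
    let ?\<mu>f = "comps (T1 \<mu> X Y f) (fob (T0 \<nu> X) x)"
    have "?H (?\<mu> (Cmp (F0 G Z) ?\<nu>g (far (F1 G Y Z g) ?\<nu>f)))
        (?H (comps (T1 \<mu> Y Z g) (fob (F1 G X Y f) (fob (T0 \<nu> X) x))) (far (F1 H Y Z g) ?\<mu>f)) =
      ?H (?\<mu> ?\<nu>g) (?H (?H (?\<mu> (far (F1 G Y Z g) ?\<nu>f))
        (comps (T1 \<mu> Y Z g) (fob (F1 G X Y f) (fob (T0 \<nu> X) x)))) (far (F1 H Y Z g) ?\<mu>f))"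
      using \<mu>Z.far_Cmp[OF G\<nu>f t\<nu>g] \<mu>Z.D.Cmp_assoc[OF H\<mu>f t\<mu>g \<mu>Z.far_closed[OF G\<nu>f]]
        \<mu>Z.D.Cmp_assoc[OF \<mu>Z.D.Cmp_closed[OF H\<mu>f t\<mu>g] \<mu>Z.far_closed[OF G\<nu>f] \<mu>Z.far_closed[OF t\<nu>g]]
      by simp
    \<comment> \<open>The two middle factors stand in the wrong order. Naturality of
      \<open>\<mu>\<^sub>g\<close> at the arrow \<open>(\<nu>\<^sub>f)\<^sub>x\<close> exchanges
      them.\<close>
    also have "\<dots> = ?H (?\<mu> ?\<nu>g) (?H (?H (comps (T1 \<mu> Y Z g) (fob (T0 \<nu> Y) (fob (F1 F X Y f) x)))
        (far (F1 H Y Z g) (far (T0 \<mu> Y) ?\<nu>f))) (far (F1 H Y Z g) ?\<mu>f))"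
      using GH.lax_natural[OF \<mu> g t\<nu>f] by simp
    also have "\<dots> = ?H (?H (?\<mu> ?\<nu>g) (comps (T1 \<mu> Y Z g) (fob (T0 \<nu> Y) (fob (F1 F X Y f) x))))
        (far (F1 H Y Z g) (Cmp (F0 H Y) (far (T0 \<mu> Y) ?\<nu>f) ?\<mu>f))"
      using \<mu>Z.D.Cmp_assoc[OF H\<mu>f H\<mu>\<nu>f t\<mu>g'] Hg.far_Cmp[OF t\<mu>f \<mu>Y.far_closed[OF t\<nu>f]]
        \<mu>Z.D.Cmp_assoc[OF \<mu>Z.D.Cmp_closed[OF H\<mu>f H\<mu>\<nu>f] t\<mu>g' \<mu>Z.far_closed[OF t\<nu>g]] by simp
    finally show ?case
      using x Fx FG.lax_Cm1[OF \<nu> a x] GH.lax_Cm1[OF \<mu> a \<nu>x]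
      by (simp add: T1[OF a(1,3) FG.F.A.Cm1_closed[OF a]] T1[OF f] T1[OF g])
  next
    case (9 X Y \<gamma> f g x)
    note a = 9(1,2) and \<gamma> = 9(3) and x = 9(4)
    have f: "f \<in> Obj (Hm K X Y)" and g: "g \<in> Obj (Hm K X Y)"
      using category.Hom_Obj[OF FG.F.A.Hm_category[OF a] \<gamma>] by auto
    interpret \<nu>X: cat_functor "F0 F X" "F0 G X" "T0 \<nu> X" using FG.lax_functor[OF \<nu> a(1)] .
    interpret \<mu>Y: cat_functor "F0 G Y" "F0 H Y" "T0 \<mu> Y" using GH.lax_functor[OF \<mu> a(2)] .
    interpret \<nu>Y: cat_functor "F0 F Y" "F0 G Y" "T0 \<nu> Y" using FG.lax_functor[OF \<nu> a(2)] .
    interpret \<mu>X: cat_functor "F0 G X" "F0 H X" "T0 \<mu> X" using GH.lax_functor[OF \<mu> a(1)] .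
    note \<nu>x = \<nu>X.fob_closed[OF x]
    note t\<nu>f = FG.lax_comps[OF \<nu> a f x] and t\<mu>f = GH.lax_comps[OF \<mu> a f \<nu>x]
    note t\<nu>g = FG.lax_comps[OF \<nu> a g x] and t\<mu>g = GH.lax_comps[OF \<mu> a g \<nu>x]
    note F\<gamma> = FG.F.F2_comps[OF a \<gamma> x] and G\<gamma> = FG.G.F2_comps[OF a \<gamma> \<nu>x]
      and H\<gamma> = GH.G.F2_comps[OF a \<gamma> \<mu>X.fob_closed[OF \<nu>x]]
    let ?H = "Cmp (F0 H Y)" and ?\<mu> = "far (T0 \<mu> Y)"
    have "?H (?\<mu> (far (T0 \<nu> Y) (comps (F2 F X Y \<gamma>) x)))
        (?H (?\<mu> (comps (T1 \<nu> X Y f) x)) (comps (T1 \<mu> X Y f) (fob (T0 \<nu> X) x))) =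
      ?H (?\<mu> (Cmp (F0 G Y) (comps (T1 \<nu> X Y g) x) (comps (F2 G X Y \<gamma>) (fob (T0 \<nu> X) x))))
        (comps (T1 \<mu> X Y f) (fob (T0 \<nu> X) x))"
      using \<mu>Y.D.Cmp_assoc[OF t\<mu>f \<mu>Y.far_closed[OF t\<nu>f] \<mu>Y.far_closed[OF \<nu>Y.far_closed[OF F\<gamma>]]]
        \<mu>Y.far_Cmp[OF t\<nu>f \<nu>Y.far_closed[OF F\<gamma>]] FG.lax_2cell[OF \<nu> a \<gamma> x] by simp
    also have "\<dots> = ?H (?\<mu> (comps (T1 \<nu> X Y g) x)) (?H (?\<mu> (comps (F2 G X Y \<gamma>) (fob (T0 \<nu> X) x)))
        (comps (T1 \<mu> X Y f) (fob (T0 \<nu> X) x)))"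
      using \<mu>Y.far_Cmp[OF G\<gamma> t\<nu>g]
        \<mu>Y.D.Cmp_assoc[OF t\<mu>f \<mu>Y.far_closed[OF G\<gamma>] \<mu>Y.far_closed[OF t\<nu>g]] by simp
    also have "\<dots> = ?H (?H (?\<mu> (comps (T1 \<nu> X Y g) x)) (comps (T1 \<mu> X Y g) (fob (T0 \<nu> X) x)))
        (comps (F2 H X Y \<gamma>) (fob (T0 \<mu> X) (fob (T0 \<nu> X) x)))"
      using GH.lax_2cell[OF \<mu> a \<gamma> \<nu>x] \<mu>Y.D.Cmp_assoc[OF H\<gamma> t\<mu>g \<mu>Y.far_closed[OF t\<nu>g]] by simp
    finally show ?case
      using a x HomD(1)[OF F\<gamma>] by (simp add: T1[OF a f] T1[OF a g] comp_trans_T0)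
  qed
qed

text \<open>For f in the class, a component of the composite is the image under
  \<open>\<mu>\<^sub>Y\<close> of an invertible component of \<open>\<nu>\<^sub>f\<close>, after an
  invertible component of \<open>\<mu>\<^sub>f\<close>.\<close>

lemma sigma_natural_comp:
  assumes S: "\<And>X Y. X \<in> Ob K \<Longrightarrow> Y \<in> Ob K \<Longrightarrow> S X Y \<subseteq> Obj (Hm K X Y)"
    and \<nu>: "sigma_natural K S Cat F G \<nu>" and \<mu>: "sigma_natural K S Cat G H \<mu>"
  shows "sigma_natural K S Cat F H (comp_trans K Cat F G H \<mu> \<nu>)"
proof -
  have l: "lax_trans K Cat F G \<nu>" "lax_trans K Cat G H \<mu>"
    using \<nu> \<mu> by (simp_all add: sigma_natural_def)
  note lc = lax_trans_comp[OF l]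
  have "invertible (fun_cat (F0 F X) (F0 H Y)) (T1 (comp_trans K Cat F G H \<mu> \<nu>) X Y f)"
    if XY: "X \<in> Ob K" "Y \<in> Ob K" and f: "f \<in> S X Y" for X Y f
  proof -
    have f': "f \<in> Obj (Hm K X Y)" using S[OF XY] f by blast
    note a = XY f'
    have "\<forall>x\<in>Obj (F0 F X). invertible (F0 H Y) (comps (T1 (comp_trans K Cat F G H \<mu> \<nu>) X Y f) x)"
    proof
      fix x assume x: "x \<in> Obj (F0 F X)"
      interpret \<mu>Y: cat_functor "F0 G Y" "F0 H Y" "T0 \<mu> Y" using GH.lax_functor[OF l(2) a(2)] .
      note \<nu>x = cat_functor.fob_closed[OF FG.lax_functor[OF l(1) a(1)] x]
      have i: "invertible (F0 G Y) (comps (T1 \<nu> X Y f) x)"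
        "invertible (F0 H Y) (comps (T1 \<mu> X Y f) (fob (T0 \<nu> X) x))"
        using \<nu> \<mu> f XY x \<nu>x invertible_fun_cat_iff[OF FG.lax_Hom[OF l(1) a]]
          invertible_fun_cat_iff[OF GH.lax_Hom[OF l(2) a]] by (auto simp: sigma_natural_def)
      show "invertible (F0 H Y) (comps (T1 (comp_trans K Cat F G H \<mu> \<nu>) X Y f) x)"
        using x \<mu>Y.D.invertible_Cmp[OF GH.lax_comps[OF l(2) a \<nu>x]
            \<mu>Y.far_closed[OF FG.lax_comps[OF l(1) a x]] i(2)
            \<mu>Y.invertible_far[OF i(1) FG.lax_comps[OF l(1) a x]]]
        by (simp add: comp_trans_T1[OF l a])
    qed
    then show ?thesis using invertible_fun_cat_iff[OF FH.lax_Hom[OF lc a]] by blast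
  qed
  then show ?thesis using lc by (simp add: sigma_natural_def)
qed

lemma modification_comp:
  assumes l: "lax_trans K Cat F G \<nu>" "lax_trans K Cat F G \<nu>'"
      "lax_trans K Cat G H \<mu>" "lax_trans K Cat G H \<mu>'"
    and m: "modification K Cat F G \<nu> \<nu>' m" and n: "modification K Cat G H \<mu> \<mu>' n"
  shows "modification K Cat F H (comp_trans K Cat F G H \<mu> \<nu>) (comp_trans K Cat F G H \<mu>' \<nu>')
    (\<lambda>X\<in>Ob K. Cm2 Cat (F0 F X) (F0 G X) (F0 H X) (n X) (m X))"
    (is "modification _ _ _ _ ?c ?c' ?r")
proof (subst FH.modification_iff[OF lax_trans_comp[OF l(1,3)] lax_trans_comp[OF l(2,4)]],
    intro conjI ballI)
  fix X assume X: "X \<in> Ob K"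
  have "Cm2 Cat (F0 F X) (F0 G X) (F0 H X) (n X) (m X) \<in> Hom (Hm Cat (F0 F X) (F0 H X))
      (Cm1 Cat (F0 F X) (F0 G X) (F0 H X) (T0 \<mu> X) (T0 \<nu> X))
      (Cm1 Cat (F0 F X) (F0 G X) (F0 H X) (T0 \<mu>' X) (T0 \<nu>' X))"
    using FG.mod_Hom[OF m l(1,2) X] GH.mod_Hom[OF n l(3,4) X] FG.F.F0_category[OF X]
      FG.G.F0_category[OF X] GH.G.F0_category[OF X] by (intro FG.F.B.Cm2_closed) simp_all
  then show "?r X \<in> Hom (fun_cat (F0 F X) (F0 H X)) (T0 ?c X) (T0 ?c' X)"
    using X by (simp add: comp_trans_T0)
next
  fix X Y f x assume a: "X \<in> Ob K" "Y \<in> Ob K" "f \<in> Obj (Hm K X Y)" and x: "x \<in> Obj (F0 F X)"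
  interpret \<nu>'X: cat_functor "F0 F X" "F0 G X" "T0 \<nu>' X" using FG.lax_functor[OF l(2) a(1)] .
  interpret \<nu>X: cat_functor "F0 F X" "F0 G X" "T0 \<nu> X" using FG.lax_functor[OF l(1) a(1)] .
  interpret \<nu>'Y: cat_functor "F0 F Y" "F0 G Y" "T0 \<nu>' Y" using FG.lax_functor[OF l(2) a(2)] .
  interpret \<mu>X: cat_functor "F0 G X" "F0 H X" "T0 \<mu> X" using GH.lax_functor[OF l(3) a(1)] .
  interpret \<mu>Y: cat_functor "F0 G Y" "F0 H Y" "T0 \<mu> Y" using GH.lax_functor[OF l(3) a(2)] .
  interpret \<mu>'Y: cat_functor "F0 G Y" "F0 H Y" "T0 \<mu>' Y" using GH.lax_functor[OF l(4) a(2)] .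
  interpret Hf: cat_functor "F0 H X" "F0 H Y" "F1 H X Y f" using GH.G.F1_functor[OF a] .
  interpret Gf: cat_functor "F0 G X" "F0 G Y" "F1 G X Y f" using FG.G.F1_functor[OF a] .
  note \<nu>'x = \<nu>'X.fob_closed[OF x] and \<nu>x = \<nu>X.fob_closed[OF x] and Fx = FG.F.F1_fob[OF a x]
  note mX = FG.mod_comps[OF m l(1,2) a(1) x] and mY = FG.mod_comps[OF m l(1,2) a(2) Fx]
  note nX = GH.mod_comps[OF n l(3,4) a(1) \<nu>'x]
  note nY = GH.mod_comps[OF n l(3,4) a(2) \<nu>'Y.fob_closed[OF Fx]]
  note nG = GH.mod_comps[OF n l(3,4) a(2) Gf.fob_closed[OF \<nu>'x]]
  note t\<nu> = FG.lax_comps[OF l(1) a x] and t\<nu>' = FG.lax_comps[OF l(2) a x]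
  note t\<mu>' = GH.lax_comps[OF l(4) a \<nu>'x] and t\<mu> = GH.lax_comps[OF l(3) a \<nu>'x]
    and t\<mu>x = GH.lax_comps[OF l(3) a \<nu>x]
  note HnX = Hf.far_closed[OF nX] and HmX = Hf.far_closed[OF \<mu>X.far_closed[OF mX]]
  note GmX = Gf.far_closed[OF mX]
  let ?H = "Cmp (F0 H Y)" and ?Hf = "far (F1 H X Y f)" and ?\<mu> = "far (T0 \<mu> Y)"
    and ?\<nu>' = "comps (T1 \<nu>' X Y f) x" and ?\<nu> = "comps (T1 \<nu> X Y f) x"
    and ?\<mu>' = "comps (T1 \<mu>' X Y f) (fob (T0 \<nu>' X) x)" and ?n = "comps (n X) (fob (T0 \<nu>' X) x)"
    and ?m = "comps (m X) x" and ?mY = "comps (m Y) (fob (F1 F X Y f) x)"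
    and ?nY = "comps (n Y) (fob (T0 \<nu>' Y) (fob (F1 F X Y f) x))"
    and ?nG = "comps (n Y) (fob (F1 G X Y f) (fob (T0 \<nu>' X) x))"
    and ?\<mu>f = "comps (T1 \<mu> X Y f) (fob (T0 \<nu>' X) x)" and ?\<mu>x = "comps (T1 \<mu> X Y f) (fob (T0 \<nu> X) x)"
  have "?H (?H (far (T0 \<mu>' Y) ?\<nu>') ?\<mu>') (?Hf (Cmp (F0 H X) ?n (far (T0 \<mu> X) ?m))) =
      ?H (far (T0 \<mu>' Y) ?\<nu>') (?H (?H ?\<mu>' (?Hf ?n)) (?Hf (far (T0 \<mu> X) ?m)))"
    using Hf.far_Cmp[OF \<mu>X.far_closed[OF mX] nX] \<mu>Y.D.Cmp_assoc[OF HmX HnX t\<mu>']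
      \<mu>Y.D.Cmp_assoc[OF \<mu>Y.D.Cmp_closed[OF HmX HnX] t\<mu>' \<mu>'Y.far_closed[OF t\<nu>']] by simp
  \<comment> \<open>The modification equation for n at f, taken at the image of x under
    \<nu>'.\<close>
  also have "\<dots> = ?H (far (T0 \<mu>' Y) ?\<nu>') (?H ?nG (?H ?\<mu>f (?Hf (far (T0 \<mu> X) ?m))))"
    using GH.mod_1cell[OF n l(3,4) a \<nu>'x] \<mu>Y.D.Cmp_assoc[OF HmX t\<mu> nG] by simp
  \<comment> \<open>Two naturality squares bring \<nu>' next to m: that of \<open>n\<^sub>Y\<close>
    at the arrow \<open>(\<nu>'\<^sub>f)\<^sub>x\<close>, and that of \<open>\<mu>\<^sub>f\<close>
    at the component of m. The modification equation for m can then be applied inside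
    \<open>\<mu>\<^sub>Y\<close>.\<close>
  also have "\<dots> = ?H (?H ?nY (?\<mu> ?\<nu>')) (?H (?\<mu> (far (F1 G X Y f) ?m)) ?\<mu>x)"
    using GH.lax_natural[OF l(3) a mX] GH.mod_natural[OF n l(3,4) a(2) t\<nu>']
      \<mu>Y.D.Cmp_assoc[OF \<mu>Y.D.Cmp_closed[OF HmX t\<mu>] nG \<mu>'Y.far_closed[OF t\<nu>']] by simp
  also have "\<dots> = ?H ?nY (?H (?\<mu> (Cmp (F0 G Y) ?\<nu>' (far (F1 G X Y f) ?m))) ?\<mu>x)"
    using \<mu>Y.far_Cmp[OF GmX t\<nu>']
      \<mu>Y.D.Cmp_assoc[OF t\<mu>x \<mu>Y.far_closed[OF GmX] \<mu>Y.far_closed[OF t\<nu>']]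
      \<mu>Y.D.Cmp_assoc[OF \<mu>Y.D.Cmp_closed[OF t\<mu>x \<mu>Y.far_closed[OF GmX]] \<mu>Y.far_closed[OF t\<nu>'] nY]
    by simp
  also have "\<dots> = ?H ?nY (?H (?H (?\<mu> ?mY) (?\<mu> ?\<nu>)) ?\<mu>x)"
    using FG.mod_1cell[OF m l(1,2) a x] \<mu>Y.far_Cmp[OF t\<nu> mY] by simp
  also have "\<dots> = ?H (?H ?nY (?\<mu> ?mY)) (?H (?\<mu> ?\<nu>) ?\<mu>x)"
    using \<mu>Y.D.Cmp_assoc[OF t\<mu>x \<mu>Y.far_closed[OF t\<nu>] \<mu>Y.far_closed[OF mY]]
      \<mu>Y.D.Cmp_assoc[OF \<mu>Y.D.Cmp_closed[OF t\<mu>x \<mu>Y.far_closed[OF t\<nu>]] \<mu>Y.far_closed[OF mY] nY]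
    by simp
  finally show "?H (comps (T1 ?c' X Y f) x) (?Hf (comps (?r X) x)) =
      ?H (comps (?r Y) (fob (F1 F X Y f) x)) (comps (T1 ?c X Y f) x)"
    using a x Fx FG.mod_Hom[OF m l(1,2)] GH.mod_Hom[OF n l(3,4)]
    by (simp add: comp_trans_T1[OF l(1,3) a] comp_trans_T1[OF l(2,4) a] Hom_fun_cat)
qed simp

end

section \<open>Constructions on 2-categories and 2-functors\<close>

lemma op2_simps [simp]:
  "Ob (op2 A) = Ob A" "Hm (op2 A) X Y = Hm A Y X" "Id1 (op2 A) = Id1 A"
  "Cm1 (op2 A) X Y Z g f = Cm1 A Z Y X f g" "Cm2 (op2 A) X Y Z \<beta> \<alpha> = Cm2 A Z Y X \<alpha> \<beta>"
  by (simp_all add: op2_def)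

lemma op2_op2: "op2 (op2 A) = A"
  by (simp add: op2_def)

lemma op_class_op_class: "op_class (op_class S) = S"
  by (simp add: op_class_def fun_eq_iff)

lemma two_category_op2:
  assumes "two_category A"
  shows "two_category (op2 A)"
proof -
  interpret two_category A by fact
  show ?thesis
    by (rule two_category.intro)
      (simp_all add: Hm_category Id1_closed Cm1_closed Cm2_closed Cm2_Id2 interchange
        Cm1_Id1_left Cm1_Id1_right Cm2_Id1_left Cm2_Id1_right Cm1_assoc Cm2_assoc)
qed

section \<open>Whiskering and interchange\<close>

context two_category
begin

lemma Id2_closed: "\<lbrakk>X \<in> Ob A; Y \<in> Ob A; f \<in> Obj (Hm A X Y)\<rbrakk> \<Longrightarrow> Id2 A X Y f \<in> Hom (Hm A X Y) f f"
  using category.Idn_closed[OF Hm_category] by blast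

lemma cell_Obj:
  assumes "X \<in> Ob A" "Y \<in> Ob A" "\<alpha> \<in> Hom (Hm A X Y) f f'"
  shows "f \<in> Obj (Hm A X Y)" "f' \<in> Obj (Hm A X Y)"
  using category.Hom_Obj[OF Hm_category[OF assms(1,2)] assms(3)] by auto

lemma lwh_closed:
  assumes "X \<in> Ob A" "Y \<in> Ob A" "Z \<in> Ob A" "g \<in> Obj (Hm A Y Z)" "\<alpha> \<in> Hom (Hm A X Y) f f'"
  shows "lwh A X Y Z g \<alpha> \<in> Hom (Hm A X Z) (Cm1 A X Y Z g f) (Cm1 A X Y Z g f')"
  unfolding lwh_def using Cm2_closed[OF assms(1-3,5) Id2_closed[OF assms(2-4)]] .

lemma rwh_closed:
  assumes "X \<in> Ob A" "Y \<in> Ob A" "Z \<in> Ob A" "f \<in> Obj (Hm A X Y)" "\<beta> \<in> Hom (Hm A Y Z) g g'"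
  shows "rwh A X Y Z \<beta> f \<in> Hom (Hm A X Z) (Cm1 A X Y Z g f) (Cm1 A X Y Z g' f)"
  unfolding rwh_def using Cm2_closed[OF assms(1-3) Id2_closed[OF assms(1,2,4)] assms(5)] .

lemma lwh_Id2:
  "\<lbrakk>X \<in> Ob A; Y \<in> Ob A; Z \<in> Ob A; f \<in> Obj (Hm A X Y); g \<in> Obj (Hm A Y Z)\<rbrakk> \<Longrightarrow>
      lwh A X Y Z g (Id2 A X Y f) = Id2 A X Z (Cm1 A X Y Z g f)"
  and rwh_Id2:
  "\<lbrakk>X \<in> Ob A; Y \<in> Ob A; Z \<in> Ob A; f \<in> Obj (Hm A X Y); g \<in> Obj (Hm A Y Z)\<rbrakk> \<Longrightarrow>
      rwh A X Y Z (Id2 A Y Z g) f = Id2 A X Z (Cm1 A X Y Z g f)"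
  by (simp_all add: lwh_def rwh_def Cm2_Id2)

lemma lwh_Cmp:
  assumes "X \<in> Ob A" "Y \<in> Ob A" "Z \<in> Ob A" "g \<in> Obj (Hm A Y Z)"
    "\<alpha> \<in> Hom (Hm A X Y) f f'" "\<alpha>' \<in> Hom (Hm A X Y) f' f''"
  shows "lwh A X Y Z g (Cmp (Hm A X Y) \<alpha>' \<alpha>) =
    Cmp (Hm A X Z) (lwh A X Y Z g \<alpha>') (lwh A X Y Z g \<alpha>)"
  using interchange[OF assms(1-3,5,6) Id2_closed[OF assms(2-4)] Id2_closed[OF assms(2-4)]]
    category.Cmp_Idn_left[OF Hm_category[OF assms(2,3)] Id2_closed[OF assms(2-4)]]
  by (simp add: lwh_def)

lemma rwh_Cmp:
  assumes "X \<in> Ob A" "Y \<in> Ob A" "Z \<in> Ob A" "f \<in> Obj (Hm A X Y)"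
    "\<beta> \<in> Hom (Hm A Y Z) g g'" "\<beta>' \<in> Hom (Hm A Y Z) g' g''"
  shows "rwh A X Y Z (Cmp (Hm A Y Z) \<beta>' \<beta>) f =
    Cmp (Hm A X Z) (rwh A X Y Z \<beta>' f) (rwh A X Y Z \<beta> f)"
  using interchange[OF assms(1-3) Id2_closed[OF assms(1,2,4)] Id2_closed[OF assms(1,2,4)] assms(5,6)]
    category.Cmp_Idn_left[OF Hm_category[OF assms(1,2)] Id2_closed[OF assms(1,2,4)]]
  by (simp add: rwh_def)

text \<open>This lemma and the next evaluate the two ways around the interchange square to the same
  \<open>Cm2\<close>. Together they give naturality of whiskering.\<close>

lemma Cmp_rwh_lwh:
  assumes "X \<in> Ob A" "Y \<in> Ob A" "Z \<in> Ob A" "\<alpha> \<in> Hom (Hm A X Y) f f'" "\<beta> \<in> Hom (Hm A Y Z) g g'"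
  shows "Cmp (Hm A X Z) (rwh A X Y Z \<beta> f') (lwh A X Y Z g \<alpha>) = Cm2 A X Y Z \<beta> \<alpha>"
proof -
  note f = cell_Obj[OF assms(1,2,4)] and g = cell_Obj[OF assms(2,3,5)]
  show ?thesis
    using interchange[OF assms(1-4) Id2_closed[OF assms(1,2) f(2)] Id2_closed[OF assms(2,3) g(1)] assms(5)]
      category.Cmp_Idn_left[OF Hm_category[OF assms(1,2)] assms(4)]
      category.Cmp_Idn_right[OF Hm_category[OF assms(2,3)] assms(5)]
    by (simp add: lwh_def rwh_def)
qed

lemma Cmp_lwh_rwh:
  assumes "X \<in> Ob A" "Y \<in> Ob A" "Z \<in> Ob A" "\<alpha> \<in> Hom (Hm A X Y) f f'" "\<beta> \<in> Hom (Hm A Y Z) g g'"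
  shows "Cmp (Hm A X Z) (lwh A X Y Z g' \<alpha>) (rwh A X Y Z \<beta> f) = Cm2 A X Y Z \<beta> \<alpha>"
proof -
  note f = cell_Obj[OF assms(1,2,4)] and g = cell_Obj[OF assms(2,3,5)]
  show ?thesis
    using interchange[OF assms(1-3) Id2_closed[OF assms(1,2) f(1)] assms(4,5) Id2_closed[OF assms(2,3) g(2)]]
      category.Cmp_Idn_right[OF Hm_category[OF assms(1,2)] assms(4)]
      category.Cmp_Idn_left[OF Hm_category[OF assms(2,3)] assms(5)]
    by (simp add: lwh_def rwh_def)
qed

lemma Id2_Arr: "\<lbrakk>X \<in> Ob A; Y \<in> Ob A; f \<in> Obj (Hm A X Y)\<rbrakk> \<Longrightarrow> Id2 A X Y f \<in> Arr (Hm A X Y)"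
  using HomD(1)[OF Id2_closed] .

lemma lwh_lwh:
  assumes "X \<in> Ob A" "Y \<in> Ob A" "Z \<in> Ob A" "V \<in> Ob A" "\<alpha> \<in> Arr (Hm A X Y)"
    "g \<in> Obj (Hm A Y Z)" "h \<in> Obj (Hm A Z V)"
  shows "lwh A X Z V h (lwh A X Y Z g \<alpha>) = lwh A X Y V (Cm1 A Y Z V h g) \<alpha>"
  using assms Cm2_assoc[OF assms(1-5) Id2_Arr[OF assms(2,3,6)] Id2_Arr[OF assms(3,4,7)]]
  by (simp add: lwh_def Cm2_Id2)

lemma rwh_rwh:
  assumes "X \<in> Ob A" "Y \<in> Ob A" "Z \<in> Ob A" "V \<in> Ob A" "f \<in> Obj (Hm A X Y)"
    "g \<in> Obj (Hm A Y Z)" "\<gamma> \<in> Arr (Hm A Z V)"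
  shows "rwh A X Y V (rwh A Y Z V \<gamma> g) f = rwh A X Z V \<gamma> (Cm1 A X Y Z g f)"
  using assms Cm2_assoc[OF assms(1-4) Id2_Arr[OF assms(1,2,5)] Id2_Arr[OF assms(2,3,6)] assms(7)]
  by (simp add: rwh_def Cm2_Id2)

lemma lwh_rwh:
  assumes "X \<in> Ob A" "Y \<in> Ob A" "Z \<in> Ob A" "V \<in> Ob A" "f \<in> Obj (Hm A X Y)"
    "\<beta> \<in> Arr (Hm A Y Z)" "h \<in> Obj (Hm A Z V)"
  shows "lwh A X Z V h (rwh A X Y Z \<beta> f) = rwh A X Y V (lwh A Y Z V h \<beta>) f"
  using assms Cm2_assoc[OF assms(1-4) Id2_Arr[OF assms(1,2,5)] assms(6) Id2_Arr[OF assms(3,4,7)]]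
  by (simp add: lwh_def rwh_def)

end

section \<open>Composite 2-functors\<close>

lemma comp_twofct_simps [simp]:
  "F0 (comp_twofct A G F) X = F0 G (F0 F X)"
  "f \<in> Obj (Hm A X Y) \<Longrightarrow> F1 (comp_twofct A G F) X Y f = F1 G (F0 F X) (F0 F Y) (F1 F X Y f)"
  "\<alpha> \<in> Arr (Hm A X Y) \<Longrightarrow> F2 (comp_twofct A G F) X Y \<alpha> = F2 G (F0 F X) (F0 F Y) (F2 F X Y \<alpha>)"
  by (simp_all add: comp_twofct_def)

lemma two_functor_comp:
  assumes "two_functor A B F" "two_functor B C G"
  shows "two_functor A C (comp_twofct A G F)"
proof -
  interpret F: two_functor A B F by fact
  interpret G: two_functor B C G by fact
  show ?thesis
  proof (intro two_functor.intro two_functor_axioms.intro F.A.two_category_axioms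
      G.B.two_category_axioms)
    fix X assume "X \<in> Ob A"
    then show "F0 (comp_twofct A G F) X \<in> Ob C"
      "F1 (comp_twofct A G F) X X (Id1 A X) = Id1 C (F0 (comp_twofct A G F) X)"
      using F.F0_closed G.F0_closed F.A.Id1_closed F.F1_Id1 G.F1_Id1 by simp_all
  next
    fix X Y assume a: "X \<in> Ob A" "Y \<in> Ob A"
    show "cat_functor (Hm A X Y)
        (Hm C (F0 (comp_twofct A G F) X) (F0 (comp_twofct A G F) Y)) (Fh (comp_twofct A G F) X Y)"
      using cat_functor_comp_fct[OF F.Fh_functor[OF a]
          G.Fh_functor[OF F.F0_closed[OF a(1)] F.F0_closed[OF a(2)]]]
      by (simp add: comp_twofct_def)
  next
    fix X Y Z f g
    assume a: "X \<in> Ob A" "Y \<in> Ob A" "Z \<in> Ob A" "f \<in> Obj (Hm A X Y)" "g \<in> Obj (Hm A Y Z)"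
    note o = F.F0_closed[OF a(1)] F.F0_closed[OF a(2)] F.F0_closed[OF a(3)]
    show "F1 (comp_twofct A G F) X Z (Cm1 A X Y Z g f) =
        Cm1 C (F0 (comp_twofct A G F) X) (F0 (comp_twofct A G F) Y) (F0 (comp_twofct A G F) Z)
          (F1 (comp_twofct A G F) Y Z g) (F1 (comp_twofct A G F) X Y f)"
      using a F.A.Cm1_closed[OF a] F.F1_Cm1[OF a]
        G.F1_Cm1[OF o cat_functor.fob_closed[OF F.Fh_functor[OF a(1,2)] a(4)]
          cat_functor.fob_closed[OF F.Fh_functor[OF a(2,3)] a(5)]] by simp
  next
    fix X Y Z \<alpha> \<beta>
    assume a: "X \<in> Ob A" "Y \<in> Ob A" "Z \<in> Ob A" "\<alpha> \<in> Arr (Hm A X Y)" "\<beta> \<in> Arr (Hm A Y Z)"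
    note o = F.F0_closed[OF a(1)] F.F0_closed[OF a(2)] F.F0_closed[OF a(3)]
    show "F2 (comp_twofct A G F) X Z (Cm2 A X Y Z \<beta> \<alpha>) =
        Cm2 C (F0 (comp_twofct A G F) X) (F0 (comp_twofct A G F) Y) (F0 (comp_twofct A G F) Z)
          (F2 (comp_twofct A G F) Y Z \<beta>) (F2 (comp_twofct A G F) X Y \<alpha>)"
      using a HomD(1)[OF F.A.Cm2_closed[OF a(1-3) Arr_Hom[OF a(4)] Arr_Hom[OF a(5)]]] F.F2_Cm2[OF a]
        G.F2_Cm2[OF o cat_functor.far_Arr[OF F.Fh_functor[OF a(1,2)] a(4)]
          cat_functor.far_Arr[OF F.Fh_functor[OF a(2,3)] a(5)]] by simp
  qed
qed

section \<open>The terminal category and the constant 2-functor at it\<close>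

lemma terminal_cat_simps [simp]:
  "Obj terminal_cat = {undefined}" "Arr terminal_cat = {undefined}"
  "Dom terminal_cat f = undefined" "Cod terminal_cat f = undefined"
  "Idn terminal_cat x = undefined" "Cmp terminal_cat g f = undefined"
  "Hom terminal_cat x y = (if x = undefined \<and> y = undefined then {undefined} else {})"
  by (auto simp: terminal_cat_def Hom_def)

lemma category_terminal_cat: "category terminal_cat"
  by unfold_locales (auto split: if_splits)

lemma const1_simps [simp]:
  "F0 (const1 K) X = terminal_cat"
  "f \<in> Obj (Hm K X Y) \<Longrightarrow> F1 (const1 K) X Y f = id_fct terminal_cat"
  "\<alpha> \<in> Arr (Hm K X Y) \<Longrightarrow> F2 (const1 K) X Y \<alpha> =
    Id2 Cat terminal_cat terminal_cat (id_fct terminal_cat)"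
  by (simp_all add: const1_def del: Cat_simps)

text \<open>That \<open>Cat\<close> is a 2-category enters as a hypothesis. It is available wherever
  some 2-functor into \<open>Cat\<close> is given, since a codomain is a 2-category by
  definition.\<close>

lemma two_functor_const1:
  assumes "two_category K" "two_category (Cat :: ('u, 'v) cat_2cat)"
  shows "two_functor K (Cat :: ('u, 'v) cat_2cat) (const1 K)"
proof -
  interpret K: two_category K by fact
  interpret Cat: two_category "Cat :: ('u, 'v) cat_2cat" by fact
  let ?t = "terminal_cat :: ('u, 'v) cat"
  have t: "?t \<in> Ob Cat" by (simp add: category_terminal_cat)
  have i: "id_fct ?t \<in> Obj (Hm Cat ?t ?t)" using Cat.Id1_closed[OF t] by simp
  note I = Cat.Id2_closed[OF t t i]
  have c: "Cm1 Cat ?t ?t ?t (id_fct ?t) (id_fct ?t) = id_fct ?t"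
    using Cat.Cm1_Id1_left[OF t t i] by simp
  show ?thesis
  proof (intro two_functor.intro two_functor_axioms.intro assms, goal_cases)
    case (1 X) show ?case using t by simp
  next
    case (2 X Y)
    interpret H: category "Hm K X Y" using K.Hm_category[OF 2] .
    interpret C: category "Hm Cat ?t ?t" using Cat.Hm_category[OF t t] .
    have "cat_functor (Hm K X Y) (Hm Cat ?t ?t) (Fh (const1 K) X Y)"
    proof (unfold_locales, goal_cases)
      case (4 f x y)
      then show ?case using I H.Hom_Obj[OF 4] HomD[OF 4] by (simp del: Cat_simps)
    next
      case (6 f x y g z)
      then show ?case using C.Cmp_Idn_left[OF I]
        by (simp del: Cat_simps add: HomD(1)[OF 6(1)] HomD(1)[OF 6(2)] HomD(1)[OF H.Cmp_closed[OF 6]])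
    qed (use i H.Idn_Arr in \<open>simp_all add: const1_def\<close>)
    then show ?case by (simp del: Cat_simps)
  next
    case (3 X)
    then show ?case using K.Id1_closed by simp
  next
    case (4 X Y Z f g)
    then show ?case using K.Cm1_closed[OF 4] c by simp
  next
    case (5 X Y Z \<alpha> \<beta>)
    note h = HomD(1)[OF K.Cm2_closed[OF 5(1-3) Arr_Hom[OF 5(4)] Arr_Hom[OF 5(5)]]]
    show ?case
      using 5 h Cat.Cm2_Id2[OF t t t i i] c by (simp del: Cat_simps)
  qed
qed

section \<open>The 2-category of elements\<close>

text \<open>\<open>El\<close> is defined by pattern matching on pairs and triples. Restated with
  projections, its operations rewrite on variables p, q, u and c without case splits.\<close>

lemma El_simps:
  "p \<in> Ob (El K Q) \<longleftrightarrow> snd p \<in> Ob K \<and> fst p \<in> Obj (F0 Q (snd p))"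
  "u \<in> Obj (Hm (El K Q) p q) \<longleftrightarrow> fst u \<in> Obj (Hm K (snd p) (snd q)) \<and>
    snd u \<in> Hom (F0 Q (snd q)) (fob (F1 Q (snd p) (snd q) (fst u)) (fst p)) (fst q)"
  "c \<in> Arr (Hm (El K Q) p q) \<longleftrightarrow> fst c \<in> Obj (Hm (El K Q) p q) \<and>
    tgt c \<in> Obj (Hm (El K Q) p q) \<and>
    comps c \<in> Hom (Hm K (snd p) (snd q)) (fst (fst c)) (fst (tgt c)) \<and>
    Cmp (F0 Q (snd q)) (snd (tgt c)) (comps (F2 Q (snd p) (snd q) (comps c)) (fst p)) = snd (fst c)"
  "Dom (Hm (El K Q) p q) = fst"
  "Cod (Hm (El K Q) p q) = tgt"
  "Idn (Hm (El K Q) p q) u = (u, Id2 K (snd p) (snd q) (fst u), u)"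
  "Cmp (Hm (El K Q) p q) d c = (fst c, Cmp (Hm K (snd p) (snd q)) (comps d) (comps c), tgt d)"
  "Id1 (El K Q) p = (Id1 K (snd p), Idn (F0 Q (snd p)) (fst p))"
  "Cm1 (El K Q) p q r v u = (Cm1 K (snd p) (snd q) (snd r) (fst v) (fst u),
    Cmp (F0 Q (snd r)) (snd v) (far (F1 Q (snd q) (snd r) (fst v)) (snd u)))"
  "Cm2 (El K Q) p q r d c = (Cm1 (El K Q) p q r (fst d) (fst c),
    Cm2 K (snd p) (snd q) (snd r) (comps d) (comps c), Cm1 (El K Q) p q r (tgt d) (tgt c))"
  by (simp_all add: El_def Let_def case_prod_unfold comps_def tgt_def)

lemma El_Hom:
  "c \<in> Hom (Hm (El K Q) p q) u v \<longleftrightarrow> fst c = u \<and> tgt c = v \<and>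
    u \<in> Obj (Hm (El K Q) p q) \<and> v \<in> Obj (Hm (El K Q) p q) \<and>
    comps c \<in> Hom (Hm K (snd p) (snd q)) (fst u) (fst v) \<and>
    Cmp (F0 Q (snd q)) (snd v) (comps (F2 Q (snd p) (snd q) (comps c)) (fst p)) = snd u"
  unfolding Hom_def[of "Hm (El K Q) p q"] by (auto simp: El_simps)


context cat_valued
begin

lemma El_ObjD:
  assumes "u \<in> Obj (Hm (El K F) p q)"
  shows "fst u \<in> Obj (Hm K (snd p) (snd q))"
    "snd u \<in> Hom (F0 F (snd q)) (fob (F1 F (snd p) (snd q) (fst u)) (fst p)) (fst q)"
  using assms by (simp_all add: El_simps)

text \<open>Functoriality of F on 1-cells is what makes the second entry of the composite start at
  the required object.\<close>

lemma El_Cm1_closed: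
  assumes p: "p \<in> Ob (El K F)" "q \<in> Ob (El K F)" "r \<in> Ob (El K F)"
    and u: "u \<in> Obj (Hm (El K F) p q)" and v: "v \<in> Obj (Hm (El K F) q r)"
  shows "Cm1 (El K F) p q r v u \<in> Obj (Hm (El K F) p r)"
proof -
  have o: "snd p \<in> Ob K" "snd q \<in> Ob K" "snd r \<in> Ob K" "fst p \<in> Obj (F0 F (snd p))"
    using p by (simp_all add: El_simps)
  note u = El_ObjD[OF u] and v = El_ObjD[OF v]
  show ?thesis
    using A.Cm1_closed[OF o(1-3) u(1) v(1)]
      category.Cmp_closed[OF F0_category[OF o(3)] F1_far[OF o(2,3) v(1) u(2)] v(2)]
    by (simp add: El_simps(2,9) F1_Cm1_fob[OF o(1-3) u(1) v(1) o(4)])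
qed

lemma El_Cm1_Id1_right:
  assumes p: "p \<in> Ob (El K F)" "q \<in> Ob (El K F)" and u: "u \<in> Obj (Hm (El K F) p q)"
  shows "Cm1 (El K F) p p q u (Id1 (El K F) p) = u"
proof -
  have o: "snd p \<in> Ob K" "snd q \<in> Ob K" "fst p \<in> Obj (F0 F (snd p))"
    using p by (simp_all add: El_simps)
  note u = El_ObjD[OF u]
  show ?thesis
    using A.Cm1_Id1_right[OF o(1,2) u(1)] category.Cmp_Idn_right[OF F0_category[OF o(2)] u(2)]
      cat_functor.far_Idn[OF F1_functor[OF o(1,2) u(1)] o(3)]
    by (simp add: El_simps(8,9) prod_eq_iff)
qed

lemma El_Cm1_Id1_left:
  assumes p: "p \<in> Ob (El K F)" "q \<in> Ob (El K F)" and u: "u \<in> Obj (Hm (El K F) p q)"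
  shows "Cm1 (El K F) p q q (Id1 (El K F) q) u = u"
proof -
  have o: "snd p \<in> Ob K" "snd q \<in> Ob K" "fst p \<in> Obj (F0 F (snd p))"
    using p by (simp_all add: El_simps)
  note u = El_ObjD[OF u]
  show ?thesis
    using A.Cm1_Id1_left[OF o(1,2) u(1)] category.Cmp_Idn_left[OF F0_category[OF o(2)] u(2)]
      F1_Id1_far[OF o(2) HomD(1)[OF u(2)]]
    by (simp add: El_simps(8,9) prod_eq_iff)
qed

lemma El_Cm1_assoc:
  assumes p: "p \<in> Ob (El K F)" "q \<in> Ob (El K F)" "r \<in> Ob (El K F)" "s \<in> Ob (El K F)"
    and u: "u \<in> Obj (Hm (El K F) p q)" and v: "v \<in> Obj (Hm (El K F) q r)"
    and w: "w \<in> Obj (Hm (El K F) r s)"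
  shows "Cm1 (El K F) p r s w (Cm1 (El K F) p q r v u) =
    Cm1 (El K F) p q s (Cm1 (El K F) q r s w v) u"
proof -
  have o: "snd p \<in> Ob K" "snd q \<in> Ob K" "snd r \<in> Ob K" "snd s \<in> Ob K"
    using p by (simp_all add: El_simps)
  note u = El_ObjD[OF u] and v = El_ObjD[OF v] and w = El_ObjD[OF w]
  note Fu = F1_far[OF o(2,3) v(1) u(2)]
  interpret W: cat_functor "F0 F (snd r)" "F0 F (snd s)" "F1 F (snd r) (snd s) (fst w)"
    using F1_functor[OF o(3,4) w(1)] .
  show ?thesis
    using A.Cm1_assoc[OF o u(1) v(1) w(1)] W.far_Cmp[OF Fu v(2)]
      F1_Cm1_far[OF o(2-4) v(1) w(1) HomD(1)[OF u(2)]]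
      W.D.Cmp_assoc[OF W.far_closed[OF Fu] W.far_closed[OF v(2)] w(2)]
    by (simp add: El_simps(9))
qed

lemma El_cellD:
  assumes "c \<in> Hom (Hm (El K F) p q) u v"
  shows "u \<in> Obj (Hm (El K F) p q)" "v \<in> Obj (Hm (El K F) p q)" "fst c = u" "tgt c = v"
    "comps c \<in> Hom (Hm K (snd p) (snd q)) (fst u) (fst v)"
    "Cmp (F0 F (snd q)) (snd v) (comps (F2 F (snd p) (snd q) (comps c)) (fst p)) = snd u"
  using assms by (simp_all add: El_Hom)

text \<open>A 2-cell of elements is a 2-cell of the base together with its ends, so equations of
  2-cells follow from those of the base and of the 1-cells at the ends. The substance lies in
  closure: vertical and horizontal composites must again satisfy the condition on second
  entries.\<close>

lemma two_category_El: "two_category (El K F)"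
proof (rule two_category.intro, goal_cases)
  case (1 p q)
  then have pq: "snd p \<in> Ob K" "snd q \<in> Ob K" and x: "fst p \<in> Obj (F0 F (snd p))"
    by (auto simp: El_simps)
  interpret H: category "Hm K (snd p) (snd q)" using A.Hm_category[OF pq] .
  interpret Q: category "F0 F (snd q)" using F0_category[OF pq(2)] .
  show ?case
  proof
    fix c assume "c \<in> Arr (Hm (El K F) p q)"
    then show "Dom (Hm (El K F) p q) c \<in> Obj (Hm (El K F) p q)"
      "Cod (Hm (El K F) p q) c \<in> Obj (Hm (El K F) p q)" by (simp_all add: El_simps)
  next
    fix u assume u: "u \<in> Obj (Hm (El K F) p q)"
    then have u': "fst u \<in> Obj (Hm K (snd p) (snd q))"
      "snd u \<in> Hom (F0 F (snd q)) (fob (F1 F (snd p) (snd q) (fst u)) (fst p)) (fst q)"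
      by (simp_all add: El_simps)
    show "Idn (Hm (El K F) p q) u \<in> Hom (Hm (El K F) p q) u u"
      using u H.Idn_closed[OF u'(1)] Q.Cmp_Idn_right[OF u'(2)]
      by (simp add: El_Hom El_simps(6) F2_Idn[OF pq u'(1) x])
  next
    fix c d u v w
    assume c: "c \<in> Hom (Hm (El K F) p q) u v" and d: "d \<in> Hom (Hm (El K F) p q) v w"
    then have u: "u \<in> Obj (Hm (El K F) p q)" "w \<in> Obj (Hm (El K F) p q)"
      and c': "comps c \<in> Hom (Hm K (snd p) (snd q)) (fst u) (fst v)"
      and d': "comps d \<in> Hom (Hm K (snd p) (snd q)) (fst v) (fst w)"
      and e: "Cmp (F0 F (snd q)) (snd v) (comps (F2 F (snd p) (snd q) (comps c)) (fst p)) = snd u"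
      "Cmp (F0 F (snd q)) (snd w) (comps (F2 F (snd p) (snd q) (comps d)) (fst p)) = snd v"
      by (simp_all add: El_Hom)
    have w: "snd w \<in> Hom (F0 F (snd q)) (fob (F1 F (snd p) (snd q) (fst w)) (fst p)) (fst q)"
      using u(2) by (simp add: El_simps)
    show "Cmp (Hm (El K F) p q) d c \<in> Hom (Hm (El K F) p q) u w"
      using c d u H.Cmp_closed[OF c' d'] F2_Cmp[OF pq c' d' x] e
        Q.Cmp_assoc[OF F2_comps[OF pq c' x] F2_comps[OF pq d' x] w]
      by (simp add: El_Hom El_simps(7))
  next
    fix c u v assume c: "c \<in> Hom (Hm (El K F) p q) u v"
    then have c': "comps c \<in> Hom (Hm K (snd p) (snd q)) (fst u) (fst v)" "fst c = u" "tgt c = v"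
      by (simp_all add: El_Hom)
    show "Cmp (Hm (El K F) p q) c (Idn (Hm (El K F) p q) u) = c"
      "Cmp (Hm (El K F) p q) (Idn (Hm (El K F) p q) v) c = c"
      using H.Cmp_Idn_left[OF c'(1)] H.Cmp_Idn_right[OF c'(1)] c'(2,3)
      by (auto intro!: triple_eqI simp: El_simps(6,7))
  next
    fix c d e u v w z
    assume c: "c \<in> Hom (Hm (El K F) p q) u v" "d \<in> Hom (Hm (El K F) p q) v w"
      "e \<in> Hom (Hm (El K F) p q) w z"
    then show "Cmp (Hm (El K F) p q) e (Cmp (Hm (El K F) p q) d c) =
        Cmp (Hm (El K F) p q) (Cmp (Hm (El K F) p q) e d) c"
      using H.Cmp_assoc[of "comps c" "fst u" "fst v" "comps d" "fst w" "comps e" "fst z"]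
      by (simp add: El_simps(7) El_Hom)
  qed
next
  case (2 p)
  then show ?case
    using A.Id1_closed[of "snd p"] category.Idn_closed[OF F0_category]
    by (simp add: El_simps F1_Id1_fob)
next
  case (3 p q r u v)
  then show ?case by (rule El_Cm1_closed)
next
  case (4 p q r c u u' d v v')
  then have o: "snd p \<in> Ob K" "snd q \<in> Ob K" "snd r \<in> Ob K" "fst p \<in> Obj (F0 F (snd p))"
    by (simp_all add: El_simps)
  have uv: "u \<in> Obj (Hm (El K F) p q)" "u' \<in> Obj (Hm (El K F) p q)"
    "v \<in> Obj (Hm (El K F) q r)" "v' \<in> Obj (Hm (El K F) q r)"
    and cd: "fst c = u" "tgt c = u'" "fst d = v" "tgt d = v'"
    and c: "comps c \<in> Hom (Hm K (snd p) (snd q)) (fst u) (fst u')"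
    and d: "comps d \<in> Hom (Hm K (snd q) (snd r)) (fst v) (fst v')"
    and e: "Cmp (F0 F (snd q)) (snd u') (comps (F2 F (snd p) (snd q) (comps c)) (fst p)) = snd u"
      "Cmp (F0 F (snd r)) (snd v') (comps (F2 F (snd q) (snd r) (comps d)) (fst q)) = snd v"
    using 4(4,5) by (simp_all add: El_Hom)
  have u': "fst u' \<in> Obj (Hm K (snd p) (snd q))"
      "snd u' \<in> Hom (F0 F (snd q)) (fob (F1 F (snd p) (snd q) (fst u')) (fst p)) (fst q)"
    and v': "fst v' \<in> Obj (Hm K (snd q) (snd r))" "fst v \<in> Obj (Hm K (snd q) (snd r))"
      "snd v' \<in> Hom (F0 F (snd r)) (fob (F1 F (snd q) (snd r) (fst v')) (fst q)) (fst r)"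
    and u: "fst u \<in> Obj (Hm K (snd p) (snd q))"
    using uv by (simp_all add: El_simps)
  interpret R: category "F0 F (snd r)" using F0_category[OF o(3)] .
  interpret Fv: cat_functor "F0 F (snd q)" "F0 F (snd r)" "F1 F (snd q) (snd r) (fst v)"
    using F1_functor[OF o(2,3) v'(2)] .
  note c1 = F2_comps[OF o(1,2) c o(4)]
  note Fc = Fv.far_closed[OF c1]
  note dc = F2_comps[OF o(2,3) d F1_fob[OF o(1,2) u'(1) o(4)]]
    and dq = F2_comps[OF o(2,3) d Fv.C.Hom_Obj(2)[OF u'(2)]]
  note Fu' = F1_far[OF o(2,3) v'(1) u'(2)]
  let ?R = "Cmp (F0 F (snd r))" and ?Fv = "far (F1 F (snd q) (snd r) (fst v))"
    and ?Fv' = "far (F1 F (snd q) (snd r) (fst v'))"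
    and ?c = "comps (F2 F (snd p) (snd q) (comps c)) (fst p)"
    and ?d = "comps (F2 F (snd q) (snd r) (comps d))"
    and ?y = "fob (F1 F (snd p) (snd q) (fst u')) (fst p)"
  \<comment> \<open>The condition for the horizontal composite. Naturality of the image of d at the
    arrow \<open>snd u'\<close> separates the factors, after which the conditions for d and for c
    apply one at a time.\<close>
  have "?R (?R (snd v') (?Fv' (snd u'))) (?R (?d ?y) (?Fv ?c)) =
      ?R (snd v') (?R (?R (?Fv' (snd u')) (?d ?y)) (?Fv ?c))"
    using R.Cmp_assoc[OF R.Cmp_closed[OF Fc dc] Fu' v'(3)] R.Cmp_assoc[OF Fc dc Fu'] by simp
  also have "\<dots> = ?R (?R (snd v') (?d (fst q))) (?R (?Fv (snd u')) (?Fv ?c))"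
    using F2_natural[OF o(2,3) d u'(2)] R.Cmp_assoc[OF Fc Fv.far_closed[OF u'(2)] dq]
      R.Cmp_assoc[OF R.Cmp_closed[OF Fc Fv.far_closed[OF u'(2)]] dq v'(3)] by simp
  also have "\<dots> = ?R (snd v) (?Fv (snd u))"
    using e Fv.far_Cmp[OF c1 u'(2)] by simp
  finally have E: "?R (?R (snd v') (?Fv' (snd u'))) (?R (?d ?y) (?Fv ?c)) = ?R (snd v) (?Fv (snd u))" .
  show ?case
    using El_Cm1_closed[OF 4(1-3) uv(1,3)] El_Cm1_closed[OF 4(1-3) uv(2,4)]
      A.Cm2_closed[OF o(1-3) c d] E F2_Cm2_comps[OF o(1-3) c d o(4)]
    by (simp add: El_Hom El_simps(9,10) cd)
next
  case (5 p q r u v)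
  then have o: "snd p \<in> Ob K" "snd q \<in> Ob K" "snd r \<in> Ob K" by (simp_all add: El_simps)
  show ?case
    using A.Cm2_Id2[OF o El_ObjD(1)[OF 5(4)] El_ObjD(1)[OF 5(5)]] by (simp add: El_simps(6,9,10))
next
  case (6 p q r c u u' c' u'' d v v' d' v'')
  then have o: "snd p \<in> Ob K" "snd q \<in> Ob K" "snd r \<in> Ob K" by (simp_all add: El_simps)
  show ?case
    using A.interchange[OF o El_cellD(5)[OF 6(4)] El_cellD(5)[OF 6(5)] El_cellD(5)[OF 6(6)]
        El_cellD(5)[OF 6(7)]]
    by (simp add: El_simps(7,9,10))
next
  case (7 p q u)
  then show ?case by (rule El_Cm1_Id1_right)
next
  case (8 p q u)
  then show ?case by (rule El_Cm1_Id1_left)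
next
  case (9 p q c)
  then have o: "snd p \<in> Ob K" "snd q \<in> Ob K" by (simp_all add: El_simps)
  note c = El_cellD[OF Arr_Hom[OF 9(3)], unfolded El_simps(4,5)]
  show ?case
    using El_Cm1_Id1_right[OF 9(1,2) c(1)] El_Cm1_Id1_right[OF 9(1,2) c(2)]
      A.Cm2_Id1_right[OF o HomD(1)[OF c(5)]]
    by (auto intro!: triple_eqI simp: El_simps(6,8,10))
next
  case (10 p q c)
  then have o: "snd p \<in> Ob K" "snd q \<in> Ob K" by (simp_all add: El_simps)
  note c = El_cellD[OF Arr_Hom[OF 10(3)], unfolded El_simps(4,5)]
  show ?case
    using El_Cm1_Id1_left[OF 10(1,2) c(1)] El_Cm1_Id1_left[OF 10(1,2) c(2)]
      A.Cm2_Id1_left[OF o HomD(1)[OF c(5)]]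
    by (auto intro!: triple_eqI simp: El_simps(6,8,10))
next
  case (11 p q r s u v w)
  then show ?case by (rule El_Cm1_assoc)
next
  case (12 p q r s c d e)
  then have o: "snd p \<in> Ob K" "snd q \<in> Ob K" "snd r \<in> Ob K" "snd s \<in> Ob K"
    by (simp_all add: El_simps)
  note c = El_cellD[OF Arr_Hom[OF 12(5)], unfolded El_simps(4,5)]
    and d = El_cellD[OF Arr_Hom[OF 12(6)], unfolded El_simps(4,5)]
    and e = El_cellD[OF Arr_Hom[OF 12(7)], unfolded El_simps(4,5)]
  show ?case
    using El_Cm1_assoc[OF 12(1-4) c(1) d(1) e(1)] El_Cm1_assoc[OF 12(1-4) c(2) d(2) e(2)]
      A.Cm2_assoc[OF o HomD(1)[OF c(5)] HomD(1)[OF d(5)] HomD(1)[OF e(5)]]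
    by (simp add: El_simps(10))
qed

section \<open>The projection to the base\<close>

lemma El_proj_simps:
  "F0 (El_proj K F) = snd"
  "u \<in> Obj (Hm (El K F) p q) \<Longrightarrow> F1 (El_proj K F) p q u = fst u"
  "c \<in> Arr (Hm (El K F) p q) \<Longrightarrow> F2 (El_proj K F) p q c = comps c"
  by (simp_all add: El_proj_def)

lemma two_functor_El_proj: "two_functor (El K F) K (El_proj K F)"
proof -
  interpret E: two_category "El K F" by (rule two_category_El)
  show ?thesis
  proof (intro two_functor.intro two_functor_axioms.intro two_category_El A.two_category_axioms,
      goal_cases)
    case (1 p) then show ?case by (simp add: El_simps El_proj_simps)
  next
    case (2 p q)
    then have pq: "snd p \<in> Ob K" "snd q \<in> Ob K" by (simp_all add: El_simps)
    have "cat_functor (Hm (El K F) p q) (Hm K (snd p) (snd q)) (Fh (El_proj K F) p q)"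
    proof (intro cat_functor.intro cat_functor_axioms.intro E.Hm_category[OF 2]
        A.Hm_category[OF pq], goal_cases)
      case (3 u) then show ?case by (simp add: El_proj_simps El_simps(2))
    next
      case (4 c u v)
      then show ?case using HomD(1)[OF 4] El_cellD[OF 4] by (simp add: El_proj_simps)
    next
      case (5 u)
      then show ?case using E.Id2_Arr[OF 2 5] by (simp add: El_proj_simps El_simps(6))
    next
      case (6 c u v d w)
      then show ?case
        using HomD(1)[OF 6(1)] HomD(1)[OF 6(2)]
          HomD(1)[OF category.Cmp_closed[OF E.Hm_category[OF 2] 6]]
        by (simp add: El_proj_simps El_simps(7))
    qed (simp_all add: El_proj_def)
    then show ?case by (simp add: El_proj_simps)
  next
    case (3 p)
    then show ?case using E.Id1_closed[OF 3] by (simp add: El_proj_simps El_simps(8))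
  next
    case (4 p q r u v)
    then show ?case using E.Cm1_closed[OF 4] by (simp add: El_proj_simps El_simps(9))
  next
    case (5 p q r c d)
    then show ?case using HomD(1)[OF E.Cm2_closed[OF 5(1-3) Arr_Hom[OF 5(4)] Arr_Hom[OF 5(5)]]]
      by (simp add: El_proj_simps El_simps(10))
  qed
qed

end

section \<open>The 2-functors \<open>B(P-,E)\<close>\<close>

lemma precomp_simps [simp]:
  "k \<in> Obj (Hm B X E) \<Longrightarrow> fob (precomp B Y X E p) k = Cm1 B Y X E k p"
  "\<alpha> \<in> Arr (Hm B X E) \<Longrightarrow> far (precomp B Y X E p) \<alpha> = rwh B Y X E \<alpha> p"
  by (simp_all add: precomp_def)

lemma postcomp_simps [simp]:
  "k \<in> Obj (Hm B X E) \<Longrightarrow> fob (postcomp B X E E' h) k = Cm1 B X E E' h k"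
  "\<alpha> \<in> Arr (Hm B X E) \<Longrightarrow> far (postcomp B X E E' h) \<alpha> = lwh B X E E' h \<alpha>"
  by (simp_all add: postcomp_def)

context two_category
begin

lemma cat_functor_precomp:
  assumes o: "Y \<in> Ob A" "X \<in> Ob A" "E \<in> Ob A" and p: "p \<in> Obj (Hm A Y X)"
  shows "cat_functor (Hm A X E) (Hm A Y E) (precomp A Y X E p)"
proof (intro cat_functor.intro cat_functor_axioms.intro Hm_category o, goal_cases)
  case (4 \<alpha> f g)
  then show ?case
    using rwh_closed[OF o p 4] cell_Obj[OF o(2,3) 4] HomD(1)[OF 4] by simp
next
  case (6 \<alpha> f g \<beta> h)
  then show ?case
    using rwh_Cmp[OF o p 6] HomD(1)[OF 6(1)] HomD(1)[OF 6(2)]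
      HomD(1)[OF category.Cmp_closed[OF Hm_category[OF o(2,3)] 6]] by simp
qed (use o p in \<open>simp_all add: precomp_def Cm1_closed Id2_Arr rwh_Id2\<close>)

lemma cat_functor_postcomp:
  assumes o: "X \<in> Ob A" "E \<in> Ob A" "E' \<in> Ob A" and h: "h \<in> Obj (Hm A E E')"
  shows "cat_functor (Hm A X E) (Hm A X E') (postcomp A X E E' h)"
proof (intro cat_functor.intro cat_functor_axioms.intro Hm_category o, goal_cases)
  case (4 \<alpha> f g)
  then show ?case
    using lwh_closed[OF o h 4] cell_Obj[OF o(1,2) 4] HomD(1)[OF 4] by simp
next
  case (6 \<alpha> f g \<beta> k)
  then show ?case
    using lwh_Cmp[OF o h 6] HomD(1)[OF 6(1)] HomD(1)[OF 6(2)]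
      HomD(1)[OF category.Cmp_closed[OF Hm_category[OF o(1,2)] 6]] by simp
qed (use o h in \<open>simp_all add: postcomp_def Cm1_closed Id2_Arr lwh_Id2\<close>)

lemma precomp_Id1:
  assumes o: "X \<in> Ob A" "E \<in> Ob A"
  shows "precomp A X X E (Id1 A X) = id_fct (Hm A X E)"
  by (rule fct_eqI[where C = "Hm A X E"])
    (use o in \<open>simp_all add: precomp_def id_fct_def Cm1_Id1_right rwh_def Cm2_Id1_right\<close>)

lemma precomp_Cm1:
  assumes o: "X \<in> Ob A" "Y \<in> Ob A" "Z \<in> Ob A" "E \<in> Ob A"
    and f: "f \<in> Obj (Hm A X Y)" and g: "g \<in> Obj (Hm A Y Z)"
  shows "precomp A X Z E (Cm1 A X Y Z g f) =
    comp_fct (Hm A Z E) (precomp A X Y E f) (precomp A Y Z E g)"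
proof -
  have "rwh A Y Z E \<alpha> g \<in> Arr (Hm A Y E)" if "\<alpha> \<in> Arr (Hm A Z E)" for \<alpha>
    using HomD(1)[OF rwh_closed[OF o(2-4) g Arr_Hom[OF that]]] .
  then show ?thesis
    using o f g
    by (intro fct_eqI[where C = "Hm A Z E"])
      (simp_all add: precomp_def comp_fct_def Cm1_closed Cm1_assoc rwh_rwh)
qed

text \<open>Associativity of composition, on 1-cells and for whiskerings. This is why B(P-,h) is
  strictly natural.\<close>

lemma precomp_postcomp:
  assumes o: "Y \<in> Ob A" "X \<in> Ob A" "E \<in> Ob A" "E' \<in> Ob A"
    and p: "p \<in> Obj (Hm A Y X)" and h: "h \<in> Obj (Hm A E E')"
  shows "comp_fct (Hm A X E) (precomp A Y X E' p) (postcomp A X E E' h) =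
    comp_fct (Hm A X E) (postcomp A Y E E' h) (precomp A Y X E p)"
proof -
  have "rwh A Y X E \<alpha> p \<in> Arr (Hm A Y E)" "lwh A X E E' h \<alpha> \<in> Arr (Hm A X E')"
    if "\<alpha> \<in> Arr (Hm A X E)" for \<alpha>
    using HomD(1)[OF rwh_closed[OF o(1-3) p Arr_Hom[OF that]]]
      HomD(1)[OF lwh_closed[OF o(2-4) h Arr_Hom[OF that]]] by auto
  then show ?thesis
    using o p h
    by (intro fct_eqI[where C = "Hm A X E"])
      (simp_all add: precomp_def postcomp_def comp_fct_def Cm1_closed Cm1_assoc lwh_rwh)
qed

text \<open>Naturality in k is interchange: both ways around the square are the horizontal composite
  of \<alpha> and \<gamma>.\<close>

lemma nat_trans_lwh:
  assumes o: "Y \<in> Ob A" "X \<in> Ob A" "E \<in> Ob A" and \<gamma>: "\<gamma> \<in> Hom (Hm A Y X) f g"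
  shows "nat_trans (Hm A X E) (Hm A Y E) (precomp A Y X E f) (precomp A Y X E g)
    (\<lambda>k\<in>Obj (Hm A X E). lwh A Y X E k \<gamma>)"
proof (rule nat_transI)
  note fg = cell_Obj[OF o(1,2) \<gamma>]
  show "cat_functor (Hm A X E) (Hm A Y E) (precomp A Y X E f)"
    "cat_functor (Hm A X E) (Hm A Y E) (precomp A Y X E g)"
    using cat_functor_precomp[OF o] fg by auto
  show "(\<lambda>k\<in>Obj (Hm A X E). lwh A Y X E k \<gamma>) k \<in>
      Hom (Hm A Y E) (fob (precomp A Y X E f) k) (fob (precomp A Y X E g) k)"
    if "k \<in> Obj (Hm A X E)" for k
    using that lwh_closed[OF o that \<gamma>] by simp
  show "Cmp (Hm A Y E) (far (precomp A Y X E g) \<alpha>) ((\<lambda>k\<in>Obj (Hm A X E). lwh A Y X E k \<gamma>) k) =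
      Cmp (Hm A Y E) ((\<lambda>k\<in>Obj (Hm A X E). lwh A Y X E k \<gamma>) l) (far (precomp A Y X E f) \<alpha>)"
    if "\<alpha> \<in> Hom (Hm A X E) k l" for \<alpha> k l
    using HomD(1)[OF that] cell_Obj[OF o(2,3) that] Cmp_rwh_lwh[OF o \<gamma> that] Cmp_lwh_rwh[OF o \<gamma> that]
    by simp
qed simp

lemma nat_trans_rwh:
  assumes o: "X \<in> Ob A" "E \<in> Ob A" "E' \<in> Ob A" and \<tau>: "\<tau> \<in> Hom (Hm A E E') h h'"
  shows "nat_trans (Hm A X E) (Hm A X E') (postcomp A X E E' h) (postcomp A X E E' h')
    (\<lambda>k\<in>Obj (Hm A X E). rwh A X E E' \<tau> k)"
proof (rule nat_transI)
  note hh = cell_Obj[OF o(2,3) \<tau>]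
  show "cat_functor (Hm A X E) (Hm A X E') (postcomp A X E E' h)"
    "cat_functor (Hm A X E) (Hm A X E') (postcomp A X E E' h')"
    using cat_functor_postcomp[OF o] hh by auto
  show "(\<lambda>k\<in>Obj (Hm A X E). rwh A X E E' \<tau> k) k \<in>
      Hom (Hm A X E') (fob (postcomp A X E E' h) k) (fob (postcomp A X E E' h') k)"
    if "k \<in> Obj (Hm A X E)" for k
    using that rwh_closed[OF o that \<tau>] by simp
  show "Cmp (Hm A X E') (far (postcomp A X E E' h') \<alpha>) ((\<lambda>k\<in>Obj (Hm A X E). rwh A X E E' \<tau> k) k) =
      Cmp (Hm A X E') ((\<lambda>k\<in>Obj (Hm A X E). rwh A X E E' \<tau> k) l) (far (postcomp A X E E' h) \<alpha>)"
    if "\<alpha> \<in> Hom (Hm A X E) k l" for \<alpha> k l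
    using HomD(1)[OF that] cell_Obj[OF o(1,2) that] Cmp_rwh_lwh[OF o that \<tau>] Cmp_lwh_rwh[OF o that \<tau>]
    by simp
qed simp

end

lemma hom_into_simps [simp]:
  "F0 (hom_into A B P E) X = Hm B (F0 P X) E"
  "f \<in> Obj (Hm A Y X) \<Longrightarrow>
    F1 (hom_into A B P E) X Y f = precomp B (F0 P Y) (F0 P X) E (F1 P Y X f)"
  "\<gamma> \<in> Arr (Hm A Y X) \<Longrightarrow> F2 (hom_into A B P E) X Y \<gamma> =
    (precomp B (F0 P Y) (F0 P X) E (F1 P Y X (Dom (Hm A Y X) \<gamma>)),
     \<lambda>k\<in>Obj (Hm B (F0 P X) E). lwh B (F0 P Y) (F0 P X) E k (F2 P Y X \<gamma>),
     precomp B (F0 P Y) (F0 P X) E (F1 P Y X (Cod (Hm A Y X) \<gamma>)))"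
  by (simp_all add: hom_into_def)

locale diagram = P: two_functor A B P + Cat: two_category "Cat :: ('u, 'v) cat_2cat"
  for A :: "('a, 'f, 't) twocat" and B :: "('b, 'u, 'v) twocat"
    and P :: "('a, 'f, 't, 'b, 'u, 'v) twofct"
begin

lemma P1_closed:
  "\<lbrakk>X \<in> Ob A; Y \<in> Ob A; f \<in> Obj (Hm A X Y)\<rbrakk> \<Longrightarrow> F1 P X Y f \<in> Obj (Hm B (F0 P X) (F0 P Y))"
  using cat_functor.fob_closed[OF P.Fh_functor] .

lemma P2_closed:
  "\<lbrakk>X \<in> Ob A; Y \<in> Ob A; \<gamma> \<in> Hom (Hm A X Y) f g\<rbrakk> \<Longrightarrow>
      F2 P X Y \<gamma> \<in> Hom (Hm B (F0 P X) (F0 P Y)) (F1 P X Y f) (F1 P X Y g)"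
  using cat_functor.far_closed[OF P.Fh_functor] .

lemma two_functor_hom_into:
  assumes E: "E \<in> Ob B"
  shows "two_functor (op2 A) Cat (hom_into A B P E)"
proof (intro two_functor.intro two_functor_axioms.intro two_category_op2 P.A.two_category_axioms
    Cat.two_category_axioms, goal_cases)
  case (1 X) then show ?case using P.B.Hm_category[OF P.F0_closed E] by simp
next
  case (2 X Y)
  then have o: "Y \<in> Ob A" "X \<in> Ob A" by simp_all
  note Po = P.F0_closed[OF o(1)] P.F0_closed[OF o(2)] E
  interpret H: category "Hm A Y X" using P.A.Hm_category[OF o] .
  have Q: "category (fun_cat (Hm B (F0 P X) E) (Hm B (F0 P Y) E))"
    using Cat.Hm_category P.B.Hm_category[OF Po(1,3)] P.B.Hm_category[OF Po(2,3)] by simp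
  have "cat_functor (Hm A Y X) (fun_cat (Hm B (F0 P X) E) (Hm B (F0 P Y) E))
      (Fh (hom_into A B P E) X Y)"
  proof (intro cat_functor.intro cat_functor_axioms.intro H.category_axioms Q, goal_cases)
    case (3 f)
    then show ?case using P.B.cat_functor_precomp[OF Po P1_closed[OF o 3]] by simp
  next
    case (4 \<gamma> f g)
    then show ?case
      using P.B.nat_trans_lwh[OF Po P2_closed[OF o 4]] HomD[OF 4] H.Hom_Obj[OF 4]
      by (simp add: Hom_fun_cat)
  next
    case (5 f)
    then show ?case
      using H.Idn_Arr[OF 5] HomD[OF H.Idn_closed[OF 5]] P1_closed[OF o 5] Po
        cat_functor.far_Idn[OF P.Fh_functor[OF o] 5]
      by (simp add: P.B.lwh_Id2 cong: restrict_cong)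
  next
    case (6 \<gamma> f g \<delta> h)
    then show ?case
      using HomD[OF 6(1)] HomD[OF 6(2)] HomD[OF H.Cmp_closed[OF 6]]
        cat_functor.far_Cmp[OF P.Fh_functor[OF o] 6]
        P.B.lwh_Cmp[OF Po _ P2_closed[OF o 6(1)] P2_closed[OF o 6(2)]]
      by (simp cong: restrict_cong)
  qed (simp_all add: hom_into_def)
  then show ?case by simp
next
  case (3 X)
  then show ?case
    using P.B.precomp_Id1[OF P.F0_closed E] P.A.Id1_closed P.F1_Id1 by simp
next
  case (4 X Y Z f g)
  then show ?case
    using P.A.Cm1_closed[of Z Y X g f] P.F1_Cm1[of Z Y X g f]
      P.B.precomp_Cm1[OF _ _ _ E P1_closed[of Z Y g] P1_closed[of Y X f]]
    by (simp add: P.F0_closed)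
next
  case (5 X Y Z \<alpha> \<beta>)
  then have o: "X \<in> Ob A" "Y \<in> Ob A" "Z \<in> Ob A" and \<alpha>: "\<alpha> \<in> Arr (Hm A Y X)"
    and \<beta>: "\<beta> \<in> Arr (Hm A Z Y)" by simp_all
  note \<alpha>h = Arr_Hom[OF \<alpha>] and \<beta>h = Arr_Hom[OF \<beta>]
  note Po = P.F0_closed[OF o(1)] P.F0_closed[OF o(2)] P.F0_closed[OF o(3)]
  note P\<alpha> = P2_closed[OF o(2,1) \<alpha>h] and P\<beta> = P2_closed[OF o(3,2) \<beta>h]
  note f = P.A.cell_Obj[OF o(2,1) \<alpha>h] and g = P.A.cell_Obj[OF o(3,2) \<beta>h]
  note ab = P.A.Cm2_closed[OF o(3,2,1) \<beta>h \<alpha>h]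
  \<comment> \<open>The right-hand side is the component at k of the horizontal composite in
    \<open>Cat\<close>. By interchange it is the horizontal composite of k P\<alpha> with P\<beta>,
    and associativity moves k outside.\<close>
  have "lwh B (F0 P Z) (F0 P X) E k (Cm2 B (F0 P Z) (F0 P Y) (F0 P X) (F2 P Y X \<alpha>) (F2 P Z Y \<beta>)) =
      Cmp (Hm B (F0 P Z) E)
        (lwh B (F0 P Z) (F0 P Y) E (Cm1 B (F0 P Y) (F0 P X) E k (F1 P Y X (Cod (Hm A Y X) \<alpha>)))
          (F2 P Z Y \<beta>))
        (rwh B (F0 P Z) (F0 P Y) E (lwh B (F0 P Y) (F0 P X) E k (F2 P Y X \<alpha>))
          (F1 P Z Y (Dom (Hm A Z Y) \<beta>)))"
    if k: "k \<in> Obj (Hm B (F0 P X) E)" for k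
    using P.B.Cmp_lwh_rwh[OF Po(3,2) E P\<beta> P.B.lwh_closed[OF Po(2,1) E k P\<alpha>]]
      P.B.Cm2_assoc[OF Po(3,2,1) E HomD(1)[OF P\<beta>] HomD(1)[OF P\<alpha>] P.B.Id2_Arr[OF Po(1) E k]]
    by (simp add: lwh_def)
  moreover have "lwh B (F0 P Y) (F0 P X) E k (F2 P Y X \<alpha>) \<in> Arr (Hm B (F0 P Y) E)"
    "Cm1 B (F0 P Y) (F0 P X) E k (F1 P Y X (Cod (Hm A Y X) \<alpha>)) \<in> Obj (Hm B (F0 P Y) E)"
    if k: "k \<in> Obj (Hm B (F0 P X) E)" for k
    using HomD(1)[OF P.B.lwh_closed[OF Po(2,1) E k P\<alpha>]]
      P.B.Cm1_closed[OF Po(2,1) E P1_closed[OF o(2,1) f(2)] k] by auto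
  ultimately show ?case
    using P.F2_Cm2[OF o(3,2,1) \<beta> \<alpha>] HomD[OF ab] \<alpha> \<beta> P.F1_Cm1[OF o(3,2,1) g(1) f(1)]
      P.F1_Cm1[OF o(3,2,1) g(2) f(2)]
      P.B.precomp_Cm1[OF Po(3,2,1) E P1_closed[OF o(3,2) g(1)] P1_closed[OF o(2,1) f(1)]]
      P.B.precomp_Cm1[OF Po(3,2,1) E P1_closed[OF o(3,2) g(2)] P1_closed[OF o(2,1) f(2)]]
    by (simp cong: restrict_cong)
qed

lemma cat_valued_hom_into: "E \<in> Ob B \<Longrightarrow> cat_valued (op2 A) (hom_into A B P E)"
  by (intro cat_valued.intro two_functor_hom_into)

section \<open>Transformations and modifications induced by cells of B\<close>

lemma hom_into_trans_simps:
  "X \<in> Ob A \<Longrightarrow> T0 (hom_into_trans A B P E E' h) X = postcomp B (F0 P X) E E' h"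
  "\<lbrakk>X \<in> Ob A; Y \<in> Ob A; f \<in> Obj (Hm A Y X)\<rbrakk> \<Longrightarrow> T1 (hom_into_trans A B P E E' h) X Y f =
    Id2 Cat (Hm B (F0 P X) E) (Hm B (F0 P Y) E')
      (comp_fct (Hm B (F0 P X) E) (F1 (hom_into A B P E') X Y f) (postcomp B (F0 P X) E E' h))"
  by (simp_all add: hom_into_trans_def restrict1_def)

text \<open>Precomposition and postcomposition commute strictly, so the structure 2-cells can be
  identities, and every law reduces to unit laws and strict commutation.\<close>

lemma lax_trans_hom_into_trans:
  assumes E: "E \<in> Ob B" "E' \<in> Ob B" and h: "h \<in> Obj (Hm B E E')"
  shows "lax_trans (op2 A) Cat (hom_into A B P E) (hom_into A B P E') (hom_into_trans A B P E E' h)"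
    (is "lax_trans _ _ ?F ?G ?h")
proof -
  interpret F: cat_valued "op2 A" ?F using cat_valued_hom_into[OF E(1)] .
  interpret G: cat_valued "op2 A" ?G using cat_valued_hom_into[OF E(2)] .
  interpret FG: cat_valued_pair "op2 A" ?F ?G ..
  have sq: "comp_fct (Hm B (F0 P X) E) (F1 ?G X Y f) (postcomp B (F0 P X) E E' h) =
      comp_fct (Hm B (F0 P X) E) (postcomp B (F0 P Y) E E' h) (F1 ?F X Y f)"
    if "X \<in> Ob A" "Y \<in> Ob A" "f \<in> Obj (Hm A Y X)" for X Y f
    using that P.B.precomp_postcomp[OF P.F0_closed P.F0_closed E P1_closed h, of Y X f] by simp
  \<comment> \<open>The identity in \<open>c\<close> is taken at the source of the structure 2-cell.
    The equation \<open>c'\<close> shows that this is also its target; both forms are needed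
    below.\<close>
  have c: "comps (T1 ?h X Y f) k = Idn (Hm B (F0 P Y) E')
      (fob (F1 ?G X Y f) (fob (T0 ?h X) k))"
    and c': "fob (F1 ?G X Y f) (fob (T0 ?h X) k) = fob (T0 ?h Y) (fob (F1 ?F X Y f) k)"
    and o: "fob (T0 ?h Y) (fob (F1 ?F X Y f) k) \<in> Obj (Hm B (F0 P Y) E')"
    if a: "X \<in> Ob A" "Y \<in> Ob A" "f \<in> Obj (Hm A Y X)" and k: "k \<in> Obj (Hm B (F0 P X) E)" for X Y f k
  proof -
    show "comps (T1 ?h X Y f) k = Idn (Hm B (F0 P Y) E') (fob (F1 ?G X Y f) (fob (T0 ?h X) k))"
      using a k by (simp add: hom_into_trans_simps)
    show e: "fob (F1 ?G X Y f) (fob (T0 ?h X) k) = fob (T0 ?h Y) (fob (F1 ?F X Y f) k)"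
      using arg_cong[OF sq[OF a], of "\<lambda>F. fob F k"] a k by (simp add: hom_into_trans_simps del: hom_into_simps(2))
    show "fob (T0 ?h Y) (fob (F1 ?F X Y f) k) \<in> Obj (Hm B (F0 P Y) E')"
      using cat_functor.fob_closed[OF P.B.cat_functor_postcomp[OF P.F0_closed E h]] F.F1_fob a k
      by (simp add: hom_into_trans_simps del: hom_into_simps(2))
  qed
  show ?thesis
  proof (rule FG.lax_transI, goal_cases)
    case 1 show ?case by (simp add: hom_into_trans_def)
  next
    case 2 show ?case by (auto simp: hom_into_trans_def restrict1_def fun_eq_iff)
  next
    case (3 X)
    then show ?case using P.B.cat_functor_postcomp[OF P.F0_closed E h]
      by (simp add: hom_into_trans_simps)
  next
    case (4 X Y f)
    then show ?case using sq[of X Y f] by (simp add: hom_into_trans_simps del: hom_into_simps(2))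
  next
    case (5 X Y f k)
    then have a: "X \<in> Ob A" "Y \<in> Ob A" "f \<in> Obj (Hm A Y X)" "k \<in> Obj (Hm B (F0 P X) E)" by simp_all
    show ?case
      using category.Idn_closed[OF P.B.Hm_category[OF P.F0_closed[OF a(2)] E(2)] o[OF a]]
      by (simp only: c[OF a] c'[OF a] hom_into_simps(1))
  next
    case (6 X Y f \<alpha> k l)
    then have a: "X \<in> Ob A" "Y \<in> Ob A" "f \<in> Obj (Hm A Y X)" and \<alpha>: "\<alpha> \<in> Hom (Hm B (F0 P X) E) k l"
      by simp_all
    note Po = P.F0_closed[OF a(1)] P.F0_closed[OF a(2)]
    have kl: "k \<in> Obj (Hm B (F0 P X) E)" "l \<in> Obj (Hm B (F0 P X) E)"
      using P.B.cell_Obj[OF Po(1) E(1) \<alpha>] .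
    have e: "far (F1 ?G X Y f) (far (T0 ?h X) \<alpha>) = far (T0 ?h Y) (far (F1 ?F X Y f) \<alpha>)"
      using arg_cong[OF sq[OF a], of "\<lambda>F. far F \<alpha>"] a HomD(1)[OF \<alpha>]
      by (simp add: hom_into_trans_simps del: hom_into_simps(2))
    have "far (T0 ?h Y) (far (F1 ?F X Y f) \<alpha>) \<in> Hom (Hm B (F0 P Y) E')
        (fob (T0 ?h Y) (fob (F1 ?F X Y f) k)) (fob (T0 ?h Y) (fob (F1 ?F X Y f) l))"
      using cat_functor.far_closed[OF P.B.cat_functor_postcomp[OF Po(2) E h]] F.F1_far 6
      by (simp add: hom_into_trans_simps del: hom_into_simps(2))
    then show ?case
      using category.Cmp_Idn_left[OF P.B.Hm_category[OF Po(2) E(2)]]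
        category.Cmp_Idn_right[OF P.B.Hm_category[OF Po(2) E(2)]]
      by (simp only: c[OF a kl(1)] c[OF a kl(2)] c'[OF a kl(1)] c'[OF a kl(2)] e hom_into_simps(1))
  next
    case (7 X k)
    then show ?case
      using c[of X X "Id1 A X" k] P.A.Id1_closed G.F1_Id1_fob[of X "fob (T0 ?h X) k"]
        cat_functor.fob_closed[OF P.B.cat_functor_postcomp[OF P.F0_closed E h], of X k]
      by (simp add: hom_into_trans_simps del: hom_into_simps(2))
  next
    case (8 X Y Z f g k)
    then have a: "X \<in> Ob A" "Y \<in> Ob A" "Z \<in> Ob A" "f \<in> Obj (Hm A Y X)" "g \<in> Obj (Hm A Z Y)"
      "k \<in> Obj (Hm B (F0 P X) E)" by simp_all
    have Fk: "fob (F1 ?F X Y f) k \<in> Obj (Hm B (F0 P Y) E)" using F.F1_fob[of X Y f k] a by simp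
    have gf: "Cm1 A Z Y X f g \<in> Obj (Hm A Z X)" using P.A.Cm1_closed a by blast
    interpret Gg: cat_functor "Hm B (F0 P Y) E'" "Hm B (F0 P Z) E'" "F1 ?G Y Z g"
      using G.F1_functor[of Y Z g] a by simp
    note oF = Gg.fob_closed[OF o[OF a(1,2,4,6)]]
    have Gc: "fob (F1 ?G X Z (Cm1 A Z Y X f g)) (fob (T0 ?h X) k) =
        fob (F1 ?G Y Z g) (fob (F1 ?G X Y f) (fob (T0 ?h X) k))"
      using G.F1_Cm1_fob[of X Y Z f g "fob (T0 ?h X) k"] a
        cat_functor.fob_closed[OF P.B.cat_functor_postcomp[OF P.F0_closed E h], of X k]
      by (simp add: hom_into_trans_simps del: hom_into_simps(2))
    show ?case
      unfolding op2_simps hom_into_simps(1)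
      using Gg.D.Cmp_Idn_left[OF Gg.D.Idn_closed[OF oF]] Gg.far_Idn[OF o[OF a(1,2,4,6)]]
      by (simp only: c[OF a(1,3) gf a(6)] c[OF a(1,2,4,6)] c[OF a(2,3,5) Fk] Gc c'[OF a(1,2,4,6)])
  next
    case (9 X Y \<gamma> f g k)
    then have a: "X \<in> Ob A" "Y \<in> Ob A" "\<gamma> \<in> Hom (Hm A Y X) f g" and k: "k \<in> Obj (Hm B (F0 P X) E)"
      by simp_all
    note Po = P.F0_closed[OF a(1)] P.F0_closed[OF a(2)]
    note fg = P.A.cell_Obj[OF a(2,1,3)] and P\<gamma> = P2_closed[OF a(2,1,3)]
    note kc = P.B.lwh_closed[OF Po(2,1) E(1) k P\<gamma>]
    have hk: "Cm1 B (F0 P X) E E' h k \<in> Obj (Hm B (F0 P X) E')"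
      using P.B.Cm1_closed[OF Po(1) E k h] .
    have H: "lwh B (F0 P Y) E E' h (lwh B (F0 P Y) (F0 P X) E k (F2 P Y X \<gamma>)) \<in> Hom (Hm B (F0 P Y) E')
       (fob (T0 ?h Y) (fob (F1 ?F X Y f) k)) (fob (T0 ?h Y) (fob (F1 ?F X Y g) k))"
      using P.B.lwh_closed[OF Po(2) E h kc] a fg k
        P.B.cell_Obj[OF Po(2) E(1) kc] by (simp add: hom_into_trans_simps)
    have l: "far (T0 ?h Y) (comps (F2 ?F X Y \<gamma>) k) =
        lwh B (F0 P Y) E E' h (lwh B (F0 P Y) (F0 P X) E k (F2 P Y X \<gamma>))"
      using a k HomD[OF a(3)] HomD(1)[OF kc] by (simp add: hom_into_trans_simps)
    \<comment> \<open>Whiskering P\<gamma> with hk is whiskering with k and then with h, so both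
      sides of the 2-cell law reduce to the same arrow.\<close>
    have r: "comps (F2 ?G X Y \<gamma>) (fob (T0 ?h X) k) =
        lwh B (F0 P Y) E E' h (lwh B (F0 P Y) (F0 P X) E k (F2 P Y X \<gamma>))"
      using a k HomD[OF a(3)] hk P.B.lwh_lwh[OF Po(2,1) E HomD(1)[OF P\<gamma>] k h]
      by (simp add: hom_into_trans_simps)
    show ?case
      unfolding hom_into_simps(1) l r
      using category.Cmp_Idn_left[OF P.B.Hm_category[OF Po(2) E(2)] H]
        category.Cmp_Idn_right[OF P.B.Hm_category[OF Po(2) E(2)] H]
      by (simp only: c[OF a(1,2) fg(1) k] c[OF a(1,2) fg(2) k] c'[OF a(1,2) fg(1) k] c'[OF a(1,2) fg(2) k])
  qed
qed

text \<open>The structure 2-cells are identities of functors, hence invertible for whichever class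
  of 1-cells is chosen.\<close>

lemma sigma_natural_hom_into_trans:
  assumes E: "E \<in> Ob B" "E' \<in> Ob B" and h: "h \<in> Obj (Hm B E E')"
    and S: "\<And>X Y. X \<in> Ob A \<Longrightarrow> Y \<in> Ob A \<Longrightarrow> S X Y \<subseteq> Obj (Hm A Y X)"
  shows "sigma_natural (op2 A) S Cat (hom_into A B P E) (hom_into A B P E')
    (hom_into_trans A B P E E' h)"
proof -
  interpret G: cat_valued "op2 A" "hom_into A B P E'" using cat_valued_hom_into[OF E(2)] .
  have "invertible (fun_cat (Hm B (F0 P X) E) (Hm B (F0 P Y) E'))
      (T1 (hom_into_trans A B P E E' h) X Y f)"
    if a: "X \<in> Ob A" "Y \<in> Ob A" and f: "f \<in> S X Y" for X Y f
  proof -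
    have f: "f \<in> Obj (Hm A Y X)" using S[OF a] f by blast
    have "category (fun_cat (Hm B (F0 P X) E) (Hm B (F0 P Y) E'))"
      using Cat.Hm_category[of "Hm B (F0 P X) E" "Hm B (F0 P Y) E'"]
        P.B.Hm_category[OF P.F0_closed[OF a(1)] E(1)] P.B.Hm_category[OF P.F0_closed[OF a(2)] E(2)]
      by simp
    moreover have "comp_fct (Hm B (F0 P X) E) (F1 (hom_into A B P E') X Y f)
        (postcomp B (F0 P X) E E' h) \<in> Obj (fun_cat (Hm B (F0 P X) E) (Hm B (F0 P Y) E'))"
      using cat_functor_comp_fct[OF P.B.cat_functor_postcomp[OF P.F0_closed[OF a(1)] E h]
          G.F1_functor[of X Y f, unfolded hom_into_simps(1)]] a f by simp
    ultimately show ?thesis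
      using category.invertible_Idn a f by (simp add: hom_into_trans_simps del: fun_cat_simps)
  qed
  then show ?thesis
    using lax_trans_hom_into_trans[OF E h] by (simp add: sigma_natural_def)
qed

text \<open>With identities as structure 2-cells, the modification equation becomes (\<tau> k) Pf =
  \<tau> (k Pf), which is \<open>rwh_rwh\<close>.\<close>

lemma modification_hom_into_modif:
  assumes E: "E \<in> Ob B" "E' \<in> Ob B" and \<tau>: "\<tau> \<in> Hom (Hm B E E') h h'"
  shows "modification (op2 A) Cat (hom_into A B P E) (hom_into A B P E')
    (hom_into_trans A B P E E' h) (hom_into_trans A B P E E' h')
    (comps (hom_into_modif A B P E E' \<tau>))"
    (is "modification _ _ ?F ?G ?h ?h' ?r")
proof -
  interpret F: cat_valued "op2 A" ?F using cat_valued_hom_into[OF E(1)] .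
  interpret G: cat_valued "op2 A" ?G using cat_valued_hom_into[OF E(2)] .
  interpret FG: cat_valued_pair "op2 A" ?F ?G ..
  note hh = P.B.cell_Obj[OF E \<tau>]
  note l = lax_trans_hom_into_trans[OF E hh(1)] lax_trans_hom_into_trans[OF E hh(2)]
  show ?thesis
  proof (subst FG.modification_iff[OF l], intro conjI ballI)
    show "?r \<in> extensional (Ob (op2 A))" by (simp add: hom_into_modif_def)
  next
    fix X assume "X \<in> Ob (op2 A)"
    then show "?r X \<in> Hom (fun_cat (F0 ?F X) (F0 ?G X)) (T0 ?h X) (T0 ?h' X)"
      using P.B.nat_trans_rwh[OF P.F0_closed E \<tau>, of X] HomD[OF \<tau>]
      by (simp add: hom_into_modif_def hom_into_trans_simps Hom_fun_cat)
  next
    fix X Y f k assume "X \<in> Ob (op2 A)" "Y \<in> Ob (op2 A)" "f \<in> Obj (Hm (op2 A) X Y)"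
      "k \<in> Obj (F0 ?F X)"
    then have a: "X \<in> Ob A" "Y \<in> Ob A" "f \<in> Obj (Hm A Y X)" and k: "k \<in> Obj (Hm B (F0 P X) E)"
      by simp_all
    note Po = P.F0_closed[OF a(1)] P.F0_closed[OF a(2)]
    note Pf = P1_closed[OF a(2,1,3)]
    note rk = P.B.rwh_closed[OF Po(1) E k \<tau>]
    note rr = P.B.rwh_closed[OF Po(2,1) E(2) Pf rk]
    have c: "Cm1 B (F0 P X) E E' h k \<in> Obj (Hm B (F0 P X) E')"
      "Cm1 B (F0 P X) E E' h' k \<in> Obj (Hm B (F0 P X) E')"
      "Cm1 B (F0 P Y) (F0 P X) E k (F1 P Y X f) \<in> Obj (Hm B (F0 P Y) E)"
      using P.B.Cm1_closed[OF Po(1) E k] P.B.Cm1_closed[OF Po(2,1) E(1) Pf k] hh by auto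
    show "Cmp (F0 ?G Y) (comps (T1 ?h' X Y f) k) (far (F1 ?G X Y f) (comps (?r X) k)) =
      Cmp (F0 ?G Y) (comps (?r Y) (fob (F1 ?F X Y f) k)) (comps (T1 ?h X Y f) k)"
      using a k c HomD[OF \<tau>] HomD(1)[OF rk]
        P.B.rwh_rwh[OF Po(2,1) E Pf k HomD(1)[OF \<tau>]]
        category.Cmp_Idn_left[OF P.B.Hm_category[OF Po(2) E(2)] rr]
        category.Cmp_Idn_right[OF P.B.Hm_category[OF Po(2) E(2)] rr]
      by (simp add: hom_into_modif_def hom_into_trans_simps)
  qed
qed

end

section \<open>Cones and elements\<close>

definition point :: "('u, 'v) cat \<Rightarrow> 'u \<Rightarrow> ('u, 'v, 'u, 'v) fct" where
  "point D d = \<lparr>fob = (\<lambda>z\<in>{undefined}. d), far = (\<lambda>z\<in>{undefined}. Idn D d)\<rparr>"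

lemma point_simps [simp]: "fob (point D d) undefined = d" "far (point D d) undefined = Idn D d"
  by (simp_all add: point_def)

lemma cat_functor_point:
  assumes "category D" "d \<in> Obj D"
  shows "cat_functor terminal_cat D (point D d)"
proof (intro cat_functor.intro cat_functor_axioms.intro category_terminal_cat assms(1), goal_cases)
  case (4 f x y)
  then show ?case
    using category.Idn_closed[OF assms] by (simp split: if_splits)
next
  case (6 f x y g z)
  then show ?case
    using category.Cmp_Idn_left[OF assms(1) category.Idn_closed[OF assms]] by (simp split: if_splits)
qed (use assms(2) in \<open>simp_all add: point_def\<close>)

text \<open>The single arrow of the terminal category is an identity, so its image is forced by the
  image of the object.\<close>

lemma functor_terminal_eq_point:
  assumes "cat_functor terminal_cat D H"
  shows "H = point D (fob H undefined)"
proof -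
  interpret cat_functor terminal_cat D H by fact
  show ?thesis
    using far_Idn[of undefined]
    by (intro fct_eqI[where C = terminal_cat]) (use fob_ext far_ext in \<open>simp_all add: point_def\<close>)
qed

lemma comp_fct_point:
  assumes "cat_functor D E H" "d \<in> Obj D"
  shows "comp_fct terminal_cat H (point D d) = point E (fob H d)"
  using cat_functor.far_Idn[OF assms] by (simp add: comp_fct_def point_def cong: restrict_cong)

section \<open>Cones as lax transformations out of the constant 2-functor\<close>

locale cone_weight = H: cat_valued L H
  for L :: "('k, 'f, 't) twocat" and H :: "('k, 'f, 't, 'u, 'v) weight"
begin

sublocale cat_valued_pair L "const1 L" H
  by (intro cat_valued_pair.intro cat_valued.intro two_functor_const1 H.A.two_category_axioms
      H.B.two_category_axioms H.two_functor_axioms)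

text \<open>The ends of the structure 2-cells are given as points, the normal form of the composites
  of functors which a lax transformation has there.\<close>

definition cone :: "('k \<Rightarrow> 'u) \<Rightarrow> ('k \<Rightarrow> 'k \<Rightarrow> 'f \<Rightarrow> 'v) \<Rightarrow> ('k, 'f, 'u, 'v) cocone" where
  "cone m0 m1 = \<lparr>T0 = (\<lambda>p\<in>Ob L. point (F0 H p) (m0 p)),
     T1 = restrict1 L (\<lambda>p q u. (point (F0 H q) (fob (F1 H p q u) (m0 p)),
       \<lambda>z\<in>{undefined}. m1 p q u, point (F0 H q) (m0 q)))\<rparr>"

lemma T0_cone: "p \<in> Ob L \<Longrightarrow> T0 (cone m0 m1) p = point (F0 H p) (m0 p)"
  and T1_cone: "\<lbrakk>p \<in> Ob L; q \<in> Ob L; u \<in> Obj (Hm L p q)\<rbrakk> \<Longrightarrow>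
      comps (T1 (cone m0 m1) p q u) undefined = m1 p q u"
  by (simp_all add: cone_def restrict1_def)

text \<open>\<open>const1\<close> sends all cells to identities, so the factors coming from the
  domain disappear from the laws. Naturality of the structure 2-cells holds because both functors
  involved are points.\<close>

lemma lax_trans_cone:
  assumes m0: "\<And>p. p \<in> Ob L \<Longrightarrow> m0 p \<in> Obj (F0 H p)"
    and m1: "\<And>p q u. \<lbrakk>p \<in> Ob L; q \<in> Ob L; u \<in> Obj (Hm L p q)\<rbrakk> \<Longrightarrow>
      m1 p q u \<in> Hom (F0 H q) (fob (F1 H p q u) (m0 p)) (m0 q)"
    and Id1: "\<And>p. p \<in> Ob L \<Longrightarrow> m1 p p (Id1 L p) = Idn (F0 H p) (m0 p)"
    and Cm1: "\<And>p q r u v. \<lbrakk>p \<in> Ob L; q \<in> Ob L; r \<in> Ob L; u \<in> Obj (Hm L p q); v \<in> Obj (Hm L q r)\<rbrakk> \<Longrightarrow>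
      m1 p r (Cm1 L p q r v u) = Cmp (F0 H r) (m1 q r v) (far (F1 H q r v) (m1 p q u))"
    and cell: "\<And>p q c u v. \<lbrakk>p \<in> Ob L; q \<in> Ob L; c \<in> Hom (Hm L p q) u v\<rbrakk> \<Longrightarrow>
      m1 p q u = Cmp (F0 H q) (m1 p q v) (comps (F2 H p q c) (m0 p))"
  shows "lax_trans L Cat (const1 L) H (cone m0 m1)"
proof (rule lax_transI, goal_cases)
  case 1 show ?case by (simp add: cone_def)
next
  case 2 show ?case by (auto simp: cone_def restrict1_def fun_eq_iff)
next
  case (3 p)
  then show ?case using cat_functor_point[OF H.F0_category m0] by (simp add: T0_cone)
next
  case (4 p q u)
  then show ?case
    using comp_fct_point[OF H.F1_functor[OF 4] m0[OF 4(1)]]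
      comp_fct_id_right[OF cat_functor_point[OF H.F0_category m0], OF 4(2) 4(2)]
    by (simp add: cone_def restrict1_def)
next
  case (5 p q u x)
  then show ?case using m1[OF 5(1-3)] by (simp add: T0_cone T1_cone)
next
  case (6 p q u \<phi> x y)
  then have e: "\<phi> = undefined" "x = undefined" "y = undefined" by (simp_all split: if_splits)
  show ?case
    using 6 e m1[OF 6(1-3)] cat_functor.far_Idn[OF H.F1_functor[OF 6(1-3)] m0[OF 6(1)]]
      category.Cmp_Idn_left[OF H.F0_category[OF 6(2)] m1[OF 6(1-3)]]
      category.Cmp_Idn_right[OF H.F0_category[OF 6(2)] m1[OF 6(1-3)]]
    by (simp add: T0_cone T1_cone)
next
  case (7 p x)
  then show ?case using Id1[OF 7(1)] H.A.Id1_closed[OF 7(1)] by (simp add: T0_cone T1_cone)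
next
  case (8 p q r u v x)
  then show ?case using Cm1[OF 8(1-5)] H.A.Cm1_closed[OF 8(1-5)] by (simp add: T1_cone)
next
  case (9 p q c u v x)
  note uv = H.A.cell_Obj[OF 9(1-3)]
  show ?case
    using 9 uv cell[OF 9(1-3)] HomD(1)[OF 9(3)]
      category.Cmp_Idn_left[OF H.F0_category[OF 9(2)] m1[OF 9(1,2) uv(1)]]
    by (simp add: T0_cone T1_cone)
qed

lemma cone_eqI:
  assumes l: "lax_trans L Cat (const1 L) H \<mu>" "lax_trans L Cat (const1 L) H \<mu>'"
    and "\<And>p. p \<in> Ob L \<Longrightarrow> fob (T0 \<mu> p) undefined = fob (T0 \<mu>' p) undefined"
    and "\<And>p q u. \<lbrakk>p \<in> Ob L; q \<in> Ob L; u \<in> Obj (Hm L p q)\<rbrakk> \<Longrightarrow>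
      comps (T1 \<mu> p q u) undefined = comps (T1 \<mu>' p q u) undefined"
  shows "\<mu> = \<mu>'"
proof (rule lax_trans_eqI[OF l])
  fix p assume p: "p \<in> Ob L"
  show "T0 \<mu> p = T0 \<mu>' p"
    using functor_terminal_eq_point[OF lax_functor[OF l(1) p, simplified]]
      functor_terminal_eq_point[OF lax_functor[OF l(2) p, simplified]] assms(3)[OF p] by simp
qed (use assms(4) in simp)

context
  fixes \<mu>
  assumes l: "lax_trans L Cat (const1 L) H \<mu>"
begin

lemma cone_0: "p \<in> Ob L \<Longrightarrow> fob (T0 \<mu> p) undefined \<in> Obj (F0 H p)"
  using cat_functor.fob_closed[OF lax_functor[OF l]] by simp

lemma cone_1: "\<lbrakk>p \<in> Ob L; q \<in> Ob L; u \<in> Obj (Hm L p q)\<rbrakk> \<Longrightarrow> comps (T1 \<mu> p q u) undefined \<in>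
    Hom (F0 H q) (fob (F1 H p q u) (fob (T0 \<mu> p) undefined)) (fob (T0 \<mu> q) undefined)"
  using lax_comps[OF l, of p q u undefined] by simp

lemma cone_Id1:
  "p \<in> Ob L \<Longrightarrow> comps (T1 \<mu> p p (Id1 L p)) undefined = Idn (F0 H p) (fob (T0 \<mu> p) undefined)"
  using lax_Id1[OF l, of p undefined] by simp

lemma cone_Cm1: "\<lbrakk>p \<in> Ob L; q \<in> Ob L; r \<in> Ob L; u \<in> Obj (Hm L p q); v \<in> Obj (Hm L q r)\<rbrakk> \<Longrightarrow>
      comps (T1 \<mu> p r (Cm1 L p q r v u)) undefined =
      Cmp (F0 H r) (comps (T1 \<mu> q r v) undefined) (far (F1 H q r v) (comps (T1 \<mu> p q u) undefined))"
  using lax_Cm1[OF l, of p q r u v undefined] by simp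

lemma cone_2cell:
  assumes a: "p \<in> Ob L" "q \<in> Ob L" "c \<in> Hom (Hm L p q) u v"
  shows "comps (T1 \<mu> p q u) undefined =
    Cmp (F0 H q) (comps (T1 \<mu> p q v) undefined) (comps (F2 H p q c) (fob (T0 \<mu> p) undefined))"
  using lax_2cell[OF l a, of undefined] HomD(1)[OF a(3)]
    cat_functor.far_Idn[OF lax_functor[OF l a(2)], of undefined]
    category.Cmp_Idn_left[OF H.F0_category[OF a(2)] cone_1[OF a(1,2) H.A.cell_Obj(1)[OF a]]] by simp

end

lemma sigma_natural_cone_iff:
  assumes S: "\<And>p q. p \<in> Ob L \<Longrightarrow> q \<in> Ob L \<Longrightarrow> S p q \<subseteq> Obj (Hm L p q)"
  shows "sigma_natural L S Cat (const1 L) H \<mu> \<longleftrightarrow> lax_trans L Cat (const1 L) H \<mu> \<and>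
    (\<forall>p\<in>Ob L. \<forall>q\<in>Ob L. \<forall>u\<in>S p q. invertible (F0 H q) (comps (T1 \<mu> p q u) undefined))"
  unfolding sigma_natural_def
proof (intro conj_cong refl ball_cong)
  fix p q u
  assume l: "lax_trans L Cat (const1 L) H \<mu>" and pq: "p \<in> Ob L" "q \<in> Ob L" and u: "u \<in> S p q"
  then have "u \<in> Obj (Hm L p q)" using S by blast
  from invertible_fun_cat_iff[OF lax_Hom[OF l pq this]]
  show "invertible (Hm Cat (F0 (const1 L) p) (F0 H q)) (T1 \<mu> p q u) \<longleftrightarrow>
      invertible (F0 H q) (comps (T1 \<mu> p q u) undefined)" by simp
qed

end

section \<open>From transformations into G to cones on the restriction of G to elements\<close>

locale elements = cat_valued_pair K F G
  for K :: "('k, 'f, 't) twocat" and F G :: "('k, 'f, 't, 'u, 'v) weight"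
begin

abbreviation "L \<equiv> El K F"
abbreviation "GE \<equiv> comp_twofct L G (El_proj K F)"

sublocale cone: cone_weight L GE
  by (intro cone_weight.intro cat_valued.intro two_functor_comp[OF F.two_functor_El_proj]
      G.two_functor_axioms)

lemma GE_simps:
  shows   "F0 GE p = F0 G (snd p)"
  "u \<in> Obj (Hm L p q) \<Longrightarrow> F1 GE p q u = F1 G (snd p) (snd q) (fst u)"
  "c \<in> Arr (Hm L p q) \<Longrightarrow> F2 GE p q c = F2 G (snd p) (snd q) (comps c)"
  and "F0 (El_proj K F) p = snd p"
  and "u \<in> Obj (Hm L p q) \<Longrightarrow> F1 (El_proj K F) p q u = fst u"
  and "c \<in> Arr (Hm L p q) \<Longrightarrow> F2 (El_proj K F) p q c = comps c"
  by (simp_all add: F.El_proj_simps)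

lemma El_ObD:
  assumes "p \<in> Ob L"
  shows "snd p \<in> Ob K" "fst p \<in> Obj (F0 F (snd p))"
  using assms by (simp_all add: El_simps)

definition to_cone :: "('k, 'f, 'u, 'v) cocone \<Rightarrow> ('u \<times> 'k, 'f \<times> 'v, 'u, 'v) cocone" where
  "to_cone \<nu> = cone.cone (\<lambda>p. fob (T0 \<nu> (snd p)) (fst p))
    (\<lambda>p q u. Cmp (F0 G (snd q)) (far (T0 \<nu> (snd q)) (snd u))
      (comps (T1 \<nu> (snd p) (snd q) (fst u)) (fst p)))"

lemma to_cone_0: "p \<in> Ob L \<Longrightarrow> fob (T0 (to_cone \<nu>) p) undefined = fob (T0 \<nu> (snd p)) (fst p)"
  by (simp add: to_cone_def cone.T0_cone)

lemma to_cone_1: "\<lbrakk>p \<in> Ob L; q \<in> Ob L; u \<in> Obj (Hm L p q)\<rbrakk> \<Longrightarrow>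
      comps (T1 (to_cone \<nu>) p q u) undefined = Cmp (F0 G (snd q)) (far (T0 \<nu> (snd q)) (snd u))
      (comps (T1 \<nu> (snd p) (snd q) (fst u)) (fst p))"
  by (simp add: to_cone_def cone.T1_cone)

lemma to_cone_1_closed:
  assumes l: "lax_trans K Cat F G \<nu>" and p: "p \<in> Ob L" and q: "q \<in> Ob L"
    and u: "u \<in> Obj (Hm L p q)"
  shows "comps (T1 \<nu> (snd p) (snd q) (fst u)) (fst p) \<in> Hom (F0 G (snd q))
      (fob (F1 G (snd p) (snd q) (fst u)) (fob (T0 \<nu> (snd p)) (fst p)))
      (fob (T0 \<nu> (snd q)) (fob (F1 F (snd p) (snd q) (fst u)) (fst p)))"
    "far (T0 \<nu> (snd q)) (snd u) \<in> Hom (F0 G (snd q))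
      (fob (T0 \<nu> (snd q)) (fob (F1 F (snd p) (snd q) (fst u)) (fst p)))
      (fob (T0 \<nu> (snd q)) (fst q))"
  using lax_comps[OF l El_ObD(1)[OF p] El_ObD(1)[OF q] F.El_ObjD(1)[OF u] El_ObD(2)[OF p]]
    cat_functor.far_closed[OF lax_functor[OF l El_ObD(1)[OF q]] F.El_ObjD(2)[OF u]] by auto

text \<open>The composition law of the cone needs the law of \<nu> for composites and naturality of
  its structure 2-cells; the 2-cell law combines that of \<nu> with the condition defining 2-cells
  of elements.\<close>

lemma lax_trans_to_cone:
  assumes l: "lax_trans K Cat F G \<nu>"
  shows "lax_trans L Cat (const1 L) GE (to_cone \<nu>)"
  unfolding to_cone_def
proof (rule cone.lax_trans_cone, goal_cases)
  case (1 p)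
  then show ?case using cat_functor.fob_closed[OF lax_functor[OF l]] El_ObD[OF 1] by (simp add: GE_simps)
next
  case (2 p q u)
  then show ?case
    using category.Cmp_closed[OF G.F0_category[OF El_ObD(1)[OF 2(2)]] to_cone_1_closed[OF l 2]]
    by (simp add: GE_simps)
next
  case (3 p)
  note p = El_ObD[OF 3]
  interpret N: cat_functor "F0 F (snd p)" "F0 G (snd p)" "T0 \<nu> (snd p)" using lax_functor[OF l p(1)] .
  show ?case
    using lax_Id1[OF l p] N.far_Idn[OF p(2)]
      N.D.Cmp_Idn_left[OF N.D.Idn_closed[OF N.fob_closed[OF p(2)]]]
    by (simp add: GE_simps El_simps(8))
next
  case (4 p q r u v)
  note p = El_ObD[OF 4(1)] and q = El_ObD[OF 4(2)] and r = El_ObD[OF 4(3)]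
  note u = F.El_ObjD[OF 4(4)] and v = F.El_ObjD[OF 4(5)]
  interpret N: cat_functor "F0 F (snd r)" "F0 G (snd r)" "T0 \<nu> (snd r)" using lax_functor[OF l r(1)] .
  interpret Gv: cat_functor "F0 G (snd q)" "F0 G (snd r)" "F1 G (snd q) (snd r) (fst v)"
    using G.F1_functor[OF q(1) r(1) v(1)] .
  let ?c = "Cmp (F0 G (snd r))" and ?N = "far (T0 \<nu> (snd r))"
    and ?Fv = "far (F1 F (snd q) (snd r) (fst v))" and ?Gv = "far (F1 G (snd q) (snd r) (fst v))"
    and ?x = "fob (F1 F (snd p) (snd q) (fst u)) (fst p)"
    and ?u = "comps (T1 \<nu> (snd p) (snd q) (fst u)) (fst p)"
    and ?v = "comps (T1 \<nu> (snd q) (snd r) (fst v))"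
  note Fvu = F.F1_far[OF q(1) r(1) v(1) u(2)]
  note cu = to_cone_1_closed[OF l 4(1,2,4)] and cv = to_cone_1_closed[OF l 4(2,3,5)]
  note x = F.F1_fob[OF p(1) q(1) u(1) p(2)]
  note vx = lax_comps[OF l q(1) r(1) v(1) x]
  note NF = N.far_closed[OF Fvu] and Gu = Gv.far_closed[OF cu(1)] and GN = Gv.far_closed[OF cu(2)]
  have "?c (?N (Cmp (F0 F (snd r)) (snd v) (?Fv (snd u)))) (?c (?v ?x) (?Gv ?u)) =
      ?c (?N (snd v)) (?c (?c (?N (?Fv (snd u))) (?v ?x)) (?Gv ?u))"
    using N.far_Cmp[OF Fvu v(2)] N.D.Cmp_assoc[OF Gu vx NF]
      N.D.Cmp_assoc[OF N.D.Cmp_closed[OF Gu vx] NF cv(2)] by simp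
  \<comment> \<open>Naturality of the 2-cell of \<nu> at \<open>fst v\<close>, applied to the arrow
    \<open>snd u\<close>, brings together the factors belonging to v and those belonging to
    u.\<close>
  also have "\<dots> = ?c (?N (snd v)) (?c (?c (?v (fst q)) (?Gv (far (T0 \<nu> (snd q)) (snd u)))) (?Gv ?u))"
    using lax_natural[OF l q(1) r(1) v(1) u(2)] by simp
  also have "\<dots> = ?c (?c (?N (snd v)) (?v (fst q)))
      (?Gv (Cmp (F0 G (snd q)) (far (T0 \<nu> (snd q)) (snd u)) ?u))"
    using N.D.Cmp_assoc[OF Gu GN cv(1)] Gv.far_Cmp[OF cu]
      N.D.Cmp_assoc[OF N.D.Cmp_closed[OF Gu GN] cv] by simp
  finally show ?case
    using 4 lax_Cm1[OF l p(1) q(1) r(1) u(1) v(1) p(2)] by (simp add: GE_simps El_simps(9))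
next
  case (5 p q c u v)
  note p = El_ObD[OF 5(1)] and q = El_ObD[OF 5(2)] and c = F.El_cellD[OF 5(3)]
  note v = F.El_ObjD[OF c(2)]
  interpret N: cat_functor "F0 F (snd q)" "F0 G (snd q)" "T0 \<nu> (snd q)" using lax_functor[OF l q(1)] .
  interpret M: cat_functor "F0 F (snd p)" "F0 G (snd p)" "T0 \<nu> (snd p)" using lax_functor[OF l p(1)] .
  let ?c = "Cmp (F0 G (snd q))" and ?N = "far (T0 \<nu> (snd q))"
    and ?u = "comps (T1 \<nu> (snd p) (snd q) (fst u)) (fst p)"
    and ?v = "comps (T1 \<nu> (snd p) (snd q) (fst v)) (fst p)"
    and ?Fc = "comps (F2 F (snd p) (snd q) (comps c)) (fst p)"
  note cu = to_cone_1_closed[OF l 5(1,2) c(1)] and cv = to_cone_1_closed[OF l 5(1,2) c(2)]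
  note Fc = F.F2_comps[OF p(1) q(1) c(5) p(2)]
  note Gc = G.F2_comps[OF p(1) q(1) c(5) M.fob_closed[OF p(2)]]
  \<comment> \<open>\<open>snd u\<close> is \<open>snd v\<close> after the component of c: this is
    the condition which makes c a 2-cell of elements.\<close>
  have "?c (?N (snd u)) ?u = ?c (?N (snd v)) (?c (?N ?Fc) ?u)"
    using c(6) N.far_Cmp[OF Fc v(2)] N.D.Cmp_assoc[OF cu(1) N.far_closed[OF Fc] cv(2)] by simp
  also have "\<dots> = ?c (?c (?N (snd v)) ?v)
      (comps (F2 G (snd p) (snd q) (comps c)) (fob (T0 \<nu> (snd p)) (fst p)))"
    using lax_2cell[OF l p(1) q(1) c(5) p(2)] N.D.Cmp_assoc[OF Gc cv] by simp
  finally show ?case using HomD(1)[OF 5(3)] by (simp add: GE_simps)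
qed

section \<open>From cones back to transformations\<close>

definition of_cone :: "('u \<times> 'k, 'f \<times> 'v, 'u, 'v) cocone \<Rightarrow> ('k, 'f, 'u, 'v) cocone" where
  "of_cone \<mu> =
    (let t0 = (\<lambda>X\<in>Ob K. \<lparr>
        fob = (\<lambda>x\<in>Obj (F0 F X). fob (T0 \<mu> (x, X)) undefined),
        far = (\<lambda>\<phi>\<in>Arr (F0 F X). comps
          (T1 \<mu> (Dom (F0 F X) \<phi>, X) (Cod (F0 F X) \<phi>, X) (Id1 K X, \<phi>)) undefined)\<rparr>)
     in \<lparr>T0 = t0,
       T1 = restrict1 K (\<lambda>X Y f.
         (comp_fct (F0 F X) (F1 G X Y f) (t0 X),
          \<lambda>x\<in>Obj (F0 F X). comps (T1 \<mu> (x, X) (fob (F1 F X Y f) x, Y)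
            (f, Idn (F0 F Y) (fob (F1 F X Y f) x))) undefined,
          comp_fct (F0 F X) (t0 Y) (F1 F X Y f)))\<rparr>)"

lemma of_cone_fob: "X \<in> Ob K \<Longrightarrow> x \<in> Obj (F0 F X) \<Longrightarrow>
    fob (T0 (of_cone \<mu>) X) x = fob (T0 \<mu> (x, X)) undefined"
  by (simp add: of_cone_def Let_def)

lemma of_cone_far: "X \<in> Ob K \<Longrightarrow> \<phi> \<in> Hom (F0 F X) x y \<Longrightarrow>
    far (T0 (of_cone \<mu>) X) \<phi> = comps (T1 \<mu> (x, X) (y, X) (Id1 K X, \<phi>)) undefined"
  by (simp add: of_cone_def Let_def Hom_def)

lemma of_cone_T1: "\<lbrakk>X \<in> Ob K; Y \<in> Ob K; f \<in> Obj (Hm K X Y); x \<in> Obj (F0 F X)\<rbrakk> \<Longrightarrow>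
      comps (T1 (of_cone \<mu>) X Y f) x = comps (T1 \<mu> (x, X) (fob (F1 F X Y f) x, Y)
      (f, Idn (F0 F Y) (fob (F1 F X Y f) x))) undefined"
  by (simp add: of_cone_def Let_def restrict1_def)

text \<open>1-cells of elements lying over an identity of the base.\<close>

lemma vertical_El:
  assumes "X \<in> Ob K" "\<phi> \<in> Hom (F0 F X) x y"
  shows "(x, X) \<in> Ob L" "(y, X) \<in> Ob L" "(Id1 K X, \<phi>) \<in> Obj (Hm L (x, X) (y, X))"
  using assms category.Hom_Obj[OF F.F0_category[OF assms(1)] assms(2)] F.A.Id1_closed
  by (simp_all add: El_simps(1,2) F.F1_Id1_fob)

text \<open>The chosen lift of f at x, the one with an identity as second entry.\<close>

lemma cartesian_El:
  assumes "X \<in> Ob K" "Y \<in> Ob K" "f \<in> Obj (Hm K X Y)" "x \<in> Obj (F0 F X)"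
  shows "(x, X) \<in> Ob L" "(fob (F1 F X Y f) x, Y) \<in> Ob L"
    "(f, Idn (F0 F Y) (fob (F1 F X Y f) x)) \<in> Obj (Hm L (x, X) (fob (F1 F X Y f) x, Y))"
  using assms F.F1_fob[OF assms] category.Idn_closed[OF F.F0_category[OF assms(2)]]
  by (simp_all add: El_simps(1,2))

lemma El_factorization:
  assumes a: "X \<in> Ob K" "Y \<in> Ob K" "f \<in> Obj (Hm K X Y)" "x \<in> Obj (F0 F X)"
    and \<phi>: "\<phi> \<in> Hom (F0 F Y) (fob (F1 F X Y f) x) y"
  shows "Cm1 L (x, X) (fob (F1 F X Y f) x, Y) (y, Y) (Id1 K Y, \<phi>)
    (f, Idn (F0 F Y) (fob (F1 F X Y f) x)) = (f, \<phi>)"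
proof -
  interpret Y: category "F0 F Y" using F.F0_category[OF a(2)] .
  show ?thesis
    using F.F1_Id1_far[OF a(2) Y.Idn_Arr[OF F.F1_fob[OF a]]] Y.Cmp_Idn_right[OF \<phi>]
      F.A.Cm1_Id1_left[OF a(1-3)] by (simp add: El_simps(9))
qed

text \<open>The formula of \<open>to_cone\<close> for the recovered transformation, at an arbitrary
  1-cell of elements. It makes one round trip immediate, and it supplies one side of the naturality
  and 2-cell laws of the recovered transformation.\<close>

lemma of_cone_factorization:
  assumes l: "lax_trans L Cat (const1 L) GE \<mu>"
    and a: "X \<in> Ob K" "Y \<in> Ob K" "f \<in> Obj (Hm K X Y)" "x \<in> Obj (F0 F X)"
    and \<phi>: "\<phi> \<in> Hom (F0 F Y) (fob (F1 F X Y f) x) y"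
  shows "comps (T1 \<mu> (x, X) (y, Y) (f, \<phi>)) undefined =
    Cmp (F0 G Y) (far (T0 (of_cone \<mu>) Y) \<phi>) (comps (T1 (of_cone \<mu>) X Y f) x)"
proof -
  note v = vertical_El[OF a(2) \<phi>] and c = cartesian_El[OF a]
  have "comps (T1 \<mu> (x, X) (fob (F1 F X Y f) x, Y) (f, Idn (F0 F Y) (fob (F1 F X Y f) x))) undefined
      \<in> Arr (F0 G Y)"
    using HomD(1)[OF cone.cone_1[OF l c]] by (simp add: GE_simps)
  then show ?thesis
    using cone.cone_Cm1[OF l c(1,2) v(2) c(3) v(3)] v(3)
    by (simp add: El_factorization[OF a \<phi>] of_cone_far[OF a(2) \<phi>] of_cone_T1[OF a] GE_simps
        G.F1_Id1_far[OF a(2)])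
qed

lemma lax_trans_of_cone:
  assumes l: "lax_trans L Cat (const1 L) GE \<mu>"
  shows "lax_trans K Cat F G (of_cone \<mu>)"
proof -
  \<comment> \<open>G sends an identity 1-cell to an identity functor, so the component of \<mu> at
    a vertical 1-cell starts at the vertex of (x,X) itself.\<close>
  have vert: "far (T0 (of_cone \<mu>) X) \<phi> \<in> Hom (F0 G X) (fob (T0 \<mu> (x, X)) undefined)
      (fob (T0 \<mu> (y, X)) undefined)" if X: "X \<in> Ob K" and \<phi>: "\<phi> \<in> Hom (F0 F X) x y" for X \<phi> x y
    using cone.cone_1[OF l vertical_El[OF X \<phi>]] vertical_El(3)[OF X \<phi>]
      cone.cone_0[OF l vertical_El(1)[OF X \<phi>]]
    by (simp add: of_cone_far[OF X \<phi>] GE_simps G.F1_Id1_fob[OF X])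
  have fctr: "cat_functor (F0 F X) (F0 G X) (T0 (of_cone \<mu>) X)" if X: "X \<in> Ob K" for X
  proof (intro cat_functor.intro cat_functor_axioms.intro F.F0_category G.F0_category X, goal_cases)
    case (3 x)
    then show ?case
      using cone.cone_0[OF l, of "(x, X)"] X by (simp add: of_cone_fob El_simps(1) GE_simps)
  next
    case (4 \<phi> x y)
    then show ?case
      using vert[OF X 4] category.Hom_Obj[OF F.F0_category[OF X] 4] X by (simp add: of_cone_fob)
  next
    case (5 x)
    then show ?case
      using cone.cone_Id1[OF l, of "(x, X)"] X
        of_cone_far[OF X category.Idn_closed[OF F.F0_category[OF X] 5]]
      by (simp add: El_simps(1,8) of_cone_fob GE_simps)
  next
    case (6 \<phi> x y \<psi> z)
    note v1 = vertical_El[OF X 6(1)] and v2 = vertical_El[OF X 6(2)]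
    note c = category.Cmp_closed[OF F.F0_category[OF X] 6]
    have "Cm1 L (x, X) (y, X) (z, X) (Id1 K X, \<psi>) (Id1 K X, \<phi>) = (Id1 K X, Cmp (F0 F X) \<psi> \<phi>)"
      using F.F1_Id1_far[OF X HomD(1)[OF 6(1)]] F.A.Cm1_Id1_left[OF X X F.A.Id1_closed[OF X]]
      by (simp add: El_simps(9))
    then show ?case
      using cone.cone_Cm1[OF l v1(1,2) v2(2) v1(3) v2(3)] HomD(1)[OF vert[OF X 6(1)]] v2(3)
      by (simp add: of_cone_far[OF X 6(1)] of_cone_far[OF X 6(2)] of_cone_far[OF X c] GE_simps
          G.F1_Id1_far[OF X])
  qed (use X in \<open>simp_all add: of_cone_def Let_def\<close>)
  have hom: "comps (T1 (of_cone \<mu>) X Y f) x \<in> Hom (F0 G Y)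
      (fob (F1 G X Y f) (fob (T0 (of_cone \<mu>) X) x)) (fob (T0 (of_cone \<mu>) Y) (fob (F1 F X Y f) x))"
    if a: "X \<in> Ob K" "Y \<in> Ob K" "f \<in> Obj (Hm K X Y)" "x \<in> Obj (F0 F X)" for X Y f x
    using cone.cone_1[OF l cartesian_El[OF a]] cartesian_El(3)[OF a] a F.F1_fob[OF a]
    by (simp add: of_cone_T1 of_cone_fob GE_simps)
  show ?thesis
  proof (rule lax_transI, goal_cases)
    case 1 show ?case by (simp add: of_cone_def Let_def)
  next
    case 2 show ?case by (auto simp: of_cone_def Let_def restrict1_def fun_eq_iff)
  next
    case (3 X) then show ?case by (rule fctr)
  next
    case (4 X Y f)
    then show ?case by (simp add: of_cone_def Let_def restrict1_def)
  next
    case (5 X Y f x) then show ?case by (rule hom)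
  next
    case (6 X Y f \<phi> x y)
    note a = 6(1-3)
    interpret X: category "F0 F X" using F.F0_category[OF a(1)] .
    interpret Y: category "F0 F Y" using F.F0_category[OF a(2)] .
    have x: "x \<in> Obj (F0 F X)" and y: "y \<in> Obj (F0 F X)" using X.Hom_Obj[OF 6(4)] by auto
    note F\<phi> = F.F1_far[OF a 6(4)]
    note v = vertical_El[OF a(1) 6(4)] and c = cartesian_El[OF a y]
    \<comment> \<open>The factorization with the vertical 1-cell first; the other order is given by
      \<open>of_cone_factorization\<close>. Comparing the two is the naturality square.\<close>
    have "Cm1 L (x, X) (y, X) (fob (F1 F X Y f) y, Y) (f, Idn (F0 F Y) (fob (F1 F X Y f) y))
        (Id1 K X, \<phi>) = (f, far (F1 F X Y f) \<phi>)"
      using F.A.Cm1_Id1_right[OF a] Y.Cmp_Idn_left[OF F\<phi>] by (simp add: El_simps(9))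
    then show ?case
      using cone.cone_Cm1[OF l v(1,2) c(2) v(3) c(3)] of_cone_factorization[OF l a x F\<phi>] c(3)
      by (simp add: of_cone_T1[OF a y] of_cone_far[OF a(1) 6(4)] GE_simps)
  next
    case (7 X x)
    then show ?case
      using cone.cone_Id1[OF l, of "(x, X)"] F.F1_Id1_fob[OF 7] F.A.Id1_closed[OF 7(1)]
      by (simp add: El_simps(1,8) of_cone_fob of_cone_T1 GE_simps)
  next
    case (8 X Y Z f g x)
    note f = 8(1,2,4,6) and g = 8(2,3,5) and gf = F.A.Cm1_closed[OF 8(1-5)]
    note Fx = F.F1_fob[OF f]
    note c1 = cartesian_El[OF f] and c2 = cartesian_El[OF g Fx]
    interpret Z: category "F0 F Z" using F.F0_category[OF 8(3)] .
    \<comment> \<open>Chosen lifts compose to chosen lifts because F preserves composites strictly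
      and F g preserves identities.\<close>
    have "Cm1 L (x, X) (fob (F1 F X Y f) x, Y) (fob (F1 F Y Z g) (fob (F1 F X Y f) x), Z)
        (g, Idn (F0 F Z) (fob (F1 F Y Z g) (fob (F1 F X Y f) x)))
        (f, Idn (F0 F Y) (fob (F1 F X Y f) x)) =
      (Cm1 K X Y Z g f, Idn (F0 F Z) (fob (F1 F Y Z g) (fob (F1 F X Y f) x)))"
      using cat_functor.far_Idn[OF F.F1_functor[OF g] Fx]
        Z.Cmp_Idn_left[OF Z.Idn_closed[OF F.F1_fob[OF g Fx]]] by (simp add: El_simps(9))
    then show ?case
      using cone.cone_Cm1[OF l c1(1,2) c2(2) c1(3) c2(3)] c2(3)
      by (simp add: of_cone_T1[OF f] of_cone_T1[OF g Fx] of_cone_T1[OF 8(1,3) gf 8(6)] GE_simps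
          F.F1_Cm1_fob[OF 8])
  next
    case (9 X Y \<gamma> f g x)
    note fg = F.A.cell_Obj[OF 9(1-3)]
    note F\<gamma> = F.F2_comps[OF 9]
    interpret Y: category "F0 F Y" using F.F0_category[OF 9(2)] .
    note c = cartesian_El[OF 9(1,2) fg(2) 9(4)]
    \<comment> \<open>The second entry of the source is forced: with an identity at the target, the
      2-cell condition leaves only the component of F\<gamma> at x.\<close>
    let ?c = "((f, comps (F2 F X Y \<gamma>) x), \<gamma>, (g, Idn (F0 F Y) (fob (F1 F X Y g) x)))"
    have "?c \<in> Hom (Hm L (x, X) (fob (F1 F X Y g) x, Y)) (f, comps (F2 F X Y \<gamma>) x)
        (g, Idn (F0 F Y) (fob (F1 F X Y g) x))"
      using c(3) fg 9(3) F\<gamma> Y.Cmp_Idn_left[OF F\<gamma>] by (simp add: El_Hom El_simps(2))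
    then show ?case
      using cone.cone_2cell[OF l c(1,2)] of_cone_factorization[OF l 9(1,2) fg(1) 9(4) F\<gamma>]
      by (simp add: of_cone_T1[OF 9(1,2) fg(2) 9(4)] of_cone_fob[OF 9(1,4)] GE_simps HomD(1))
  qed
qed

lemma to_cone_of_cone:
  assumes l: "lax_trans L Cat (const1 L) GE \<mu>"
  shows "to_cone (of_cone \<mu>) = \<mu>"
proof (rule cone.cone_eqI[OF lax_trans_to_cone[OF lax_trans_of_cone[OF l]] l])
  fix p assume p: "p \<in> Ob L"
  show "fob (T0 (to_cone (of_cone \<mu>)) p) undefined = fob (T0 \<mu> p) undefined"
    using El_ObD[OF p] by (simp add: to_cone_0[OF p] of_cone_fob)
next
  fix p q u assume p: "p \<in> Ob L" "q \<in> Ob L" "u \<in> Obj (Hm L p q)"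
  show "comps (T1 (to_cone (of_cone \<mu>)) p q u) undefined = comps (T1 \<mu> p q u) undefined"
    using of_cone_factorization[OF l El_ObD(1)[OF p(1)] El_ObD(1)[OF p(2)] F.El_ObjD(1)[OF p(3)]
        El_ObD(2)[OF p(1)] F.El_ObjD(2)[OF p(3)]]
    by (simp add: to_cone_1[OF p])
qed

text \<open>The structure 2-cell of \<nu> at an identity is an identity, so the second factor drops
  out.\<close>

lemma to_cone_vertical:
  assumes l: "lax_trans K Cat F G \<nu>" and X: "X \<in> Ob K" and \<phi>: "\<phi> \<in> Hom (F0 F X) x y"
  shows "comps (T1 (to_cone \<nu>) (x, X) (y, X) (Id1 K X, \<phi>)) undefined = far (T0 \<nu> X) \<phi>"
proof -
  interpret N: cat_functor "F0 F X" "F0 G X" "T0 \<nu> X" using lax_functor[OF l X] .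
  show ?thesis
    using lax_Id1[OF l X N.C.Hom_Obj(1)[OF \<phi>]] N.D.Cmp_Idn_right[OF N.far_closed[OF \<phi>]]
    by (simp add: to_cone_1[OF vertical_El[OF X \<phi>]])
qed

text \<open>The functor \<open>T0 \<nu> Y\<close> preserves the identity in the second entry, so the
  first factor drops out.\<close>

lemma to_cone_cartesian:
  assumes l: "lax_trans K Cat F G \<nu>"
    and a: "X \<in> Ob K" "Y \<in> Ob K" "f \<in> Obj (Hm K X Y)" "x \<in> Obj (F0 F X)"
  shows "comps (T1 (to_cone \<nu>) (x, X) (fob (F1 F X Y f) x, Y)
      (f, Idn (F0 F Y) (fob (F1 F X Y f) x))) undefined = comps (T1 \<nu> X Y f) x"
proof -
  interpret N: cat_functor "F0 F Y" "F0 G Y" "T0 \<nu> Y" using lax_functor[OF l a(2)] .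
  show ?thesis
    using N.far_Idn[OF F.F1_fob[OF a]] N.D.Cmp_Idn_left[OF lax_comps[OF l a]]
    by (simp add: to_cone_1[OF cartesian_El[OF a]])
qed

lemma of_cone_to_cone:
  assumes l: "lax_trans K Cat F G \<nu>"
  shows "of_cone (to_cone \<nu>) = \<nu>"
proof (rule lax_trans_eqI[OF lax_trans_of_cone[OF lax_trans_to_cone[OF l]] l])
  fix X assume X: "X \<in> Ob K"
  show "T0 (of_cone (to_cone \<nu>)) X = T0 \<nu> X"
  proof (rule cat_functor_eqI[OF lax_functor[OF lax_trans_of_cone[OF lax_trans_to_cone[OF l]] X]
      lax_functor[OF l X]])
    show "fob (T0 (of_cone (to_cone \<nu>)) X) x = fob (T0 \<nu> X) x" if "x \<in> Obj (F0 F X)" for x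
      using X that to_cone_0[of "(x, X)"] by (simp add: of_cone_fob El_simps(1))
    show "far (T0 (of_cone (to_cone \<nu>)) X) \<phi> = far (T0 \<nu> X) \<phi>" if "\<phi> \<in> Arr (F0 F X)" for \<phi>
      using to_cone_vertical[OF l X Arr_Hom[OF that]] of_cone_far[OF X Arr_Hom[OF that]] by simp
  qed
next
  fix X Y f x assume "X \<in> Ob K" "Y \<in> Ob K" "f \<in> Obj (Hm K X Y)" "x \<in> Obj (F0 F X)"
  then show "comps (T1 (of_cone (to_cone \<nu>)) X Y f) x = comps (T1 \<nu> X Y f) x"
    using to_cone_cartesian[OF l] of_cone_T1 by simp
qed

end

section \<open>Sigma-naturality on both sides\<close>

lemma Hom_sigma_simps [simp]:
  "Obj (Hm (Hom_sigma A S B) F G) = {\<theta>. sigma_natural A S B F G \<theta>}"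
  "Arr (Hm (Hom_sigma A S B) F G) = {m. sigma_natural A S B F G (fst m) \<and>
    sigma_natural A S B F G (tgt m) \<and> modification A B F G (fst m) (tgt m) (comps m)}"
  "Dom (Hm (Hom_sigma A S B) F G) = fst"
  "Cod (Hm (Hom_sigma A S B) F G) = tgt"
  "Idn (Hm (Hom_sigma A S B) F G) \<theta> = (\<theta>, \<lambda>X\<in>Ob A. Id2 B (F0 F X) (F0 G X) (T0 \<theta> X), \<theta>)"
  "Cmp (Hm (Hom_sigma A S B) F G) n m =
    (fst m, \<lambda>X\<in>Ob A. Cmp (Hm B (F0 F X) (F0 G X)) (comps n X) (comps m X), tgt n)"
  "Cm1 (Hom_sigma A S B) = comp_trans A B"
  "Cm2 (Hom_sigma A S B) F G H n m =
    (comp_trans A B F G H (fst n) (fst m),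
     \<lambda>X\<in>Ob A. Cm2 B (F0 F X) (F0 G X) (F0 H X) (comps n X) (comps m X),
     comp_trans A B F G H (tgt n) (tgt m))"
  by (simp_all add: Hom_sigma_def trans_2cat_def)

lemma sigma_natural_lax: "sigma_natural A S B F G \<theta> \<Longrightarrow> lax_trans A B F G \<theta>"
  by (simp add: sigma_natural_def)

lemma (in cat_valued_pair) category_sigma: "category (Hm (Hom_sigma K S Cat) F G)"
  unfolding Hom_sigma_def by (rule category_trans) (rule sigma_natural_lax)

lemma (in cat_valued_pair) sigma_natural_iff:
  assumes S: "\<And>X Y. X \<in> Ob K \<Longrightarrow> Y \<in> Ob K \<Longrightarrow> S X Y \<subseteq> Obj (Hm K X Y)"
  shows "sigma_natural K S Cat F G \<theta> \<longleftrightarrow> lax_trans K Cat F G \<theta> \<and>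
    (\<forall>X\<in>Ob K. \<forall>Y\<in>Ob K. \<forall>f\<in>S X Y. \<forall>x\<in>Obj (F0 F X). invertible (F0 G Y) (comps (T1 \<theta> X Y f) x))"
  unfolding sigma_natural_def
proof (intro conj_cong refl ball_cong)
  fix X Y f
  assume l: "lax_trans K Cat F G \<theta>" and a: "X \<in> Ob K" "Y \<in> Ob K" and f: "f \<in> S X Y"
  then have "f \<in> Obj (Hm K X Y)" using S by blast
  from invertible_fun_cat_iff[OF lax_Hom[OF l a this]]
  show "invertible (Hm Cat (F0 F X) (F0 G Y)) (T1 \<theta> X Y f) \<longleftrightarrow>
      (\<forall>x\<in>Obj (F0 F X). invertible (F0 G Y) (comps (T1 \<theta> X Y f) x))" by simp
qed

context cone_weight
begin

text \<open>A natural transformation between functors out of the terminal category is a single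
  arrow: its naturality square has identities as horizontal sides.\<close>

lemma modification_cone_iff:
  assumes l: "lax_trans L Cat (const1 L) H \<mu>" "lax_trans L Cat (const1 L) H \<mu>'"
  shows "modification L Cat (const1 L) H \<mu> \<mu>' \<rho> \<longleftrightarrow> \<rho> \<in> extensional (Ob L) \<and>
    (\<forall>p\<in>Ob L. fst (\<rho> p) = T0 \<mu> p \<and> tgt (\<rho> p) = T0 \<mu>' p \<and> comps (\<rho> p) \<in> extensional {undefined} \<and>
      comps (\<rho> p) undefined \<in> Hom (F0 H p) (fob (T0 \<mu> p) undefined) (fob (T0 \<mu>' p) undefined)) \<and>
    (\<forall>p\<in>Ob L. \<forall>q\<in>Ob L. \<forall>u\<in>Obj (Hm L p q).
      Cmp (F0 H q) (comps (T1 \<mu>' p q u) undefined) (far (F1 H p q u) (comps (\<rho> p) undefined)) =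
      Cmp (F0 H q) (comps (\<rho> q) undefined) (comps (T1 \<mu> p q u) undefined))"
proof -
  have "\<rho> p \<in> Hom (fun_cat terminal_cat (F0 H p)) (T0 \<mu> p) (T0 \<mu>' p) \<longleftrightarrow>
      fst (\<rho> p) = T0 \<mu> p \<and> tgt (\<rho> p) = T0 \<mu>' p \<and> comps (\<rho> p) \<in> extensional {undefined} \<and>
      comps (\<rho> p) undefined \<in> Hom (F0 H p) (fob (T0 \<mu> p) undefined) (fob (T0 \<mu>' p) undefined)"
    if p: "p \<in> Ob L" for p
  proof -
    have f: "cat_functor terminal_cat (F0 H p) (T0 \<mu> p)" "cat_functor terminal_cat (F0 H p) (T0 \<mu>' p)"
      using lax_functor[OF l(1) p] lax_functor[OF l(2) p] by simp_all
    have i: "far (T0 \<mu> p) undefined = Idn (F0 H p) (fob (T0 \<mu> p) undefined)"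
      "far (T0 \<mu>' p) undefined = Idn (F0 H p) (fob (T0 \<mu>' p) undefined)"
      using cat_functor.far_Idn[OF f(1), of undefined] cat_functor.far_Idn[OF f(2), of undefined]
      by simp_all
    interpret C: category "F0 H p" using H.F0_category[OF p] .
    show ?thesis
      using f C.Cmp_Idn_left C.Cmp_Idn_right
      by (auto simp: Hom_fun_cat nat_trans_def i)
  qed
  then show ?thesis unfolding modification_iff[OF l] by simp
qed

end

context elements
begin

lemma C_class_iff:
  "u \<in> C_class K S F p q \<longleftrightarrow> u \<in> Obj (Hm L p q) \<and> invertible (F0 F (snd q)) (snd u) \<and>
    fst u \<in> S (snd p) (snd q)"
  by (simp add: C_class_def C_all_def)

text \<open>At (f,\<phi>) in the class both factors of the component are invertible: one is a
  component of \<open>\<nu>\<^sub>f\<close> with f in S, the other the image of the invertible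
  \<phi> under a functor.\<close>

lemma sigma_natural_to_cone:
  assumes S: "\<And>X Y. X \<in> Ob K \<Longrightarrow> Y \<in> Ob K \<Longrightarrow> S X Y \<subseteq> Obj (Hm K X Y)"
    and \<nu>: "sigma_natural K S Cat F G \<nu>"
  shows "sigma_natural L (C_class K S F) Cat (const1 L) GE (to_cone \<nu>)"
proof (subst cone.sigma_natural_cone_iff, goal_cases)
  case (1 p q) then show ?case by (auto simp: C_class_iff)
next
  case 2
  have l: "lax_trans K Cat F G \<nu>"
    and i: "\<And>X Y f x. \<lbrakk>X \<in> Ob K; Y \<in> Ob K; f \<in> S X Y; x \<in> Obj (F0 F X)\<rbrakk> \<Longrightarrow>
      invertible (F0 G Y) (comps (T1 \<nu> X Y f) x)"
    using \<nu> sigma_natural_iff[OF S] by auto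
  have "invertible (F0 GE q) (comps (T1 (to_cone \<nu>) p q u) undefined)"
    if p: "p \<in> Ob L" and q: "q \<in> Ob L" and u: "u \<in> C_class K S F p q" for p q u
  proof -
    have u': "u \<in> Obj (Hm L p q)" and v: "invertible (F0 F (snd q)) (snd u)"
      and s: "fst u \<in> S (snd p) (snd q)" using u by (auto simp: C_class_iff)
    note c = to_cone_1_closed[OF l p q u']
    interpret N: cat_functor "F0 F (snd q)" "F0 G (snd q)" "T0 \<nu> (snd q)"
      using lax_functor[OF l El_ObD(1)[OF q]] .
    show ?thesis
      using N.D.invertible_Cmp[OF c i[OF El_ObD(1)[OF p] El_ObD(1)[OF q] s El_ObD(2)[OF p]]
          N.invertible_far[OF v F.El_ObjD(2)[OF u']]]
      by (simp add: to_cone_1[OF p q u'] GE_simps)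
  qed
  then show ?case using lax_trans_to_cone[OF l] by blast
qed

text \<open>For f in S the chosen lift at x lies in \<open>C_class\<close>, since identities are
  invertible, and the component of \<mu> there is the component of the recovered 2-cell.\<close>

lemma sigma_natural_of_cone:
  assumes S: "\<And>X Y. X \<in> Ob K \<Longrightarrow> Y \<in> Ob K \<Longrightarrow> S X Y \<subseteq> Obj (Hm K X Y)"
    and \<mu>: "sigma_natural L (C_class K S F) Cat (const1 L) GE \<mu>"
  shows "sigma_natural K S Cat F G (of_cone \<mu>)"
proof (subst sigma_natural_iff[OF S], assumption, assumption, intro conjI ballI)
  note l = sigma_natural_lax[OF \<mu>]
  show "lax_trans K Cat F G (of_cone \<mu>)" using lax_trans_of_cone[OF l] .
  fix X Y f x assume X: "X \<in> Ob K" "Y \<in> Ob K" and f: "f \<in> S X Y" and x: "x \<in> Obj (F0 F X)"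
  have f': "f \<in> Obj (Hm K X Y)" using S[OF X] f by blast
  note c = cartesian_El[OF X f' x]
  have C: "C_class K S F p q \<subseteq> Obj (Hm L p q)" for p q by (auto simp: C_class_iff)
  have "(f, Idn (F0 F Y) (fob (F1 F X Y f) x)) \<in> C_class K S F (x, X) (fob (F1 F X Y f) x, Y)"
    using c(3) f category.invertible_Idn[OF F.F0_category[OF X(2)] F.F1_fob[OF X f' x]]
    by (simp add: C_class_iff)
  then have "invertible (F0 GE (fob (F1 F X Y f) x, Y)) (comps (T1 \<mu> (x, X) (fob (F1 F X Y f) x, Y)
      (f, Idn (F0 F Y) (fob (F1 F X Y f) x))) undefined)"
    using cone.sigma_natural_cone_iff[OF C] \<mu> c(1,2) by blast
  then show "invertible (F0 G Y) (comps (T1 (of_cone \<mu>) X Y f) x)"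
    by (simp add: of_cone_T1[OF X f' x] GE_simps)
qed

section \<open>The correspondence on modifications\<close>

definition to_cone_map :: "('k, 'f, 'u, 'v) cocone_map \<Rightarrow> ('u \<times> 'k, 'f \<times> 'v, 'u, 'v) cocone_map" where
  "to_cone_map r = (to_cone (fst r),
    \<lambda>p\<in>Ob L. (T0 (to_cone (fst r)) p, \<lambda>z\<in>{undefined}. comps (comps r (snd p)) (fst p),
      T0 (to_cone (tgt r)) p),
    to_cone (tgt r))"

lemma to_cone_map_simps [simp]:
  "fst (to_cone_map r) = to_cone (fst r)" "tgt (to_cone_map r) = to_cone (tgt r)"
  "p \<in> Ob L \<Longrightarrow> comps (comps (to_cone_map r) p) undefined = comps (comps r (snd p)) (fst p)"
  by (simp_all add: to_cone_map_def)

text \<open>The equation at (f,\<phi>) pastes the modification equation at f with naturality at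
  \<phi> of the natural transformation forming the component of r at the target.\<close>

lemma modification_to_cone_map:
  assumes l: "lax_trans K Cat F G (fst r)" "lax_trans K Cat F G (tgt r)"
    and m: "modification K Cat F G (fst r) (tgt r) (comps r)"
  shows "modification L Cat (const1 L) GE (to_cone (fst r)) (to_cone (tgt r)) (comps (to_cone_map r))"
proof (subst cone.modification_cone_iff[OF lax_trans_to_cone[OF l(1)] lax_trans_to_cone[OF l(2)]],
    intro conjI ballI)
  show "comps (to_cone_map r) \<in> extensional (Ob L)" by (simp add: to_cone_map_def)
next
  fix p assume p: "p \<in> Ob L"
  show "fst (comps (to_cone_map r) p) = T0 (to_cone (fst r)) p"
    "tgt (comps (to_cone_map r) p) = T0 (to_cone (tgt r)) p"
    "comps (comps (to_cone_map r) p) \<in> extensional {undefined}"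
    using p by (simp_all add: to_cone_map_def)
  show "comps (comps (to_cone_map r) p) undefined \<in> Hom (F0 GE p)
      (fob (T0 (to_cone (fst r)) p) undefined) (fob (T0 (to_cone (tgt r)) p) undefined)"
    using p mod_comps[OF m l El_ObD[OF p]] by (simp add: to_cone_0 GE_simps)
next
  fix p q u assume p: "p \<in> Ob L" and q: "q \<in> Ob L" and u: "u \<in> Obj (Hm L p q)"
  note u' = F.El_ObjD[OF u] and p' = El_ObD[OF p] and q' = El_ObD[OF q]
  interpret C: category "F0 G (snd q)" using G.F0_category[OF q'(1)] .
  note c = to_cone_1_closed[OF l(1) p q u] and d = to_cone_1_closed[OF l(2) p q u]
  note Gm = G.F1_far[OF p'(1) q'(1) u'(1) mod_comps[OF m l p']]
  note Fx = F.F1_fob[OF p'(1) q'(1) u'(1) p'(2)]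
  note mq = mod_comps[OF m l q'] and mx = mod_comps[OF m l q'(1) Fx]
  show "Cmp (F0 GE q) (comps (T1 (to_cone (tgt r)) p q u) undefined)
      (far (F1 GE p q u) (comps (comps (to_cone_map r) p) undefined)) =
    Cmp (F0 GE q) (comps (comps (to_cone_map r) q) undefined)
      (comps (T1 (to_cone (fst r)) p q u) undefined)"
    using p q u mod_1cell[OF m l p'(1) q'(1) u'(1) p'(2)] mod_natural[OF m l q'(1) u'(2)]
      C.Cmp_assoc[OF Gm d] C.Cmp_assoc[OF c(1) mx d(2)] C.Cmp_assoc[OF c mq]
    by (simp add: to_cone_1 GE_simps)
qed

definition of_cone_map :: "('u \<times> 'k, 'f \<times> 'v, 'u, 'v) cocone_map \<Rightarrow> ('k, 'f, 'u, 'v) cocone_map" where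
  "of_cone_map m = (of_cone (fst m),
    \<lambda>X\<in>Ob K. (T0 (of_cone (fst m)) X,
      \<lambda>x\<in>Obj (F0 F X). comps (comps m (x, X)) undefined, T0 (of_cone (tgt m)) X),
    of_cone (tgt m))"

lemma of_cone_map_simps [simp]:
  "fst (of_cone_map m) = of_cone (fst m)" "tgt (of_cone_map m) = of_cone (tgt m)"
  "X \<in> Ob K \<Longrightarrow> x \<in> Obj (F0 F X) \<Longrightarrow>
    comps (comps (of_cone_map m) X) x = comps (comps m (x, X)) undefined"
  by (simp_all add: of_cone_map_def)

text \<open>The equations of the cone map split along the factorization of 1-cells of elements: the
  vertical ones give naturality of each component, the chosen lifts give the modification
  equation.\<close>

lemma modification_of_cone_map:
  assumes l: "lax_trans L Cat (const1 L) GE (fst m)" "lax_trans L Cat (const1 L) GE (tgt m)"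
    and m: "modification L Cat (const1 L) GE (fst m) (tgt m) (comps m)"
  shows "modification K Cat F G (of_cone (fst m)) (of_cone (tgt m)) (comps (of_cone_map m))"
proof -
  note lo = lax_trans_of_cone[OF l(1)] lax_trans_of_cone[OF l(2)]
  have h: "comps (comps m (x, X)) undefined \<in> Hom (F0 G X)
      (fob (T0 (of_cone (fst m)) X) x) (fob (T0 (of_cone (tgt m)) X) x)"
    if "X \<in> Ob K" "x \<in> Obj (F0 F X)" for X x
  proof -
    have "(x, X) \<in> Ob L" using that by (simp add: El_simps(1))
    then show ?thesis
      using m that unfolding cone.modification_cone_iff[OF l] by (auto simp: of_cone_fob GE_simps)
  qed
  have c: "Cmp (F0 GE q) (comps (T1 (tgt m) p q u) undefined)
      (far (F1 GE p q u) (comps (comps m p) undefined)) =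
    Cmp (F0 GE q) (comps (comps m q) undefined) (comps (T1 (fst m) p q u) undefined)"
    if "p \<in> Ob L" "q \<in> Ob L" "u \<in> Obj (Hm L p q)" for p q u
    using m that unfolding cone.modification_cone_iff[OF l] by blast
  show ?thesis
  proof (subst modification_iff[OF lo], intro conjI ballI)
    show "comps (of_cone_map m) \<in> extensional (Ob K)" by (simp add: of_cone_map_def)
  next
    fix X assume X: "X \<in> Ob K"
    have "nat_trans (F0 F X) (F0 G X) (T0 (of_cone (fst m)) X) (T0 (of_cone (tgt m)) X)
      (comps (comps (of_cone_map m) X))"
    proof (rule nat_transI[OF lax_functor[OF lo(1) X] lax_functor[OF lo(2) X]], goal_cases)
      case 1 show ?case using X by (simp add: of_cone_map_def)
    next
      case (2 x) then show ?case using X h by simp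
    next
      case (3 \<phi> x y)
      note v = vertical_El[OF X 3]
      have xy: "x \<in> Obj (F0 F X)" "y \<in> Obj (F0 F X)"
        using category.Hom_Obj[OF F.F0_category[OF X] 3] by auto
      show ?case
        using c[OF v] v(3) xy X HomD(1)[OF h[OF X xy(1)]]
        by (simp add: of_cone_far[OF X 3] GE_simps G.F1_Id1_far[OF X])
    qed
    then show "comps (of_cone_map m) X \<in>
        Hom (fun_cat (F0 F X) (F0 G X)) (T0 (of_cone (fst m)) X) (T0 (of_cone (tgt m)) X)"
      using X by (simp add: Hom_fun_cat of_cone_map_def)
  next
    fix X Y f x assume a: "X \<in> Ob K" "Y \<in> Ob K" "f \<in> Obj (Hm K X Y)" "x \<in> Obj (F0 F X)"
    show "Cmp (F0 G Y) (comps (T1 (of_cone (tgt m)) X Y f) x)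
        (far (F1 G X Y f) (comps (comps (of_cone_map m) X) x)) =
      Cmp (F0 G Y) (comps (comps (of_cone_map m) Y) (fob (F1 F X Y f) x))
        (comps (T1 (of_cone (fst m)) X Y f) x)"
      using c[OF cartesian_El[OF a]] cartesian_El(3)[OF a] a F.F1_fob[OF a]
      by (simp add: of_cone_T1[OF a] GE_simps)
  qed
qed

text \<open>A modification is a triple whose middle entry takes triples as values, so equality is
  checked in two layers, each time with the ends and the extensional range.\<close>

lemma to_cone_map_of_cone_map:
  assumes l: "lax_trans L Cat (const1 L) GE (fst m)" "lax_trans L Cat (const1 L) GE (tgt m)"
    and m: "modification L Cat (const1 L) GE (fst m) (tgt m) (comps m)"
  shows "to_cone_map (of_cone_map m) = m"
proof (rule triple_eqI)
  show "comps (to_cone_map (of_cone_map m)) = comps m"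
  proof (rule extensionalityI)
    show "comps (to_cone_map (of_cone_map m)) \<in> extensional (Ob L)" by (simp add: to_cone_map_def)
    show "comps m \<in> extensional (Ob L)" using cone.mod_ext[OF m l] .
    fix p assume p: "p \<in> Ob L"
    have mp: "fst (comps m p) = T0 (fst m) p" "tgt (comps m p) = T0 (tgt m) p"
      "comps (comps m p) \<in> extensional {undefined}"
      using m p unfolding cone.modification_cone_iff[OF l] by auto
    show "comps (to_cone_map (of_cone_map m)) p = comps m p"
    proof (rule triple_eqI)
      show "comps (comps (to_cone_map (of_cone_map m)) p) = comps (comps m p)"
        by (rule extensionalityI[OF _ mp(3)]) (use p El_ObD[OF p] in \<open>auto simp: to_cone_map_def\<close>)
    qed (use p mp in \<open>simp_all add: to_cone_map_def to_cone_of_cone l\<close>)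
  qed
qed (simp_all add: to_cone_of_cone l)

lemma of_cone_map_to_cone_map:
  assumes l: "lax_trans K Cat F G (fst r)" "lax_trans K Cat F G (tgt r)"
    and m: "modification K Cat F G (fst r) (tgt r) (comps r)"
  shows "of_cone_map (to_cone_map r) = r"
proof (rule triple_eqI)
  show "comps (of_cone_map (to_cone_map r)) = comps r"
  proof (rule extensionalityI)
    show "comps (of_cone_map (to_cone_map r)) \<in> extensional (Ob K)" by (simp add: of_cone_map_def)
    show "comps r \<in> extensional (Ob K)" using mod_ext[OF m l] .
    fix X assume X: "X \<in> Ob K"
    have r: "fst (comps r X) = T0 (fst r) X" "tgt (comps r X) = T0 (tgt r) X"
      "comps (comps r X) \<in> extensional (Obj (F0 F X))"
      using mod_Hom[OF m l X] nat_transD(3) by (auto simp: Hom_fun_cat)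
    show "comps (of_cone_map (to_cone_map r)) X = comps r X"
    proof (rule triple_eqI)
      show "comps (comps (of_cone_map (to_cone_map r)) X) = comps (comps r X)"
        by (rule extensionalityI[OF _ r(3)]) (use X in \<open>auto simp: of_cone_map_def El_simps(1)\<close>)
    qed (use X r in \<open>simp_all add: of_cone_map_def of_cone_to_cone l\<close>)
  qed
qed (simp_all add: of_cone_to_cone l)

section \<open>The isomorphism of categories\<close>

definition cone_fct :: "('k \<Rightarrow> 'k \<Rightarrow> 'f set) \<Rightarrow>
    (('k, 'f, 'u, 'v) cocone, ('k, 'f, 'u, 'v) cocone_map,
     ('u \<times> 'k, 'f \<times> 'v, 'u, 'v) cocone, ('u \<times> 'k, 'f \<times> 'v, 'u, 'v) cocone_map) fct" where
  "cone_fct S = \<lparr>fob = (\<lambda>\<nu>\<in>Obj (Hm (Hom_sigma K S Cat) F G). to_cone \<nu>),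
     far = (\<lambda>r\<in>Arr (Hm (Hom_sigma K S Cat) F G). to_cone_map r)\<rparr>"

lemma cone_fct_simps:
  "\<nu> \<in> Obj (Hm (Hom_sigma K S Cat) F G) \<Longrightarrow> fob (cone_fct S) \<nu> = to_cone \<nu>"
  "r \<in> Arr (Hm (Hom_sigma K S Cat) F G) \<Longrightarrow> far (cone_fct S) r = to_cone_map r"
  by (simp_all add: cone_fct_def del: Hom_sigma_simps)

text \<open>With the round trips on transformations and modifications available, it suffices to
  check functoriality in one direction; \<open>cat_isoI\<close> takes care of the inverse.\<close>

lemma cat_iso_cone_fct:
  assumes S: "\<And>X Y. X \<in> Ob K \<Longrightarrow> Y \<in> Ob K \<Longrightarrow> S X Y \<subseteq> Obj (Hm K X Y)"
  shows "cat_iso (Hm (Hom_sigma K S Cat) F G)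
    (Hm (Hom_sigma L (C_class K S F) Cat) (const1 L) GE) (cone_fct S)" (is "cat_iso ?C ?D _")
proof (rule cat_isoI)
  interpret C: category ?C by (rule category_sigma)
  interpret D: category ?D by (rule cone.category_sigma)
  have to: "to_cone_map r \<in> Arr ?D" "of_cone_map (to_cone_map r) = r" if r: "r \<in> Arr ?C" for r
  proof -
    have s: "sigma_natural K S Cat F G (fst r)" "sigma_natural K S Cat F G (tgt r)"
      and m: "modification K Cat F G (fst r) (tgt r) (comps r)" using r by simp_all
    note l = sigma_natural_lax[OF s(1)] sigma_natural_lax[OF s(2)]
    show "to_cone_map r \<in> Arr ?D" "of_cone_map (to_cone_map r) = r"
      using sigma_natural_to_cone[OF S s(1)] sigma_natural_to_cone[OF S s(2)]
        modification_to_cone_map[OF l m] of_cone_map_to_cone_map[OF l m] by simp_all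
  qed
  have of: "of_cone_map m \<in> Arr ?C" "to_cone_map (of_cone_map m) = m" if m: "m \<in> Arr ?D" for m
  proof -
    have s: "sigma_natural L (C_class K S F) Cat (const1 L) GE (fst m)"
      "sigma_natural L (C_class K S F) Cat (const1 L) GE (tgt m)"
      and m: "modification L Cat (const1 L) GE (fst m) (tgt m) (comps m)" using m by simp_all
    note l = sigma_natural_lax[OF s(1)] sigma_natural_lax[OF s(2)]
    show "of_cone_map m \<in> Arr ?C" "to_cone_map (of_cone_map m) = m"
      using sigma_natural_of_cone[OF S s(1)] sigma_natural_of_cone[OF S s(2)]
        modification_of_cone_map[OF l m] to_cone_map_of_cone_map[OF l m] by simp_all
  qed
  show "cat_functor ?C ?D (cone_fct S)"
  proof (intro cat_functor.intro cat_functor_axioms.intro C.category_axioms D.category_axioms,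
      goal_cases)
    case (3 \<nu>)
    then show ?case using sigma_natural_to_cone[OF S] by (simp add: cone_fct_simps)
  next
    case (4 r \<nu> \<nu>')
    then show ?case
      using to(1)[OF HomD(1)[OF 4]] C.Hom_Obj[OF 4] HomD[OF 4]
      by (auto intro!: HomI simp: cone_fct_simps)
  next
    case (5 \<nu>)
    then have l: "lax_trans K Cat F G \<nu>" using sigma_natural_lax by auto
    have "comps (Id2 Cat (F0 (const1 L) p) (F0 GE p) (T0 (to_cone \<nu>) p)) =
        (\<lambda>z\<in>{undefined}. comps (Id2 Cat (F0 F (snd p)) (F0 G (snd p)) (T0 \<nu> (snd p))) (fst p))"
      if "p \<in> Ob L" for p
      using El_ObD[OF that] to_cone_0[OF that, of \<nu>]
      by (simp add: GE_simps cong: restrict_cong)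
    then show ?case
      using 5 C.Idn_Arr[OF 5] El_ObD
      by (simp add: cone_fct_simps to_cone_map_def del: Hom_sigma_simps(1,2) cong: restrict_cong)
  next
    case (6 r \<nu> \<nu>' s \<nu>'')
    have a: "r \<in> Arr ?C" "s \<in> Arr ?C" "fst r = \<nu>" "tgt r = \<nu>'" "fst s = \<nu>'" "tgt s = \<nu>''"
      using HomD[OF 6(1)] HomD[OF 6(2)] by auto
    show ?case
      using a(1,2) HomD(1)[OF C.Cmp_closed[OF 6]] El_ObD
      by (simp add: cone_fct_simps to_cone_map_def GE_simps a(3-6) del: Hom_sigma_simps(1,2) cong: restrict_cong)
  qed (simp_all add: cone_fct_def)
  show "bij_betw (fob (cone_fct S)) (Obj ?C) (Obj ?D)"
    by (rule bij_betw_byWitness[where f' = of_cone])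
      (auto simp: cone_fct_def sigma_natural_to_cone[OF S] sigma_natural_of_cone[OF S]
        of_cone_to_cone[OF sigma_natural_lax] to_cone_of_cone[OF sigma_natural_lax])
  show "bij_betw (far (cone_fct S)) (Arr ?C) (Arr ?D)"
    by (rule bij_betw_byWitness[where f' = of_cone_map])
      (use to of in \<open>auto simp: cone_fct_simps simp del: Hom_sigma_simps\<close>)
qed

end

section \<open>Compatibility with composition by transformations between targets\<close>

locale elements_pair = E: elements K F G + E': elements K F G'
  for K :: "('k, 'f, 't) twocat" and F G G' :: "('k, 'f, 't, 'u, 'v) weight"
begin

sublocale K3: cat_valued_triple K F G G' ..

sublocale L3: cat_valued_triple "El K F" "const1 (El K F)" E.GE E'.GE ..

text \<open>Here \<eta>E stands for the restriction of \<eta> along the projection. It is described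
  by its values, because in the application it arises from the diagram over the elements. At
  (f,\<phi>) the two sides differ only by functoriality of \<eta> at the target object and by
  associativity.\<close>

lemma to_cone_comp_trans:
  assumes \<nu>: "lax_trans K Cat F G \<nu>" and \<eta>: "lax_trans K Cat G G' \<eta>"
    and \<eta>E: "lax_trans (El K F) Cat E.GE E'.GE \<eta>E"
    and T0: "\<And>p. p \<in> Ob (El K F) \<Longrightarrow> T0 \<eta>E p = T0 \<eta> (snd p)"
    and T1: "\<And>p q u. \<lbrakk>p \<in> Ob (El K F); q \<in> Ob (El K F); u \<in> Obj (Hm (El K F) p q)\<rbrakk> \<Longrightarrow>
      T1 \<eta>E p q u = T1 \<eta> (snd p) (snd q) (fst u)"
  shows "E'.to_cone (comp_trans K Cat F G G' \<eta> \<nu>) =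
    comp_trans (El K F) Cat (const1 (El K F)) E.GE E'.GE \<eta>E (E.to_cone \<nu>)"
proof (rule E'.cone.cone_eqI[OF E'.lax_trans_to_cone[OF K3.lax_trans_comp[OF \<nu> \<eta>]]
    L3.lax_trans_comp[OF E.lax_trans_to_cone[OF \<nu>] \<eta>E]])
  fix p assume p: "p \<in> Ob (El K F)"
  show "fob (T0 (E'.to_cone (comp_trans K Cat F G G' \<eta> \<nu>)) p) undefined =
      fob (T0 (comp_trans (El K F) Cat (const1 (El K F)) E.GE E'.GE \<eta>E (E.to_cone \<nu>)) p) undefined"
    using E.El_ObD[OF p] by (simp add: E'.to_cone_0 E.to_cone_0 K3.comp_trans_T0 L3.comp_trans_T0 T0 p)
next
  fix p q u assume p: "p \<in> Ob (El K F)" and q: "q \<in> Ob (El K F)" and u: "u \<in> Obj (Hm (El K F) p q)"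
  note p' = E.El_ObD[OF p] and q' = E.El_ObD[OF q] and u' = E.F.El_ObjD[OF u]
  interpret \<eta>q: cat_functor "F0 G (snd q)" "F0 G' (snd q)" "T0 \<eta> (snd q)"
    using K3.GH.lax_functor[OF \<eta> q'(1)] .
  note c = E.to_cone_1_closed[OF \<nu> p q u]
  note \<nu>x = cat_functor.fob_closed[OF E.lax_functor[OF \<nu> p'(1)] p'(2)]
  note t = K3.GH.lax_comps[OF \<eta> p'(1) q'(1) u'(1) \<nu>x]
  show "comps (T1 (E'.to_cone (comp_trans K Cat F G G' \<eta> \<nu>)) p q u) undefined =
      comps (T1 (comp_trans (El K F) Cat (const1 (El K F)) E.GE E'.GE \<eta>E (E.to_cone \<nu>)) p q u) undefined"
    using p' q' HomD(1)[OF u'(2)] \<eta>q.far_Cmp[OF c]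
      \<eta>q.D.Cmp_assoc[OF t \<eta>q.far_closed[OF c(1)] \<eta>q.far_closed[OF c(2)]]
    by (simp add: E'.to_cone_1[OF p q u] E.to_cone_1[OF p q u] E.to_cone_0[OF p] K3.comp_trans_T0
        K3.comp_trans_T1[OF \<nu> \<eta> p'(1) q'(1) u'(1)]
        L3.comp_trans_T1[OF E.lax_trans_to_cone[OF \<nu>] \<eta>E p q u] T0 T1[OF p q u] p q E.GE_simps)
qed

text \<open>The ends are handled by \<open>to_cone_comp_trans\<close>. For the middle entries, the
  horizontal composite in \<open>Cat\<close> evaluated at x involves only the x-component of m,
  which is what the cone map stores.\<close>

lemma to_cone_map_comp_trans:
  assumes m: "lax_trans K Cat F G (fst m)" "lax_trans K Cat F G (tgt m)"
      "modification K Cat F G (fst m) (tgt m) (comps m)"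
    and n: "lax_trans K Cat G G' (fst n)" "lax_trans K Cat G G' (tgt n)"
      "modification K Cat G G' (fst n) (tgt n) (comps n)"
    and nE: "lax_trans (El K F) Cat E.GE E'.GE (fst nE)" "lax_trans (El K F) Cat E.GE E'.GE (tgt nE)"
    and T0: "\<And>p. p \<in> Ob (El K F) \<Longrightarrow> T0 (fst nE) p = T0 (fst n) (snd p) \<and>
      T0 (tgt nE) p = T0 (tgt n) (snd p)"
    and T1: "\<And>p q u. \<lbrakk>p \<in> Ob (El K F); q \<in> Ob (El K F); u \<in> Obj (Hm (El K F) p q)\<rbrakk> \<Longrightarrow>
      T1 (fst nE) p q u = T1 (fst n) (snd p) (snd q) (fst u) \<and>
      T1 (tgt nE) p q u = T1 (tgt n) (snd p) (snd q) (fst u)"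
    and comps: "\<And>p. p \<in> Ob (El K F) \<Longrightarrow> comps nE p = comps n (snd p)"
  shows "E'.to_cone_map (Cm2 (Hom_sigma K S Cat) F G G' n m) =
    Cm2 (Hom_sigma (El K F) S' Cat) (const1 (El K F)) E.GE E'.GE nE (E.to_cone_map m)"
proof -
  have f: "E'.to_cone (comp_trans K Cat F G G' (fst n) (fst m)) =
      comp_trans (El K F) Cat (const1 (El K F)) E.GE E'.GE (fst nE) (E.to_cone (fst m))"
    using to_cone_comp_trans[OF m(1) n(1) nE(1)] T0 T1 by blast
  have t: "E'.to_cone (comp_trans K Cat F G G' (tgt n) (tgt m)) =
      comp_trans (El K F) Cat (const1 (El K F)) E.GE E'.GE (tgt nE) (E.to_cone (tgt m))"
    using to_cone_comp_trans[OF m(2) n(2) nE(2)] T0 T1 by blast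
  have c: "comps (E'.to_cone_map (Cm2 (Hom_sigma K S Cat) F G G' n m)) p =
      Cm2 Cat terminal_cat (F0 G (snd p)) (F0 G' (snd p)) (comps nE p) (comps (E.to_cone_map m) p)"
    if p: "p \<in> Ob (El K F)" for p
  proof -
    have h: "fst (comps m (snd p)) = T0 (fst m) (snd p)" "tgt (comps m (snd p)) = T0 (tgt m) (snd p)"
      "fst (comps n (snd p)) = T0 (fst n) (snd p)" "tgt (comps n (snd p)) = T0 (tgt n) (snd p)"
      using E.mod_Hom[OF m(3,1,2) E.El_ObD(1)[OF p]] K3.GH.mod_Hom[OF n(3,1,2) E.El_ObD(1)[OF p]]
      by (simp_all add: Hom_fun_cat)
    show ?thesis
      using p E.El_ObD[OF p] T0[OF p]
      by (simp add: E'.to_cone_map_def E.to_cone_map_def f t comps[OF p] h L3.comp_trans_T0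
          E.to_cone_0[OF p] cong: restrict_cong)
  qed
  show ?thesis
  proof (rule triple_eqI)
    show "comps (E'.to_cone_map (Cm2 (Hom_sigma K S Cat) F G G' n m)) =
        comps (Cm2 (Hom_sigma (El K F) S' Cat) (const1 (El K F)) E.GE E'.GE nE (E.to_cone_map m))"
    proof (rule extensionalityI[where A = "Ob (El K F)"])
      fix p assume p: "p \<in> Ob (El K F)"
      then have "comps (Cm2 (Hom_sigma (El K F) S' Cat) (const1 (El K F)) E.GE E'.GE nE
          (E.to_cone_map m)) p =
        Cm2 Cat terminal_cat (F0 G (snd p)) (F0 G' (snd p)) (comps nE p) (comps (E.to_cone_map m) p)"
        by (simp add: E.GE_simps del: Cat_simps)
      then show "comps (E'.to_cone_map (Cm2 (Hom_sigma K S Cat) F G G' n m)) p =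
          comps (Cm2 (Hom_sigma (El K F) S' Cat) (const1 (El K F)) E.GE E'.GE nE
            (E.to_cone_map m)) p" using c[OF p] by (rule trans[OF _ sym, rotated])
    qed (simp_all add: E'.to_cone_map_def)
  qed (simp_all add: f t)
qed

end

section \<open>Transfer of colimits along natural isomorphisms of cocone categories\<close>

text \<open>By naturality the comparison functor on the second side is \<Phi> after the one on the
  first side. The closure hypotheses \<open>act1\<close> and \<open>act2\<close> allow the converse:
  inverse functors cancel on carriers, so the values of the first comparison functor must be known
  to lie there.\<close>

lemma colim_transfer:
  assumes iso: "cocones_natural_iso B H A W P H' A' W' P' \<Phi>"
    and E: "E \<in> Ob B" and \<nu>: "\<nu> \<in> Obj (cocones H A B W P E)"
    and act1: "\<And>X h. X \<in> Ob B \<Longrightarrow> h \<in> Obj (Hm B E X) \<Longrightarrow>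
      cocone_act1 H A B W P E X h \<nu> \<in> Obj (cocones H A B W P X)"
    and act2: "\<And>X \<tau>. X \<in> Ob B \<Longrightarrow> \<tau> \<in> Arr (Hm B E X) \<Longrightarrow>
      cocone_act2 H A B W P E X \<tau> (Idn (cocones H A B W P E) \<nu>) \<in> Arr (cocones H A B W P X)"
  shows "is_colim H A B W P E \<nu> \<longleftrightarrow> is_colim H' A' B W' P' E (fob (\<Phi> E) \<nu>)" (is ?colim)
    and "is_bicolim H A B W P E \<nu> \<longleftrightarrow> is_bicolim H' A' B W' P' E (fob (\<Phi> E) \<nu>)" (is ?bicolim)
proof -
  let ?C = "cocones H A B W P" and ?D = "cocones H' A' B W' P'"
  let ?I = "induced H A B W P E \<nu>" and ?J = "induced H' A' B W' P' E (fob (\<Phi> E) \<nu>)"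
  have \<Phi>: "cat_iso (?C X) (?D X) (\<Phi> X)" if "X \<in> Ob B" for X
    using iso that unfolding cocones_natural_iso_def by blast
  interpret \<Phi>E: cat_functor "?C E" "?D E" "\<Phi> E" using cat_iso_functor[OF \<Phi>[OF E]] .
  have n1: "fob (\<Phi> X) (cocone_act1 H A B W P E X h \<nu>) = cocone_act1 H' A' B W' P' E X h (fob (\<Phi> E) \<nu>)"
    if "X \<in> Ob B" "h \<in> Obj (Hm B E X)" for X h
    using iso E \<nu> that unfolding cocones_natural_iso_def by blast
  \<comment> \<open>Naturality on arrows is used at the identity of \<nu>, which the functor
    \<open>\<Phi> E\<close> preserves.\<close>
  have n2: "far (\<Phi> X) (cocone_act2 H A B W P E X \<tau> (Idn (?C E) \<nu>)) =
      cocone_act2 H' A' B W' P' E X \<tau> (Idn (?D E) (fob (\<Phi> E) \<nu>))"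
    if "X \<in> Ob B" "\<tau> \<in> Arr (Hm B E X)" for X \<tau>
    using iso E \<Phi>E.C.Idn_Arr[OF \<nu>] \<Phi>E.far_Idn[OF \<nu>] that
    unfolding cocones_natural_iso_def by metis
  have J: "?J X = comp_fct (Hm B E X) (\<Phi> X) (?I X)" if X: "X \<in> Ob B" for X
    using n1[OF X] n2[OF X] by (simp add: induced_def comp_fct_def cong: restrict_cong)
  \<comment> \<open>Both equivalences to be shown are symmetric, so the first comparison functor
    also has to be exhibited as an isomorphism after the second.\<close>
  have "\<exists>\<Psi>. cat_iso (?D X) (?C X) \<Psi> \<and> ?I X = comp_fct (Hm B E X) \<Psi> (?J X)" if X: "X \<in> Ob B" for X
  proof -
    obtain \<Psi> where \<Psi>: "cat_iso (?D X) (?C X) \<Psi>" "comp_fct (?C X) \<Psi> (\<Phi> X) = id_fct (?C X)"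
      using cat_iso_inverse[OF \<Phi>[OF X]] by blast
    have o: "fob \<Psi> (fob (\<Phi> X) x) = x" if "x \<in> Obj (?C X)" for x
      using arg_cong[OF \<Psi>(2), of "\<lambda>F. fob F x"] that by simp
    have a: "far \<Psi> (far (\<Phi> X) f) = f" if "f \<in> Arr (?C X)" for f
      using arg_cong[OF \<Psi>(2), of "\<lambda>F. far F f"] that by simp
    have "?I X = comp_fct (Hm B E X) \<Psi> (?J X)"
      using o[OF act1[OF X]] a[OF act2[OF X]] n1[OF X] n2[OF X]
      by (simp add: induced_def comp_fct_def cong: restrict_cong)
    with \<Psi>(1) show ?thesis by blast
  qed
  then obtain \<Psi> where \<Psi>: "\<And>X. X \<in> Ob B \<Longrightarrow> cat_iso (?D X) (?C X) (\<Psi> X)"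
    and I: "\<And>X. X \<in> Ob B \<Longrightarrow> ?I X = comp_fct (Hm B E X) (\<Psi> X) (?J X)" by metis
  have "cat_iso (Hm B E X) (?C X) (?I X) \<longleftrightarrow> cat_iso (Hm B E X) (?D X) (?J X)" if X: "X \<in> Ob B" for X
    using cat_iso_comp[OF _ \<Phi>[OF X], of "Hm B E X" "?I X"] cat_iso_comp[OF _ \<Psi>[OF X], of "Hm B E X" "?J X"]
    unfolding J[OF X, symmetric] I[OF X, symmetric] by blast
  then show ?colim using E \<nu> \<Phi>E.fob_closed[OF \<nu>] unfolding is_colim_def by blast
  have "cat_equiv (Hm B E X) (?C X) (?I X) \<longleftrightarrow> cat_equiv (Hm B E X) (?D X) (?J X)" if X: "X \<in> Ob B" for X
    using cat_equiv_comp_iso[OF _ \<Phi>[OF X], of "Hm B E X" "?I X"]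
      cat_equiv_comp_iso[OF _ \<Psi>[OF X], of "Hm B E X" "?J X"]
    unfolding J[OF X, symmetric] I[OF X, symmetric] by blast
  then show ?bicolim using E \<nu> \<Phi>E.fob_closed[OF \<nu>] unfolding is_bicolim_def by blast
qed

section \<open>Opposite 2-functors and the diagram over the elements\<close>

lemma two_functor_op:
  assumes "two_functor A B F"
  shows "two_functor (op2 A) (op2 B) (op_twofct F)"
proof -
  interpret two_functor A B F by fact
  show ?thesis
    by (intro two_functor.intro two_functor_axioms.intro two_category_op2 A.two_category_axioms
        B.two_category_axioms)
      (simp_all add: op_twofct_def F0_closed Fh_functor F1_Id1 F1_Cm1 F2_Cm2)
qed

lemma El_diagram_simps:
  "F0 (El_diagram A W P) p = F0 P (snd p)"
  "u \<in> Obj (Hm (El (op2 A) W) p q) \<Longrightarrow> F1 (El_diagram A W P) q p u = F1 P (snd q) (snd p) (fst u)"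
  "c \<in> Arr (Hm (El (op2 A) W) p q) \<Longrightarrow> F2 (El_diagram A W P) q p c = F2 P (snd q) (snd p) (comps c)"
  by (simp_all add: El_diagram_def El_op_def op_twofct_def El_proj_def)

text \<open>On both sides (f,\<phi>) acts by precomposition with Pf, and a 2-cell of elements by
  whiskering with the image under P of its underlying 2-cell. Equality on the nose lets the results
  for G restricted to elements be used without a further comparison.\<close>

lemma hom_into_El:
  "hom_into (El_op A W) B (El_diagram A W P) E =
    comp_twofct (El (op2 A) W) (hom_into A B P E) (El_proj (op2 A) W)"
proof (rule twofct.equality)
  have "Fh (hom_into (El_op A W) B (El_diagram A W P) E) p q =
      Fh (comp_twofct (El (op2 A) W) (hom_into A B P E) (El_proj (op2 A) W)) p q" for p q
  proof (rule fct_eqI[where C = "Hm (El (op2 A) W) p q"])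
    fix u assume u: "u \<in> Obj (Hm (El (op2 A) W) p q)"
    then have "fst u \<in> Obj (Hm A (snd q) (snd p))" by (simp add: El_simps)
    with u show "F1 (hom_into (El_op A W) B (El_diagram A W P) E) p q u =
        F1 (comp_twofct (El (op2 A) W) (hom_into A B P E) (El_proj (op2 A) W)) p q u"
      by (simp add: El_op_def El_diagram_simps El_proj_def)
  next
    fix c assume c: "c \<in> Arr (Hm (El (op2 A) W) p q)"
    then have "fst c \<in> Obj (Hm (El (op2 A) W) p q)" "tgt c \<in> Obj (Hm (El (op2 A) W) p q)"
      "comps c \<in> Hom (Hm A (snd q) (snd p)) (fst (fst c)) (fst (tgt c))"
      by (simp_all add: El_simps(3))
    with c show "F2 (hom_into (El_op A W) B (El_diagram A W P) E) p q c =
        F2 (comp_twofct (El (op2 A) W) (hom_into A B P E) (El_proj (op2 A) W)) p q c"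
      by (simp add: El_op_def El_diagram_simps El_proj_def El_simps(4,5) HomD)
  qed (simp_all add: hom_into_def comp_twofct_def El_op_def fob_comp_fct_ext far_comp_fct_ext)
  then show "Fh (hom_into (El_op A W) B (El_diagram A W P) E) =
      Fh (comp_twofct (El (op2 A) W) (hom_into A B P E) (El_proj (op2 A) W))" by (simp add: fun_eq_iff)
qed (simp_all add: hom_into_def comp_twofct_def El_diagram_simps El_proj_def fun_eq_iff)

section \<open>Weighted colimits as conical colimits\<close>

text \<open>The class is given as a family of sets of 1-cells, a form that fits both the given
  \<Sigma> and the class of all 1-cells.\<close>

locale weighted_diagram = W: cat_valued "op2 A" W + P: diagram A B P
  for A :: "('a, 'f, 't) twocat" and B :: "('b, 'u, 'v) twocat"
    and W :: "('a, 'f, 't, 'u, 'v) weight" and P :: "('a, 'f, 't, 'b, 'u, 'v) twofct" +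
  fixes \<Sigma> :: "'a \<Rightarrow> 'a \<Rightarrow> 'f set"
  assumes \<Sigma>: "X \<in> Ob A \<Longrightarrow> Y \<in> Ob A \<Longrightarrow> \<Sigma> X Y \<subseteq> Obj (Hm A X Y)"
begin

abbreviation "K \<equiv> op2 A"
abbreviation "S \<equiv> op_class \<Sigma>"
abbreviation "G \<equiv> hom_into A B P"
abbreviation "H \<equiv> Hom_sigma K S Cat :: ('a, 'f, 't, 'u, 'v) weight_2cat"
abbreviation "L \<equiv> El K W"
abbreviation "GE X \<equiv> comp_twofct L (G X) (El_proj K W)"
abbreviation "J \<equiv> El_op A W"
abbreviation "Q \<equiv> El_diagram A W P"
abbreviation "k1 \<equiv> const1 (op2 J)"
abbreviation "HJ \<equiv> Hom_sigma_op J (C_Sigma A \<Sigma> W)"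
abbreviation "C \<equiv> cocones H A B W P"
abbreviation "CJ \<equiv> cocones HJ J B k1 Q"
abbreviation "HE \<equiv> Hom_sigma L (C_class K S W) Cat"

lemma S: "X \<in> Ob K \<Longrightarrow> Y \<in> Ob K \<Longrightarrow> S X Y \<subseteq> Obj (Hm K X Y)"
  using \<Sigma> by (simp add: op_class_def)

lemma op2_El_op: "op2 J = L"
  by (simp add: El_op_def op2_op2)

text \<open>Makes the results on B(P-,E) available for the diagram over the elements.\<close>

sublocale PE: diagram J B Q
proof -
  have "two_functor J A (op_twofct (El_proj K W))"
    using two_functor_op[OF W.two_functor_El_proj] by (simp add: El_op_def op2_op2)
  from two_functor_comp[OF this P.P.two_functor_axioms]
  show "diagram J B Q"
    by (intro diagram.intro W.B.two_category_axioms) (simp_all add: El_diagram_def)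
qed

lemma elements_hom_into: "X \<in> Ob B \<Longrightarrow> elements K W (G X)"
  by (intro elements.intro cat_valued_pair.intro W.cat_valued_axioms P.cat_valued_hom_into)

lemma elements_pair_hom_into: "X \<in> Ob B \<Longrightarrow> Y \<in> Ob B \<Longrightarrow> elements_pair K W (G X) (G Y)"
  by (intro elements_pair.intro elements_hom_into)

lemma cocones_W: "C X = Hm H W (G X)"
  by (simp add: cocones_def)

text \<open>The opposites cancel in pairs: \<open>El_op\<close> and \<open>C_Sigma\<close> are
  opposites of the data over which cones were built, and \<open>Hom_sigma_op\<close> takes opposites
  again.\<close>

lemma cocones_El: "CJ X = Hm HE (const1 L) (GE X)"
  by (simp add: cocones_def op2_El_op hom_into_El C_Sigma_def op_class_op_class)

lemma lax_hom_into_El: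
  assumes "X \<in> Ob B" "Y \<in> Ob B" "h \<in> Obj (Hm B X Y)"
  shows "lax_trans L Cat (GE X) (GE Y) (hom_into_trans J B Q X Y h)"
  using PE.lax_trans_hom_into_trans[OF assms] by (simp add: op2_El_op hom_into_El)

text \<open>Supplies the hypotheses of \<open>to_cone_comp_trans\<close> for B(P-,h):
  postcomposition with h depends on an element only through its underlying object.\<close>

lemma hom_into_trans_El:
  assumes "p \<in> Ob L"
  shows "T0 (hom_into_trans J B Q X Y h) p =
      T0 (hom_into_trans A B P X Y h) (snd p)"
    and "q \<in> Ob L \<Longrightarrow> u \<in> Obj (Hm L p q) \<Longrightarrow>
      T1 (hom_into_trans J B Q X Y h) p q u =
      T1 (hom_into_trans A B P X Y h) (snd p) (snd q) (fst u)"
proof -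
  show "T0 (hom_into_trans J B Q X Y h) p =
      T0 (hom_into_trans A B P X Y h) (snd p)"
    using assms by (simp add: hom_into_trans_def El_op_def El_diagram_simps El_simps(1))
  show "T1 (hom_into_trans J B Q X Y h) p q u =
      T1 (hom_into_trans A B P X Y h) (snd p) (snd q) (fst u)"
    if "q \<in> Ob L" and u: "u \<in> Obj (Hm L p q)"
  proof -
    have "snd p \<in> Ob A" "snd q \<in> Ob A" "fst u \<in> Obj (Hm A (snd q) (snd p))"
      using assms that by (simp_all add: El_simps(1,2))
    then show ?thesis
      using assms that
      by (simp add: hom_into_trans_def restrict1_def El_op_def op2_op2 El_diagram_simps)
  qed
qed

text \<open>Together with \<open>act2_closed\<close> this keeps the action of cells of B inside the
  categories of cocones, where \<open>cone_fct\<close> is given by \<open>to_cone\<close> and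
  \<open>to_cone_map\<close>; \<open>colim_transfer\<close> asks for the same.\<close>

lemma act1_closed:
  assumes X: "X \<in> Ob B" "Y \<in> Ob B" "h \<in> Obj (Hm B X Y)"
    and \<nu>: "\<nu> \<in> Obj (C X)"
  shows "cocone_act1 H A B W P X Y h \<nu> \<in> Obj (C Y)"
proof -
  interpret E: elements_pair K W "G X" "G Y" using elements_pair_hom_into X by blast
  show ?thesis
    using E.K3.sigma_natural_comp[OF S, of \<nu> "hom_into_trans A B P X Y h"]
      P.sigma_natural_hom_into_trans[OF X, of S] \<nu> S
    by (simp add: cocones_W cocone_act1_def)
qed

lemma modif_simps [simp]:
  "fst (hom_into_modif A' B' P' X Y \<tau>) = hom_into_trans A' B' P' X Y (Dom (Hm B' X Y) \<tau>)"
  "tgt (hom_into_modif A' B' P' X Y \<tau>) = hom_into_trans A' B' P' X Y (Cod (Hm B' X Y) \<tau>)"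
  by (simp_all add: hom_into_modif_def)

lemma act2_closed:
  assumes X: "X \<in> Ob B" "Y \<in> Ob B" and \<tau>: "\<tau> \<in> Arr (Hm B X Y)"
    and \<rho>: "\<rho> \<in> Arr (C X)"
  shows "cocone_act2 H A B W P X Y \<tau> \<rho> \<in> Arr (C Y)"
proof -
  interpret E: elements_pair K W "G X" "G Y" using elements_pair_hom_into X by blast
  note hh = P.P.B.cell_Obj[OF X Arr_Hom[OF \<tau>]]
  have r: "sigma_natural K S Cat W (G X) (fst \<rho>)" "sigma_natural K S Cat W (G X) (tgt \<rho>)"
    "modification K Cat W (G X) (fst \<rho>) (tgt \<rho>) (comps \<rho>)"
    using \<rho> by (simp_all add: cocones_W)
  have t: "sigma_natural K S Cat (G X) (G Y) (hom_into_trans A B P X Y h)"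
    if "h \<in> Obj (Hm B X Y)" for h
    using P.sigma_natural_hom_into_trans[OF X that, of S] S by simp
  show ?thesis
    using E.K3.sigma_natural_comp[OF S r(1) t[OF hh(1)]] E.K3.sigma_natural_comp[OF S r(2) t[OF hh(2)]]
      E.K3.modification_comp[OF sigma_natural_lax[OF r(1)] sigma_natural_lax[OF r(2)]
        sigma_natural_lax[OF t[OF hh(1)]] sigma_natural_lax[OF t[OF hh(2)]] r(3)
        P.modification_hom_into_modif[OF X Arr_Hom[OF \<tau>]]]
    by (simp add: cocones_W cocone_act2_def del: Cat_simps)
qed

definition \<Phi> where "\<Phi> X = elements.cone_fct K W (G X) S"

text \<open>2-naturality is the compatibility of \<open>to_cone\<close> and
  \<open>to_cone_map\<close> with composition, applied to B(P-,h) and B(P-,\<tau>).\<close>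

lemma natural_iso:
  "cocones_natural_iso B H A W P
    HJ J k1 Q \<Phi>"
  unfolding cocones_natural_iso_def
proof (intro conjI ballI)
  fix X assume X: "X \<in> Ob B"
  show "cat_iso (C X)
      (CJ X) (\<Phi> X)"
    unfolding cocones_W cocones_El \<Phi>_def using elements.cat_iso_cone_fct[OF elements_hom_into[OF X] S] .
next
  fix X Y h \<nu>
  assume X: "X \<in> Ob B" "Y \<in> Ob B" and h: "h \<in> Obj (Hm B X Y)"
    and \<nu>: "\<nu> \<in> Obj (C X)"
  interpret E: elements_pair K W "G X" "G Y" using elements_pair_hom_into X by blast
  have l: "lax_trans K Cat W (G X) \<nu>" using \<nu> sigma_natural_lax by (auto simp: cocones_W)
  show "fob (\<Phi> Y) (cocone_act1 H A B W P X Y h \<nu>) =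
      cocone_act1 HJ J B k1 Q X Y h (fob (\<Phi> X) \<nu>)"
    using E.to_cone_comp_trans[OF l P.lax_trans_hom_into_trans[OF X h] lax_hom_into_El[OF X h]
        hom_into_trans_El]
      E.E.cone_fct_simps(1)[OF \<nu>[unfolded cocones_W]]
      E.E'.cone_fct_simps(1)[OF act1_closed[OF X h \<nu>, unfolded cocones_W]]
    by (simp add: \<Phi>_def cocone_act1_def op2_El_op hom_into_El)
next
  fix X Y \<tau> \<rho>
  assume X: "X \<in> Ob B" "Y \<in> Ob B" and \<tau>: "\<tau> \<in> Arr (Hm B X Y)"
    and \<rho>: "\<rho> \<in> Arr (C X)"
  interpret E: elements_pair K W "G X" "G Y" using elements_pair_hom_into X by blast
  note hh = P.P.B.cell_Obj[OF X Arr_Hom[OF \<tau>]]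
  have r: "lax_trans K Cat W (G X) (fst \<rho>)" "lax_trans K Cat W (G X) (tgt \<rho>)"
    "modification K Cat W (G X) (fst \<rho>) (tgt \<rho>) (comps \<rho>)"
    using \<rho> sigma_natural_lax by (auto simp: cocones_W)
  let ?n = "hom_into_modif A B P X Y \<tau>"
    and ?nE = "hom_into_modif J B Q X Y \<tau>"
  have "E.E'.to_cone_map (Cm2 H W (G X) (G Y) ?n \<rho>) =
      Cm2 HE (const1 L) (GE X) (GE Y) ?nE (E.E.to_cone_map \<rho>)"
  proof (rule E.to_cone_map_comp_trans[OF r])
    show "lax_trans K Cat (G X) (G Y) (fst ?n)" "lax_trans K Cat (G X) (G Y) (tgt ?n)"
      using P.lax_trans_hom_into_trans[OF X] hh by simp_all
    show "modification K Cat (G X) (G Y) (fst ?n) (tgt ?n) (comps ?n)"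
      using P.modification_hom_into_modif[OF X Arr_Hom[OF \<tau>]] by simp
    show "lax_trans L Cat (GE X) (GE Y) (fst ?nE)" "lax_trans L Cat (GE X) (GE Y) (tgt ?nE)"
      using lax_hom_into_El[OF X] hh by simp_all
  next
    fix p assume p: "p \<in> Ob L"
    show "T0 (fst ?nE) p = T0 (fst ?n) (snd p) \<and> T0 (tgt ?nE) p = T0 (tgt ?n) (snd p)"
      using hom_into_trans_El(1)[OF p] by simp
    show "comps ?nE p = comps ?n (snd p)"
      using p by (simp add: hom_into_modif_def El_op_def El_diagram_simps El_simps(1))
  qed (simp add: hom_into_trans_El)
  then show "far (\<Phi> Y) (cocone_act2 H A B W P X Y \<tau> \<rho>) =
      cocone_act2 HJ J B k1 Q X Y \<tau> (far (\<Phi> X) \<rho>)"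
    using E.E.cone_fct_simps(2)[OF \<rho>[unfolded cocones_W]]
      E.E'.cone_fct_simps(2)[OF act2_closed[OF X \<tau> \<rho>, unfolded cocones_W]]
    by (simp add: \<Phi>_def cocone_act2_def op2_El_op hom_into_El C_Sigma_def op_class_op_class
        del: Hom_sigma_simps Cat_simps)
qed

lemma colim_iff:
  assumes E: "E \<in> Ob B" and \<nu>: "\<nu> \<in> Obj (C E)"
  shows "sigma_colim A \<Sigma> B W P E \<nu> \<longleftrightarrow>
      sigma_colim J (C_Sigma A \<Sigma> W) B k1 Q E (fob (\<Phi> E) \<nu>)" (is ?colim)
    and "sigma_bicolim A \<Sigma> B W P E \<nu> \<longleftrightarrow>
      sigma_bicolim J (C_Sigma A \<Sigma> W) B k1 Q E (fob (\<Phi> E) \<nu>)" (is ?bicolim)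
proof -
  interpret E: elements K W "G E" using elements_hom_into[OF E] .
  have i: "Idn (C E) \<nu> \<in> Arr (C E)"
    using category.Idn_Arr[OF E.category_sigma] \<nu> unfolding cocones_W by blast
  note t = colim_transfer[OF natural_iso E \<nu> act1_closed[OF E _ _ \<nu>] act2_closed[OF E _ _ i]]
  show ?colim unfolding sigma_colim_def by (rule t(1))
  show ?bicolim unfolding sigma_bicolim_def by (rule t(2))
qed

end

section \<open>The pseudonatural case\<close>

lemma Hom_p_eq_Hom_sigma: "Hom_p K D = Hom_sigma K (\<lambda>X Y. Obj (Hm K X Y)) D"
proof -
  have "pseudonatural K D = sigma_natural K (\<lambda>X Y. Obj (Hm K X Y)) D"
    by (simp add: fun_eq_iff pseudonatural_def sigma_natural_def)
  then show ?thesis by (simp add: Hom_p_def Hom_sigma_def)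
qed

lemma Hom_p_op_eq: "Hom_p_op A = Hom_sigma_op A (\<lambda>X Y. Obj (Hm A X Y))"
  by (simp add: Hom_p_eq_Hom_sigma op_class_def[abs_def])

text \<open>The first entry of a 1-cell of elements is by definition a 1-cell of the base, so for
  the class of all 1-cells the extra condition in \<open>C_class\<close> always holds.\<close>

lemma C_W_eq: "C_W A W = C_Sigma A (\<lambda>X Y. Obj (Hm A X Y)) W"
  by (auto simp: fun_eq_iff C_W_def C_Sigma_def op_class_def C_class_def C_all_def El_simps(2))

text \<open>\<open>\<Phi> E\<close> is an isomorphism of categories, so each conical cocone is
  \<open>fob (\<Phi> E) \<nu>\<close> for exactly one \<nu>. Quantifying over \<nu> therefore covers
  all cocones on both sides.\<close>

theorem theorem2p4p10:
  fixes A :: "('a, 'f, 't) twocat" and B :: "('b, 'u, 'v) twocat"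
    and \<Sigma> :: "'a \<Rightarrow> 'a \<Rightarrow> 'f set"
    and W :: "('a, 'f, 't, 'u, 'v) weight" and P :: "('a, 'f, 't, 'b, 'u, 'v) twofct"
  assumes "two_category A" and "two_category B"
    and "wide_subcat A \<Sigma>"
    and "two_functor (op2 A) Cat W" and "two_functor A B P"
  shows "(\<exists>\<Phi>.
      cocones_natural_iso B (Hom_sigma_op A \<Sigma>) A W P
        (Hom_sigma_op (El_op A W) (C_Sigma A \<Sigma> W)) (El_op A W)
        (const1 (op2 (El_op A W))) (El_diagram A W P) \<Phi> \<and>
      (\<forall>E\<in>Ob B. \<forall>\<nu>\<in>Obj (cocones (Hom_sigma_op A \<Sigma>) A B W P E).
        (sigma_colim A \<Sigma> B W P E \<nu> \<longleftrightarrow>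
         sigma_colim (El_op A W) (C_Sigma A \<Sigma> W) B (const1 (op2 (El_op A W)))
           (El_diagram A W P) E (fob (\<Phi> E) \<nu>)) \<and>
        (sigma_colim A \<Sigma> B W P E \<nu> \<longleftrightarrow>
         conical_sigma_colim (El_op A W) (C_Sigma A \<Sigma> W) B
           (El_diagram A W P) E (fob (\<Phi> E) \<nu>)) \<and>
        (sigma_bicolim A \<Sigma> B W P E \<nu> \<longleftrightarrow>
         sigma_bicolim (El_op A W) (C_Sigma A \<Sigma> W) B (const1 (op2 (El_op A W)))
           (El_diagram A W P) E (fob (\<Phi> E) \<nu>)) \<and>
        (sigma_bicolim A \<Sigma> B W P E \<nu> \<longleftrightarrow>
         conical_sigma_bicolim (El_op A W) (C_Sigma A \<Sigma> W) B
           (El_diagram A W P) E (fob (\<Phi> E) \<nu>)))) \<and>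
    (\<exists>\<Psi>.
      cocones_natural_iso B (Hom_p_op A) A W P
        (Hom_sigma_op (El_op A W) (C_W A W)) (El_op A W)
        (const1 (op2 (El_op A W))) (El_diagram A W P) \<Psi> \<and>
      (\<forall>E\<in>Ob B. \<forall>\<nu>\<in>Obj (cocones (Hom_p_op A) A B W P E).
        (pseudo_colim A B W P E \<nu> \<longleftrightarrow>
         conical_sigma_colim (El_op A W) (C_W A W) B
           (El_diagram A W P) E (fob (\<Psi> E) \<nu>)) \<and>
        (pseudo_bicolim A B W P E \<nu> \<longleftrightarrow>
         conical_sigma_bicolim (El_op A W) (C_W A W) B
           (El_diagram A W P) E (fob (\<Psi> E) \<nu>))))"
proof -
  let ?all = "\<lambda>X Y. Obj (Hm A X Y)"
  \<comment> \<open>The locale \<open>diagram\<close> requires \<open>Cat\<close> to be a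
    2-category; this is extracted from the assumption that W is a 2-functor into it.\<close>
  have D: "cat_valued (op2 A) W" "diagram A B P"
    using assms(4,5) by (auto intro: cat_valued.intro diagram.intro two_functor.axioms(2))
  interpret S: weighted_diagram A B W P \<Sigma>
    using D assms(3) by (intro weighted_diagram.intro weighted_diagram_axioms.intro)
      (auto simp: wide_subcat_def)
  interpret T: weighted_diagram A B W P ?all
    using D by (intro weighted_diagram.intro weighted_diagram_axioms.intro) auto
  show ?thesis
    unfolding pseudo_colim_def pseudo_bicolim_def conical_sigma_colim_def conical_sigma_bicolim_def
      Hom_p_op_eq C_W_eq
    by (rule conjI[OF exI[of _ S.\<Phi>] exI[of _ T.\<Phi>]])
      (use S.natural_iso S.colim_iff T.natural_iso T.colim_iff[unfolded sigma_colim_def sigma_bicolim_def]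
        in \<open>simp_all add: sigma_colim_def sigma_bicolim_def\<close>)
qed

end
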